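(* Let $d\ge1$, let $\zeta$ be the Riemann zeta function, and let $g$ be a real-valued function with $$g\in L^\infty(\mathbb{R}^d)\cap C(\mathbb{R}^d)\quad\text{and}\quad\inf_{x\in\mathbb{R}^d}|g(x)-1|>0 .$$ Let $S=\sup_{x\in\mathbb{R}^d}g(x)$ and $I=\inf_{x\in\mathbb{R}^d}g(x)$, and let $u$ be the local solution of $$\partial_tu(t,x)=\Delta u(t,x)+\zeta(u(t,x)),\quad x\in\mathbb{R}^d,\ t\ge0,\qquad u(0,x)=g(x).$$ Then $u$ is global in time and the following hold. (i) If $I>1$, then for all $t\ge0$ and $x\in\mathbb{R}^d$, $\ t+I\le u(t,x)\le\zeta(I)\,t+S$. (ii) If $I<1$, then for all $t\ge0$ and $x\in\mathbb{R}^d$, $\ -2k_1\le u(t,x)\le-2k_2$, where $k_1,k_2$ are defined by $$-2k_1:=\max\{-2k\le I\ |\ k\in\mathbb{N}\},\qquad -2k_2:=\begin{cases}\inf\{-2k\ge S\ |\ k\in\mathbb{N}\},& S\le-2,\\ S,& S>-2.\end{cases}$$ (iii) Additionally, if $I<1$ and if $n_1$ and $n_2$ are the unique positive integers such that $I\in(-4n_1,-4n_1+4)$ and $S\in(-4n_2,-4n_2+4)$ respectively, then for all $x\in\mathbb{R}^d$ $$-4n_1+2\le\liminf_{t\to\infty}u(t,x)\le\limsup_{t\to\infty}u(t,x)\le-4n_2+2 .$$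
   Context: $\mathbb{N}=\{1,2,3,\dots\}$. The zeta function has a unique pole at $s=1$. The local solution is the unique solution in $C([0,T);L^\infty(\mathbb{R}^d;\mathbb{C})\cap C(\mathbb{R}^d;\mathbb{C}))$, up to its maximal time of existence, in the Duhamel sense $u(t)=e^{t\Delta}g+\int_0^te^{(t-s)\Delta}\zeta(u(s))\,ds$, where $e^{t\Delta}$ is convolution with the heat kernel $(4\pi t)^{-d/2}e^{-|x|^2/(4t)}$. Global in time means that the maximal time of existence is $+\infty$.
   Formalization: If g is not uniformly continuous, no solution lies in C([0,T);L^∞∩C), since e^{tΔ}g does not tend to g in sup norm; for such g, sup-norm continuity at t=0 only is replaced by local boundedness and locally uniform convergence u(t)→g. *)

theory Defs
  imports "HOL-Analysis.Analysis"
begin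

(* The value at the pole is irrelevant; it is fixed only so that the description is unique. *)
definition riemann_zeta :: "complex \<Rightarrow> complex" where
  "riemann_zeta = (THE f. f holomorphic_on - {1} \<and>
     (\<forall>s. Re s > 1 \<longrightarrow> (\<lambda>n. 1 / of_nat (Suc n) powr s) sums f s) \<and> f 1 = 0)"

definition heat_kernel :: "real \<Rightarrow> real ^ 'n \<Rightarrow> real" where
  "heat_kernel t x =
     (4 * pi * t) powr (- real CARD('n) / 2) * exp (- (norm x)\<^sup>2 / (4 * t))"

definition heat_semigroup ::
    "real \<Rightarrow> (real ^ 'n \<Rightarrow> complex) \<Rightarrow> real ^ 'n \<Rightarrow> complex" where
  "heat_semigroup t f x =
     (if t = 0 then f x else (LINT y|lborel. heat_kernel t (x - y) *\<^sub>R f y))"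

(* The bounded continuous functions are the space called L^\<infinity> \<inter> C, with the sup norm.
   If g is uniformly continuous, solution_curve is membership in C([0,T); L^\<infinity> \<inter> C).
   If g is bounded and continuous but not uniformly continuous, then exp(t\<Delta>)g does not
   converge to g in the sup norm as t \<rightarrow> 0, so that no solution is norm continuous at t = 0;
   only there, norm continuity is replaced by boundedness and locally uniform convergence,
   which exp(t\<Delta>)g does have. *)
definition solution_curve ::
    "(real ^ 'n \<Rightarrow> complex) \<Rightarrow> ereal \<Rightarrow> (real \<Rightarrow> ((real ^ 'n) \<Rightarrow>\<^sub>C complex)) \<Rightarrow> bool" where
  "solution_curve g T u \<longleftrightarrow>
     (if uniformly_continuous_on UNIV g
      then continuous_on {t. 0 \<le> t \<and> ereal t < T} u
      else continuous_on {t. 0 < t \<and> ereal t < T} u \<and>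
           (\<forall>t. 0 \<le> t \<and> ereal t < T \<longrightarrow> bounded (u ` {0..t})) \<and>
           (\<forall>K. compact K \<longrightarrow> uniform_limit K (\<lambda>t. apply_bcontfun (u t)) g (at_right 0)))"

(* The second conjunct keeps u away from the pole of zeta, locally uniformly in time; it is what
   makes zeta(u(s)) an element of L^\<infinity> \<inter> C, and with it both integrals of the Duhamel
   formula converge absolutely. *)
definition mild_solution ::
    "(real ^ 'n \<Rightarrow> complex) \<Rightarrow> ereal \<Rightarrow> (real \<Rightarrow> ((real ^ 'n) \<Rightarrow>\<^sub>C complex)) \<Rightarrow> bool" where
  "mild_solution g T u \<longleftrightarrow>
     0 < T \<and> solution_curve g T u \<and>
     (\<forall>t. 0 \<le> t \<and> ereal t < T \<longrightarrow>
        (\<exists>\<delta>>0. \<forall>s\<in>{0..t}. \<forall>x. \<delta> \<le> cmod (apply_bcontfun (u s) x - 1))) \<and>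
     (\<forall>t x. 0 \<le> t \<and> ereal t < T \<longrightarrow>
        apply_bcontfun (u t) x = heat_semigroup t g x +
          (LINT s:{0..t}|lborel.
             heat_semigroup (t - s) (\<lambda>y. riemann_zeta (apply_bcontfun (u s) y)) x))"

(* T is the maximal time of existence, and u is the unique solution on [0,T). *)
definition local_solution ::
    "(real ^ 'n \<Rightarrow> complex) \<Rightarrow> ereal \<Rightarrow> (real \<Rightarrow> ((real ^ 'n) \<Rightarrow>\<^sub>C complex)) \<Rightarrow> bool" where
  "local_solution g T u \<longleftrightarrow>
     mild_solution g T u \<and>
     (\<forall>T' v. mild_solution g T' v \<longrightarrow>
        T' \<le> T \<and> (\<forall>t. 0 \<le> t \<and> ereal t < T' \<longrightarrow> v t = u t))"

end

theory Submission
  imports Defs "HOL-Complex_Analysis.Complex_Analysis" "HOL-Probability.Probability" "HOL-Real_Asymp.Real_Asymp"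
begin

text \<open>
  On the real line, zeta is at least 1 and decreasing to the right of its pole, negative on (-2, 1),
  and changes sign exactly at the negative even integers further to the left.  So every -2k is an
  equilibrium of the ordinary differential equation v' = zeta(v), and the equilibrium -4n + 2 attracts
  the whole interval (-4n, -4n + 4).  Solutions of this ordinary differential equation are the spatially
  constant solutions of the partial differential equation.  Since the data are bounded away from the pole
  and R^d is connected, the data lie on one side of 1, and comparison with spatially constant barriers
  gives all three assertions; it also keeps the solution in a region where zeta is bounded and Lipschitz,
  which is why the solution is global.

  The zeta function.  The series of errors of the trapezoid rule continues zeta to Re s > -1 (zeta_right).
  For s = -a with 0 < a < 1, each error is a Laplace integral with nonnegative integrand; summed over
  the nodes it contains coth(w/2)/2 - 1/w, and the partial fractions of coth turn the integral into a
  multiple of the Dirichlet series at 1 + a.  This is the functional equation on (-1, 0)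
  (zeta_right_functional_equation); all interchanges are instances of Tonelli's theorem.  The right-hand
  side of the functional equation is holomorphic on Re s < 0 and so continues zeta to the whole plane
  without 1.  It shows that zeta(x) is a positive multiple of sin(pi x / 2) for x < 0
  (real_zeta_negative_axis), whence the signs.

  The equation.  Let F be bounded and L-Lipschitz; later F is zeta with its argument clamped to the range
  that the barriers allow.  F need not be monotone, so the Duhamel formula for F does not respect the
  order.  Adding L u on both sides gives the Duhamel formula for the damped semigroup exp(-L t) exp(t Laplace)
  and the nondecreasing function F(u) + L u.  In the unknown exp(-2 L t) u its right-hand side is a
  contraction in the supremum norm over all times (damped_solution_exists), and its monotonicity gives the
  comparison principle (damped_solution_ge_subsolution).  The semigroup law removes the damping again
  (mild_change_damping).  The barriers confine the solution to the range where F is zeta, so it solves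
  the original equation (mild_solution_of_real_solution).

  A Gronwall argument shows that any two complex-valued mild solutions agree as long as both exist
  (mild_solution_unique).  Hence the global real solution is the local solution, and its
  maximal time of existence is infinite.  For the limits in (iii), barriers that relax exponentially to a
  point just short of the equilibrium are used (lower_asymptotics).
\<close>

section \<open>Continuation of zeta by the trapezoid rule\<close>

text \<open>
  The error of the trapezoid rule for x^(-s) on [n, n + 1].  Its integral term is evaluated by the
  antiderivative x^(1-s) / (1 - s), so the expression makes sense for complex s.
\<close>
definition trapezoid_error :: "nat \<Rightarrow> complex \<Rightarrow> complex" where
  "trapezoid_error n s = (of_nat n powr (-s) + of_nat (Suc n) powr (-s)) / 2
     - (of_nat (Suc n) powr (1 - s) - of_nat n powr (1 - s)) / (1 - s)"

text \<open>
  The trapezoid rule is exact on polynomials of degree 1, so its error is governed by the second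
  derivative s (s + 1) x^(-s-2).  Combining the Taylor expansions at n of the integrand and of its
  antiderivative, all terms of lower order cancel.
\<close>
lemma norm_trapezoid_error_le:
  assumes s: "s \<noteq> 1" "Re s > -2" and n: "n \<ge> 1"
  shows "cmod (trapezoid_error n s) \<le> cmod (s * (s + 1)) * real n powr (- Re s - 2)"
proof -
  \<comment> \<open>an antiderivative of z^(-s), followed by z^(-s) and its first two derivatives\<close>
  define f :: "nat \<Rightarrow> complex \<Rightarrow> complex" where
    "f = (\<lambda>i z. if i = 0 then z powr (1 - s) / (1 - s) else if i = 1 then z powr (-s)
            else if i = 2 then - s * z powr (-s - 1) else s * (s + 1) * z powr (- s - 2))"
  define B where "B = cmod (s * (s + 1)) * real n powr (- Re s - 2)"
  define A :: "complex set" where "A = closed_segment (of_nat n) (of_nat (Suc n))"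
  have A: "\<exists>x\<ge>real n. z = of_real x" if "z \<in> A" for z
  proof -
    have "A = of_real ` closed_segment (real n) (real (Suc n))"
      unfolding A_def closed_segment_of_real[symmetric] of_real_of_nat_eq ..
    then have "z \<in> of_real ` closed_segment (real n) (real (Suc n))" using that by simp
    then show ?thesis by (auto simp: closed_segment_eq_real_ivl)
  qed
  have nonpos: "z \<notin> \<real>\<^sub>\<le>\<^sub>0" "z \<noteq> 0" if "z \<in> A" for z
  proof -
    obtain x where x: "x \<ge> real n" "z = of_real x" using A[OF \<open>z \<in> A\<close>] by blast
    show "z \<notin> \<real>\<^sub>\<le>\<^sub>0" "z \<noteq> 0" unfolding x(2) complex_nonpos_Reals_iff of_real_eq_0_iff
      using x(1) n by simp_all
  qed
  have deriv: "(f i has_field_derivative f (Suc i) z) (at z within A)" if "z \<in> A" "i \<le> 2" for i z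
  proof -
    have d: "((\<lambda>z. z powr r) has_field_derivative r * z powr (r - 1)) (at z within A)" for r :: complex
      using has_field_derivative_powr[OF nonpos(1)[OF that(1)], of r] has_field_derivative_at_within by blast
    consider "i = 0" | "i = 1" | "i = 2" using \<open>i \<le> 2\<close> by linarith
    then show ?thesis
    proof cases
      case 1
      show ?thesis using DERIV_cdivide[OF d[of "1-s"], of "1-s"] s by (simp add: 1 f_def)
    next
      case 2
      show ?thesis using d[of "-s"] by (simp add: 2 f_def)
    next
      case 3
      show ?thesis using DERIV_cmult[OF d[of "-s-1"], of "-s"] 
        by (simp add: 3 f_def numeral_2_eq_2 algebra_simps)
    qed
  qed
  have bound: "cmod (f 3 z) \<le> B" if z: "z \<in> A" for z
  proof -
    obtain x where x: "x \<ge> real n" "z = of_real x" using A[OF z] by blast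
    have "cmod (z powr (- s - 2)) = x powr (- Re s - 2)"
      using x n by (simp add: norm_powr_real_powr)
    also have "\<dots> \<le> real n powr (- Re s - 2)"
      using x n s by (intro powr_mono2') auto
    finally show ?thesis by (simp add: f_def B_def norm_mult mult_left_mono)
  qed
  have conv: "convex A" by (simp add: A_def)
  have mem: "of_nat n \<in> A" "of_nat (Suc n) \<in> A" by (auto simp: A_def)
  have 1: "cmod (f 0 (of_nat (Suc n)) - (f 0 (of_nat n) + f 1 (of_nat n) + f 2 (of_nat n) / 2)) \<le> B / 2"
    using complex_Taylor[of A 2 f B "of_nat n" "of_nat (Suc n)", OF conv deriv] bound mem
    by (simp add: numeral_2_eq_2 numeral_3_eq_3)
  have 2: "cmod (f 1 (of_nat (Suc n)) - (f 1 (of_nat n) + f 2 (of_nat n))) \<le> B"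
  proof -
    have "cmod ((\<lambda>i. f (Suc i)) 0 (of_nat (Suc n)) - (\<Sum>i\<le>1. (\<lambda>i. f (Suc i)) i (of_nat n) * (of_nat (Suc n) - of_nat n) ^ i / fact i))
        \<le> B * cmod (of_nat (Suc n) - of_nat n) ^ Suc 1 / fact 1"
      by (rule complex_Taylor[OF conv]) (use deriv bound mem in \<open>auto simp: numeral_3_eq_3\<close>)
    then show ?thesis by (simp add: numeral_2_eq_2)
  qed
  have "trapezoid_error n s = (f 1 (of_nat (Suc n)) - (f 1 (of_nat n) + f 2 (of_nat n))) / 2
      - (f 0 (of_nat (Suc n)) - (f 0 (of_nat n) + f 1 (of_nat n) + f 2 (of_nat n) / 2))"
    by (simp add: trapezoid_error_def f_def add_divide_distrib diff_divide_distrib)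
  also have "cmod \<dots> \<le> B / 2 + B / 2"
    by (rule norm_triangle_le_diff) (use 1 2 in \<open>simp add: norm_divide add_mono\<close>)
  finally show ?thesis by (simp add: B_def)
qed

lemma trapezoid_error_of_real:
  assumes "x \<noteq> 1"
  shows "trapezoid_error n (of_real x) = of_real ((real n powr (- x) + real (Suc n) powr (- x)) / 2
     - (real (Suc n) powr (1 - x) - real n powr (1 - x)) / (1 - x))"
proof -
  have p: "complex_of_real u powr of_real v = of_real (u powr v)" if "u \<ge> 0" for u v :: real
    using that by (simp add: powr_of_real)
  have "trapezoid_error n (of_real x) = (of_real (real n) powr of_real (- x) + of_real (real (Suc n)) powr of_real (- x)) / 2
     - (of_real (real (Suc n)) powr of_real (1 - x) - of_real (real n) powr of_real (1 - x)) / of_real (1 - x)"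
    by (simp add: trapezoid_error_def)
  also have "\<dots> = of_real ((real n powr (- x) + real (Suc n) powr (- x)) / 2
     - (real (Suc n) powr (1 - x) - real n powr (1 - x)) / (1 - x))"
    by (subst p, simp)+ simp
  finally show ?thesis .
qed

text \<open>
  The Euler-Maclaurin formula for the sum of n^(-s), to first order: the integral of x^(-s) over [1,
  \<infinity>) is 1 / (s - 1), half the first term is 1 / 2, and the remainder is the series of
  trapezoid errors, which converges for Re s > -1.
\<close>
definition zeta_right :: "complex \<Rightarrow> complex" where
  "zeta_right s = 1 / (s - 1) + 1 / 2 + (\<Sum>n. trapezoid_error (Suc n) s)"

lemma summable_trapezoid_error:
  assumes "s \<noteq> 1" "Re s > -1"
  shows "summable (\<lambda>n. trapezoid_error (Suc n) s)"
proof (rule summable_comparison_test')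
  have "summable (\<lambda>n. real n powr (- Re s - 2))"
    using assms by (subst summable_real_powr_iff) auto
  then have "summable (\<lambda>n. real (Suc n) powr (- Re s - 2))" by (subst summable_Suc_iff)
  then show "summable (\<lambda>n. cmod (s * (s + 1)) * real (Suc n) powr (- Re s - 2))"
    by (rule summable_mult)
  show "norm (trapezoid_error (Suc n) s) \<le> cmod (s * (s + 1)) * real (Suc n) powr (- Re s - 2)" if "n \<ge> 0" for n
    by (rule norm_trapezoid_error_le) (use assms in auto)
qed

lemma holomorphic_zeta_right: "zeta_right holomorphic_on {s. Re s > -1} - {1}"
proof -
  let ?S = "{s. Re s > -1} - {1}"
  have op: "open ?S" by (intro open_Diff open_halfspace_Re_gt) auto
  have "(\<lambda>s. \<Sum>n. trapezoid_error (Suc n) s) holomorphic_on ?S"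
  proof (rule holomorphic_uniform_sequence[OF op])
    show "(\<lambda>s. \<Sum>i<n. trapezoid_error (Suc i) s) holomorphic_on ?S" for n
      unfolding trapezoid_error_def by (intro holomorphic_intros) auto
    fix x assume x: "x \<in> ?S"
    obtain d where d: "d > 0" "cball x d \<subseteq> ?S" using op x open_contains_cball by blast
    obtain e where e: "e > 0" "\<And>s. s \<in> cball x d \<Longrightarrow> Re s \<ge> -1 + e"
    proof -
      have "compact (Re ` cball x d)" by (intro compact_continuous_image continuous_intros) auto
      then obtain m where m: "m \<in> Re ` cball x d" "\<And>r. r \<in> Re ` cball x d \<Longrightarrow> m \<le> r"
        using compact_attains_inf[of "Re ` cball x d"] d(1) by auto
      show ?thesis by (rule that[of "m + 1"]) (use m d in auto)
    qed
    define R where "R = cmod x + d"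
    have R: "cmod s \<le> R" if "s \<in> cball x d" for s
      using that norm_triangle_ineq[of "s - x" x] by (auto simp: R_def dist_norm norm_minus_commute)
    have "uniform_limit (cball x d) (\<lambda>n s. \<Sum>i<n. trapezoid_error (Suc i) s) (\<lambda>s. \<Sum>n. trapezoid_error (Suc n) s) sequentially"
    proof (rule Weierstrass_m_test)
      have "summable (\<lambda>n. real n powr (- 1 - e))"
        using e by (subst summable_real_powr_iff) auto
      then have "summable (\<lambda>n. real (Suc n) powr (- 1 - e))" by (subst summable_Suc_iff)
      then show "summable (\<lambda>n. (R * (R + 1)) * real (Suc n) powr (- 1 - e))"
        by (rule summable_mult)
      fix n s assume s: "s \<in> cball x d"
      have "cmod (trapezoid_error (Suc n) s) \<le> cmod (s * (s + 1)) * real (Suc n) powr (- Re s - 2)"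
        by (rule norm_trapezoid_error_le) (use d s in auto)
      also have "\<dots> \<le> (R * (R + 1)) * real (Suc n) powr (- 1 - e)"
      proof (rule mult_mono)
        have "cmod (s + 1) \<le> R + 1" using R[OF s] norm_triangle_ineq[of s 1] by simp
        then show "cmod (s * (s + 1)) \<le> R * (R + 1)"
          unfolding norm_mult by (rule mult_mono[OF R[OF s]]) (use R[OF s] order_trans[OF norm_ge_zero R[OF s]] in auto)
        show "real (Suc n) powr (- Re s - 2) \<le> real (Suc n) powr (- 1 - e)"
          using e(2)[OF s] by (intro powr_mono) auto
        have "R \<ge> 0" using order_trans[OF norm_ge_zero R[OF s]] .
        then show "0 \<le> R * (R + 1)" by auto
      qed auto
      finally show "norm (trapezoid_error (Suc n) s) \<le> (R * (R + 1)) * real (Suc n) powr (- 1 - e)" .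
    qed
    then show "\<exists>d>0. cball x d \<subseteq> ?S \<and> uniform_limit (cball x d) (\<lambda>n s. \<Sum>i<n. trapezoid_error (Suc i) s) (\<lambda>s. \<Sum>n. trapezoid_error (Suc n) s) sequentially"
      using d by blast
  qed
  then show ?thesis unfolding zeta_right_def by (intro holomorphic_intros) auto
qed

lemma sum_trapezoid_error:
  assumes "s \<noteq> 1"
  shows "(\<Sum>n<N. trapezoid_error (Suc n) s) = (\<Sum>n<N. 1 / of_nat (Suc n) powr s) - 1 / 2 + of_nat (Suc N) powr (-s) / 2
           - (of_nat (Suc N) powr (1 - s) - 1) / (1 - s)"
proof (induction N)
  case 0
  then show ?case by simp
next
  case (Suc N)
  show ?case
    unfolding sum.lessThan_Suc Suc.IH
    by (simp add: trapezoid_error_def powr_minus inverse_eq_divide add_divide_distrib diff_divide_distrib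
        del: of_nat_Suc)
qed

lemma zeta_right_sums:
  assumes s: "Re s > 1"
  shows "(\<lambda>n. 1 / of_nat (Suc n) powr s) sums zeta_right s"
proof -
  have s1: "s \<noteq> 1" using s by auto
  have lim: "(\<lambda>N. of_nat (Suc N) powr (-z) :: complex) \<longlonglongrightarrow> 0" if "Re z > 0" for z
    using LIMSEQ_Suc[OF tendsto_neg_powr_complex_of_nat[of "\<lambda>n. n" sequentially "-z"]] that
    by (auto simp: filterlim_ident)
  have "(\<lambda>N. (\<Sum>n<N. trapezoid_error (Suc n) s) + 1 / 2 - of_nat (Suc N) powr (-s) / 2
           + (of_nat (Suc N) powr (-(s - 1)) - 1) / (1 - s)) \<longlonglongrightarrow> (\<Sum>n. trapezoid_error (Suc n) s) + 1 / 2 - 0 / 2 + (0 - 1) / (1 - s)"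
    by (intro tendsto_intros lim summable_LIMSEQ summable_trapezoid_error) (use s s1 in auto)
  also have "(\<Sum>n. trapezoid_error (Suc n) s) + 1 / 2 - 0 / 2 + (0 - 1) / (1 - s) = zeta_right s"
    using minus_divide_right[of 1 "1 - s"] by (simp add: zeta_right_def)
  also have "(\<lambda>N. (\<Sum>n<N. trapezoid_error (Suc n) s) + 1 / 2 - of_nat (Suc N) powr (-s) / 2
           + (of_nat (Suc N) powr (-(s - 1)) - 1) / (1 - s)) = (\<lambda>N. \<Sum>n<N. 1 / of_nat (Suc n) powr s)"
    using s1 by (simp add: sum_trapezoid_error)
  finally show ?thesis by (simp add: sums_def)
qed

section \<open>Integrals for the functional equation\<close>

lemma nn_integral_exp_powr:
  fixes s y :: real
  assumes "s > 0" "y > 0"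
  shows "(\<integral>\<^sup>+w. ennreal (w powr (s - 1) * exp (- (y * w))) * indicator {0<..} w \<partial>lborel) = ennreal (Gamma s * y powr (- s))"
proof -
  define f :: "real \<Rightarrow> ennreal" where "f = (\<lambda>t. ennreal (indicator {0..} t * t powr (s - 1) / exp t))"
  have [measurable]: "f \<in> borel_measurable borel" unfolding f_def by measurable
  have "ennreal (Gamma s) = (\<integral>\<^sup>+t. f t \<partial>lborel)"
    unfolding f_def by (rule Gamma_conv_nn_integral_real[OF assms(1)])
  also have "\<dots> = ennreal \<bar>y\<bar> * (\<integral>\<^sup>+t. f (0 + y * t) \<partial>lborel)"
    by (rule nn_integral_real_affine) (use assms in auto)
  also have "(\<integral>\<^sup>+t. f (0 + y * t) \<partial>lborel)
     = (\<integral>\<^sup>+w. ennreal (y powr (s - 1)) * (ennreal (w powr (s - 1) * exp (- (y * w))) * indicator {0<..} w) \<partial>lborel)"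
  proof (rule nn_integral_cong_AE)
    have "AE t in lborel. t \<noteq> (0::real)" by (rule AE_lborel_singleton)
    then show "AE x in lborel. f (0 + y * x) = ennreal (y powr (s - 1)) * (ennreal (x powr (s - 1) * exp (- (y * x))) * indicator {0<..} x)"
    proof eventually_elim
      case (elim x)
      then show ?case using assms
        by (cases "x > 0") (auto simp: f_def indicator_def zero_le_mult_iff powr_mult exp_minus ennreal_mult'[symmetric] field_simps)
    qed
  qed
  also have "\<dots> = ennreal (y powr (s - 1)) * (\<integral>\<^sup>+w. ennreal (w powr (s - 1) * exp (- (y * w))) * indicator {0<..} w \<partial>lborel)"
    by (rule nn_integral_cmult) measurable
  finally have *: "ennreal (Gamma s) = ennreal (y powr s) * (\<integral>\<^sup>+w. ennreal (w powr (s - 1) * exp (- (y * w))) * indicator {0<..} w \<partial>lborel)"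
    using assms by (simp add: mult.assoc[symmetric] ennreal_mult'[symmetric] powr_mult_base)
  have "ennreal (y powr (-s)) * ennreal (Gamma s) = (\<integral>\<^sup>+w. ennreal (w powr (s - 1) * exp (- (y * w))) * indicator {0<..} w \<partial>lborel)"
    unfolding * using assms
    by (simp add: mult.assoc[symmetric] ennreal_mult'[symmetric] powr_add[symmetric])
  then show ?thesis using assms by (simp add: ennreal_mult'[symmetric] mult.commute Gamma_real_pos_exp)
qed

text \<open>
  The substitution y = w^2 in the Gamma integral, on compact intervals first and then, by monotone
  convergence, on the half line.
\<close>
lemma nn_integral_exp_square_powr:
  fixes a v :: real
  assumes "a < 1" "v > 0"
  shows "(\<integral>\<^sup>+w. ennreal (w powr (- a) * exp (- (v * w\<^sup>2))) * indicator {0<..} w \<partial>lborel)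
     = ennreal (Gamma ((1 - a) / 2) / 2 * v powr ((a - 1) / 2))"
proof -
  define s where "s = (1 - a) / 2"
  define f :: "real \<Rightarrow> ennreal" where "f = (\<lambda>y. ennreal (y powr (s - 1) * exp (- (v * y))) * indicator {0<..} y)"
  define h :: "real \<Rightarrow> ennreal" where "h = (\<lambda>w. ennreal (w powr (- a) * exp (- (v * w\<^sup>2))) * indicator {0<..} w)"
  have [measurable]: "f \<in> borel_measurable borel" "h \<in> borel_measurable borel"
    unfolding f_def h_def by measurable
  have eq: "(\<integral>\<^sup>+y. f y * indicator {0..real n ^ 2} y \<partial>lborel) = (\<integral>\<^sup>+w. 2 * h w * indicator {0..real n} w \<partial>lborel)" for n :: nat
  proof (cases "n = 0")
    case True
    have "f y * indicator {0..real n ^ 2} y = 0" "2 * h y * indicator {0..real n} y = 0" for y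
      by (auto simp: True f_def h_def indicator_def)
    then show ?thesis by (simp only:)
  next
    case False
    have "(\<integral>\<^sup>+y. f y * indicator {0 ^ 2..real n ^ 2} y \<partial>lborel) = (\<integral>\<^sup>+w. f (w ^ 2) * ennreal (2 * w) * indicator {0..real n} w \<partial>lborel)"
      by (rule nn_integral_substitution_aux[where g = "\<lambda>w. w ^ 2"])
        (use False in \<open>auto intro!: derivative_eq_intros continuous_intros\<close>)
    also have "\<dots> = (\<integral>\<^sup>+w. 2 * h w * indicator {0..real n} w \<partial>lborel)"
    proof (rule nn_integral_cong)
      fix w :: real
      have "f (w ^ 2) * ennreal (2 * w) = 2 * h w" if "w > 0"
      proof -
        have "(w ^ 2) powr (s - 1) * w = w powr (2 * (s - 1)) * w powr 1"
          using that by (simp add: powr_powr flip: powr_numeral)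
        also have "\<dots> = w powr (- a)" unfolding powr_add[symmetric] by (simp add: s_def field_simps)
        finally have *: "(w ^ 2) powr (s - 1) * w = w powr (- a)" .
        have "f (w ^ 2) * ennreal (2 * w) = ennreal (2 * ((w ^ 2) powr (s - 1) * w) * exp (- (v * w\<^sup>2)))"
          using that by (simp add: f_def ennreal_mult'[symmetric] mult_ac)
        also have "\<dots> = 2 * h w" unfolding * using that by (simp add: h_def ennreal_mult' mult_ac)
        finally show ?thesis .
      qed
      then show "f (w ^ 2) * ennreal (2 * w) * indicator {0..real n} w = 2 * h w * indicator {0..real n} w"
        by (cases "w > 0") (auto simp: indicator_def h_def f_def)
    qed
    finally show ?thesis by simp
  qed
  have lim: "(\<integral>\<^sup>+y. g y \<partial>lborel) = (SUP n. \<integral>\<^sup>+y. g y * indicator {0..r n} y \<partial>lborel)"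
    if [measurable]: "g \<in> borel_measurable borel" and r: "incseq r" "filterlim r at_top sequentially" 
      and g: "\<And>y. y \<le> 0 \<Longrightarrow> g y = 0" for g :: "real \<Rightarrow> ennreal" and r :: "nat \<Rightarrow> real"
  proof -
    have "(SUP n. g y * indicator {0..r n} y) = g y" for y
    proof (cases "y > 0")
      case True
      obtain n where "y \<le> r n"
        using r(2) unfolding filterlim_at_top eventually_sequentially by blast
      then have "g y * indicator {0..r n} y = g y" using True by simp
      then show ?thesis
        by (intro antisym SUP_least) (auto simp: indicator_def intro: SUP_upper2[of n])
    qed (use g in auto)
    then have "(\<integral>\<^sup>+y. g y \<partial>lborel) = (\<integral>\<^sup>+y. (SUP n. g y * indicator {0..r n} y) \<partial>lborel)" by simp
    also have "\<dots> = (SUP n. \<integral>\<^sup>+y. g y * indicator {0..r n} y \<partial>lborel)"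
    proof (rule nn_integral_monotone_convergence_SUP)
      show "incseq (\<lambda>n y. g y * indicator {0..r n} y)"
        using r(1) by (auto simp: incseq_def le_fun_def indicator_def intro: order_trans)
    qed measurable
    finally show ?thesis .
  qed
  have r1: "filterlim (\<lambda>n. real n ^ 2) at_top sequentially" "incseq (\<lambda>n. real n ^ 2)"
    by real_asymp (auto simp: incseq_def intro: power_mono)
  have r2: "filterlim real at_top sequentially" "incseq real"
    by real_asymp (auto simp: incseq_def)
  have "ennreal (Gamma s * v powr (- s)) = (\<integral>\<^sup>+y. f y \<partial>lborel)"
    unfolding f_def by (rule nn_integral_exp_powr[symmetric]) (use assms in \<open>auto simp: s_def\<close>)
  also have "\<dots> = (SUP n. \<integral>\<^sup>+y. f y * indicator {0..real n ^ 2} y \<partial>lborel)"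
    by (rule lim[OF _ r1(2,1)]) (auto simp: f_def)
  also have "\<dots> = (SUP n. \<integral>\<^sup>+w. 2 * h w * indicator {0..real n} w \<partial>lborel)" unfolding eq ..
  also have "\<dots> = (\<integral>\<^sup>+w. 2 * h w \<partial>lborel)"
    by (rule lim[OF _ r2(2,1), symmetric]) (auto simp: h_def)
  also have "\<dots> = 2 * (\<integral>\<^sup>+w. h w \<partial>lborel)" by (rule nn_integral_cmult) measurable
  finally have *: "2 * (\<integral>\<^sup>+w. h w \<partial>lborel) = ennreal (Gamma s * v powr (- s))" by simp
  have half: "ennreal (1/2) * 2 = 1"
    using ennreal_mult'[of 2 "1/2", symmetric] by (simp add: mult.commute)
  have "(\<integral>\<^sup>+w. h w \<partial>lborel) = ennreal (1/2) * (2 * (\<integral>\<^sup>+w. h w \<partial>lborel))"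
    by (simp only: mult.assoc[symmetric] half mult_1_left)
  also have "\<dots> = ennreal (Gamma s / 2 * v powr (- s))"
    unfolding * by (subst ennreal_mult'[symmetric]) auto
  finally show ?thesis unfolding h_def s_def by (simp add: minus_divide_left)
qed

lemma Gamma_reflection_real:
  fixes x :: real
  shows "Gamma x * Gamma (1 - x) = pi / sin (pi * x)"
proof -
  have "complex_of_real (Gamma x * Gamma (1 - x)) = Gamma (of_real x) * Gamma (1 - of_real x)"
    by (simp flip: Gamma_complex_of_real)
  also have "\<dots> = of_real pi / sin (of_real pi * of_real x)" by (rule Gamma_reflection_complex)
  also have "\<dots> = complex_of_real (pi / sin (pi * x))"
    by (simp add: sin_of_real[symmetric])
  finally show ?thesis by (simp only: of_real_eq_iff)
qed

text \<open>
  Writing 1 / (w^2 + b^2) as the integral of exp(-v (w^2 + b^2)) over v > 0 and integrating first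
  over w yields a product Gamma((1 + a)/2) Gamma((1 - a)/2), which the reflection formula evaluates.
\<close>
lemma nn_integral_powr_over_square_plus:
  fixes a b :: real
  assumes a: "0 < a" "a < 1" and b: "b > 0"
  shows "(\<integral>\<^sup>+w. ennreal (w powr (- a) / (w\<^sup>2 + b\<^sup>2)) * indicator {0<..} w \<partial>lborel)
     = ennreal (b powr (- a - 1) * pi / (2 * cos (pi * a / 2)))"
proof -
  define K where "K = (\<lambda>w v. ennreal (w powr (- a) * exp (- (v * w\<^sup>2)) * exp (- (v * b\<^sup>2))) * indicator {0<..} w * indicator {0<..} v)"
  have K[measurable]: "case_prod K \<in> borel_measurable (lborel \<Otimes>\<^sub>M lborel)"
    unfolding K_def by measurable
  have inner_v: "(\<integral>\<^sup>+v. K w v \<partial>lborel) = ennreal (w powr (- a) / (w\<^sup>2 + b\<^sup>2)) * indicator {0<..} w" for w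
  proof (cases "w > 0")
    case True
    then have p: "w\<^sup>2 + b\<^sup>2 > 0" using b by (simp add: add_pos_pos)
    have "(\<integral>\<^sup>+v. K w v \<partial>lborel) = (\<integral>\<^sup>+v. ennreal (w powr (- a)) * (ennreal (v powr (1 - 1) * exp (- ((w\<^sup>2 + b\<^sup>2) * v))) * indicator {0<..} v) \<partial>lborel)"
      using True by (intro nn_integral_cong)
        (auto simp: K_def indicator_def ennreal_mult'[symmetric] exp_add[symmetric] algebra_simps)
    also have "\<dots> = ennreal (w powr (- a)) * ennreal (Gamma 1 * (w\<^sup>2 + b\<^sup>2) powr (- 1))"
      by (subst nn_integral_cmult, measurable) (subst nn_integral_exp_powr[of 1, OF _ p], auto)
    also have "\<dots> = ennreal (w powr (- a) / (w\<^sup>2 + b\<^sup>2))"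
      using p by (simp add: ennreal_mult'[symmetric] powr_minus divide_inverse)
    finally show ?thesis using True by simp
  qed (simp add: K_def)
  have inner_w: "(\<integral>\<^sup>+w. K w v \<partial>lborel) = ennreal (Gamma ((1 - a) / 2) / 2) * (ennreal (v powr ((1 + a) / 2 - 1) * exp (- (b\<^sup>2 * v))) * indicator {0<..} v)" for v
  proof (cases "v > 0")
    case True
    have "(\<integral>\<^sup>+w. K w v \<partial>lborel) = (\<integral>\<^sup>+w. ennreal (exp (- (v * b\<^sup>2))) * (ennreal (w powr (- a) * exp (- (v * w\<^sup>2))) * indicator {0<..} w) \<partial>lborel)"
      using True by (intro nn_integral_cong)
        (auto simp: K_def indicator_def ennreal_mult'[symmetric] mult_ac)
    also have "\<dots> = ennreal (exp (- (v * b\<^sup>2))) * ennreal (Gamma ((1 - a) / 2) / 2 * v powr ((a - 1) / 2))"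
      by (subst nn_integral_cmult, measurable) (subst nn_integral_exp_square_powr[OF a(2) True], auto)
    also have "(a - 1) / 2 = (1 + a) / 2 - 1" by (simp add: field_simps)
    finally show ?thesis using True a by (simp add: ennreal_mult'[symmetric] mult_ac Gamma_real_pos)
  qed (simp add: K_def)
  have "(\<integral>\<^sup>+w. ennreal (w powr (- a) / (w\<^sup>2 + b\<^sup>2)) * indicator {0<..} w \<partial>lborel) = (\<integral>\<^sup>+w. \<integral>\<^sup>+v. K w v \<partial>lborel \<partial>lborel)"
    unfolding inner_v ..
  also have "\<dots> = (\<integral>\<^sup>+v. \<integral>\<^sup>+w. K w v \<partial>lborel \<partial>lborel)"
    by (rule lborel_pair.Fubini'[symmetric]) measurable
  also have "\<dots> = ennreal (Gamma ((1 - a) / 2) / 2) * ennreal (Gamma ((1 + a) / 2) * (b\<^sup>2) powr (- ((1 + a) / 2)))"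
    unfolding inner_w using a b
    by (subst nn_integral_cmult, measurable) (subst nn_integral_exp_powr, auto)
  also have "\<dots> = ennreal ((Gamma ((1 + a) / 2) * Gamma (1 - (1 + a) / 2)) / 2 * b powr (- a - 1))"
  proof -
    have 1: "(b\<^sup>2) powr (- ((1 + a) / 2)) = b powr (- a - 1)"
    proof -
      have "2 * (- ((1 + a) / 2)) = - a - 1" by (simp add: field_simps)
      then show ?thesis using b by (simp only: powr_powr flip: powr_numeral)
    qed
    have 2: "1 - (1 + a) / 2 = (1 - a) / 2" by (simp add: field_simps)
    show ?thesis unfolding 1 2 using a by (simp add: ennreal_mult'[symmetric] mult_ac)
  qed
  also have "Gamma ((1 + a) / 2) * Gamma (1 - (1 + a) / 2) = pi / sin (pi * ((1 + a) / 2))"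
    by (rule Gamma_reflection_real)
  also have "sin (pi * ((1 + a) / 2)) = cos (pi * a / 2)"
    using sin_cos_eq[of "pi * ((1 + a) / 2)"] by (subst cos_minus[symmetric]) (simp add: field_simps)
  finally show ?thesis by (simp add: mult_ac)
qed

text \<open>
  The product formula of the sine at an imaginary argument.
\<close>
lemma sinh_product_formula:
  fixes x :: real
  assumes "x \<noteq> 0"
  shows "(\<lambda>n. \<Prod>k=1..n. 1 + x\<^sup>2 / real k ^ 2) \<longlonglongrightarrow> sinh (pi * x) / (pi * x)"
proof -
  have "(\<lambda>n. of_real pi * (\<i> * of_real x) * (\<Prod>k=1..n. 1 - (\<i> * of_real x)^2 / of_nat k^2)) \<longlonglongrightarrow> sin (of_real pi * (\<i> * of_real x))"
    by (rule sin_product_formula_complex)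
  also have "(\<lambda>n. of_real pi * (\<i> * of_real x) * (\<Prod>k=1..n. 1 - (\<i> * of_real x)^2 / of_nat k^2)) 
     = (\<lambda>n. \<i> * complex_of_real (pi * x * (\<Prod>k=1..n. 1 + x^2 / of_nat k^2)))"
    by (simp add: power_mult_distrib mult_ac)
  also have "sin (of_real pi * (\<i> * of_real x)) = \<i> * complex_of_real (sinh (pi * x))"
  proof -
    have "complex_of_real (sinh (pi * x)) = sinh (of_real (pi * x))"
      by (simp add: sinh_field_def exp_of_real[symmetric])
    also have "\<dots> = -\<i> * sin (of_real pi * (\<i> * of_real x))"
      unfolding sinh_conv_sin by (simp add: mult_ac)
    finally show ?thesis by simp
  qed
  finally have "(\<lambda>n. -\<i> * (\<i> * complex_of_real (pi * x * (\<Prod>k=1..n. 1 + x^2 / of_nat k^2)))) \<longlonglongrightarrow> -\<i> * (\<i> * complex_of_real (sinh (pi * x)))"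
    by (rule tendsto_mult_left)
  then have "(\<lambda>n. complex_of_real (pi * x * (\<Prod>k=1..n. 1 + x^2 / of_nat k^2))) \<longlonglongrightarrow> complex_of_real (sinh (pi * x))"
    by (simp add: mult.assoc[symmetric])
  then have "(\<lambda>n. pi * x * (\<Prod>k=1..n. 1 + x^2 / of_nat k^2)) \<longlonglongrightarrow> sinh (pi * x)"
    by (simp only: tendsto_of_real_iff)
  from tendsto_divide[OF this tendsto_const[of "pi * x"]] assms show ?thesis by simp
qed

text \<open>
  The logarithmic derivative of the product formula of sinh.  The value is coth(w/2) / 2 - 1 / w,
  written in exp(-w) because it arises from a geometric series below.
\<close>
lemma coth_partial_fractions:
  fixes w :: real
  assumes w: "w > 0"
  shows "(\<lambda>k. 2 * w / (w\<^sup>2 + (2 * pi * real (Suc k))\<^sup>2)) sums ((1 + exp (- w)) / (2 * (1 - exp (- w))) - 1 / w)"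
proof -
  define x where "x = w / (2 * pi)"
  have x: "x > 0" using w by (simp add: x_def)
  \<comment> \<open>with w = 2 pi x, the factors of the product formula become 1 + x^2 / k^2\<close>
  define f where "f = (\<lambda>k y. ln (1 + y\<^sup>2 / real (Suc k) ^ 2))"
  define f' where "f' = (\<lambda>k y. 2 * y / (y\<^sup>2 + real (Suc k) ^ 2))"
  have pos: "1 + y\<^sup>2 / real (Suc k) ^ 2 > 0" for y k by (simp add: add_pos_nonneg)
  have sums: "(\<lambda>k. f k y) sums ln (sinh (pi * y) / (pi * y))" if y: "y > 0" for y
  proof -
    have "(\<lambda>n. ln (\<Prod>k=1..n. 1 + y\<^sup>2 / real k ^ 2)) \<longlonglongrightarrow> ln (sinh (pi * y) / (pi * y))"
      using y by (intro tendsto_ln sinh_product_formula) auto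
    also have "(\<lambda>n. ln (\<Prod>k=1..n. 1 + y\<^sup>2 / real k ^ 2)) = (\<lambda>n. \<Sum>k<n. f k y)"
    proof
      fix n
      have "(\<Prod>k=1..n. 1 + y\<^sup>2 / real k ^ 2) = (\<Prod>k<n. 1 + y\<^sup>2 / real (Suc k) ^ 2)"
        by (rule prod.reindex_bij_witness[of _ Suc "\<lambda>k. k - 1"]) auto
      also have "ln \<dots> = (\<Sum>k<n. f k y)"
        unfolding f_def by (rule ln_prod[OF finite_lessThan]) (use pos[THEN less_imp_neq] in \<open>metis\<close>)
      finally show "ln (\<Prod>k=1..n. 1 + y\<^sup>2 / real k ^ 2) = (\<Sum>k<n. f k y)" .
    qed
    finally show ?thesis by (simp add: sums_def)
  qed
  have unif: "uniformly_convergent_on {0<..<x + 1} (\<lambda>n y. \<Sum>i<n. f' i y)"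
  proof (rule Weierstrass_m_test')
    have "summable (\<lambda>n. 1 / real (Suc n) ^ 2)"
      using inverse_power_summable[of 2] by (subst summable_Suc_iff) (simp add: inverse_eq_divide)
    then show "summable (\<lambda>n. 2 * (x + 1) * (1 / real (Suc n) ^ 2))" by (rule summable_mult)
    fix n y assume y: "y \<in> {0<..<x + 1}"
    have "2 * y / (y\<^sup>2 + real (Suc n) ^ 2) \<le> 2 * (x + 1) / real (Suc n) ^ 2"
      using y by (intro frac_le) auto
    then show "norm (f' n y) \<le> 2 * (x + 1) * (1 / real (Suc n) ^ 2)"
      using y by (simp add: f'_def add_nonneg_nonneg del: of_nat_Suc)
  qed
  have deriv: "(f k has_field_derivative f' k y) (at y within {0<..<x + 1})" for k y
  proof -
    define K where "K = real (Suc k) ^ 2"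
    have K: "K > 0" by (simp add: K_def)
    have d1: "((\<lambda>y. 1 + y\<^sup>2 / K) has_real_derivative 2 * y / K) (at y)"
      using K by (auto intro!: derivative_eq_intros)
    have "((\<lambda>y. ln (1 + y\<^sup>2 / K)) has_real_derivative 1 / (1 + y\<^sup>2 / K) * (2 * y / K)) (at y)"
      using DERIV_chain2[OF DERIV_ln_divide d1] pos[of y k] by (simp add: K_def)
    also have "1 / (1 + y\<^sup>2 / K) * (2 * y / K) = f' k y"
    proof -
      have "(1 + y\<^sup>2 / K) * K = y\<^sup>2 + K" using K by (simp add: distrib_right)
      then show ?thesis by (simp add: f'_def K_def)
    qed
    finally show ?thesis unfolding f_def K_def by (rule has_field_derivative_at_within)
  qed
  have "((\<lambda>y. \<Sum>k. f k y) has_field_derivative (\<Sum>k. f' k x)) (at x)"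
    by (rule has_field_derivative_series'(2)[OF _ deriv unif, of x]) 
      (use x sums[OF x] in \<open>auto simp: sums_iff\<close>)
  moreover have "((\<lambda>y. \<Sum>k. f k y) has_field_derivative pi * cosh (pi * x) / sinh (pi * x) - 1 / x) (at x)"
  proof (rule DERIV_cong_ev[THEN iffD1, OF refl _ refl])
    show "\<forall>\<^sub>F y in nhds x. ln (sinh (pi * y) / (pi * y)) = (\<Sum>k. f k y)"
      using eventually_nhds_in_open[of "{0<..}" x] x
      by (auto elim!: eventually_mono dest!: sums simp: sums_iff)
    have s: "sinh (pi * x) > 0" using x by simp
    show "((\<lambda>y. ln (sinh (pi * y) / (pi * y))) has_field_derivative pi * cosh (pi * x) / sinh (pi * x) - 1 / x) (at x)"
      using x s by (auto intro!: derivative_eq_intros simp: field_simps)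
  qed
  ultimately have eq: "(\<Sum>k. f' k x) = pi * cosh (pi * x) / sinh (pi * x) - 1 / x"
    by (rule DERIV_unique)
  have "summable (\<lambda>k. f' k x)"
    using uniformly_convergent_imp_convergent[OF unif, of x] x by (simp add: summable_iff_convergent)
  with eq have "(\<lambda>k. f' k x) sums (pi * cosh (pi * x) / sinh (pi * x) - 1 / x)"
    by (simp add: sums_iff)
  then have "(\<lambda>k. 1 / (2 * pi) * f' k x) sums (1 / (2 * pi) * (pi * cosh (pi * x) / sinh (pi * x) - 1 / x))"
    by (rule sums_mult)
  also have "(\<lambda>k. 1 / (2 * pi) * f' k x) = (\<lambda>k. 2 * w / (w\<^sup>2 + (2 * pi * real (Suc k))\<^sup>2))"
  proof
    fix k
    have "w = 2 * pi * x" by (simp add: x_def)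
    have "2 * w / (w\<^sup>2 + (2 * pi * real (Suc k))\<^sup>2) = (4 * pi * x) / ((4 * pi\<^sup>2) * (x\<^sup>2 + real (Suc k) ^ 2))"
      unfolding \<open>w = 2 * pi * x\<close> by (simp add: power_mult_distrib distrib_left del: of_nat_Suc)
    also have "\<dots> = 1 / (2 * pi) * f' k x"
      by (simp add: f'_def power2_eq_square)
    finally show "1 / (2 * pi) * f' k x = 2 * w / (w\<^sup>2 + (2 * pi * real (Suc k))\<^sup>2)" ..
  qed
  also have "1 / (2 * pi) * (pi * cosh (pi * x) / sinh (pi * x) - 1 / x) = (1 + exp (- w)) / (2 * (1 - exp (- w))) - 1 / w"
  proof -
    have e: "exp (- w) = exp (- (w / 2)) * exp (- (w / 2))" by (simp add: exp_add[symmetric])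
    have "cosh (w / 2) / sinh (w / 2) = (exp (w / 2) + exp (- (w / 2))) / (exp (w / 2) - exp (- (w / 2)))"
    proof -
      have "(p / 2) / (q / 2) = p / q" for p q :: real by simp
      then show ?thesis unfolding cosh_field_def sinh_field_def .
    qed
    also have "\<dots> = (exp (- (w / 2)) * (exp (w / 2) + exp (- (w / 2)))) / (exp (- (w / 2)) * (exp (w / 2) - exp (- (w / 2))))"
      by simp
    also have "\<dots> = (1 + exp (- w)) / (1 - exp (- w))"
      unfolding e by (simp add: distrib_left right_diff_distrib exp_add[symmetric])
    finally have c: "cosh (w / 2) / sinh (w / 2) = (1 + exp (- w)) / (1 - exp (- w))" .
    have p: "pi * x = w / 2" by (simp add: x_def)
    have "1 / (2 * pi) * (pi * cosh (pi * x) / sinh (pi * x) - 1 / x) = (cosh (w / 2) / sinh (w / 2)) / 2 - 1 / w"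
      unfolding p using w by (simp add: x_def field_simps)
    then show ?thesis unfolding c by simp
  qed
  finally show ?thesis .
qed

text \<open>
  Two integrations by parts: the trapezoid error is the integral of t (1 - t) / 2, the Peano kernel
  of the rule, against the second derivative.  For n = 0 the derivatives are singular at the left
  end point, but the antiderivative is continuous there, which suffices for the fundamental theorem.
\<close>
lemma trapezoid_error_powr_has_integral:
  fixes a :: real and n :: nat
  assumes a: "0 < a" "a < 1"
  shows "((\<lambda>t. t * (1 - t) / 2 * (a * (1 - a) * (real n + t) powr (a - 2))) has_integral
     ((real (Suc n) powr (1 + a) - real n powr (1 + a)) / (1 + a) - (real n powr a + real (Suc n) powr a) / 2)) {0..1}"
proof -
  \<comment> \<open>in the first term, t (n + t)^(a-1) is written as (n + t)^a - n (n + t)^(a-1), which is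
    continuous at t = 0 also for n = 0\<close>
  define G where "G = (\<lambda>t. - (1 - t) * a / 2 * ((real n + t) powr a - real n * (real n + t) powr (a - 1))
     + (1 - 2 * t) / 2 * (real n + t) powr a + (real n + t) powr (1 + a) / (1 + a))"
  have "((\<lambda>t. t * (1 - t) / 2 * (a * (1 - a) * (real n + t) powr (a - 2))) has_integral G 1 - G 0) {0..1}"
  proof (rule fundamental_theorem_of_calculus_interior)
    have c: "continuous_on {0..1} (\<lambda>t. real n * (real n + t) powr (a - 1))"
    proof (cases "n = 0")
      case False
      then show ?thesis by (intro continuous_intros) auto
    qed simp
    have c': "continuous_on {0..1} (\<lambda>t. (real n + t) powr r)" if "r > 0" for r
      using that by (intro continuous_on_powr' continuous_intros) auto
    have cG: "continuous_on {0..1} (\<lambda>t. - (1 - t) * a / 2 * (P t - Q t) + (1 - 2 * t) / 2 * P t + R t / (1 + a))"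
      if "continuous_on {0..1} P" "continuous_on {0..1} Q" "continuous_on {0..1} R" for P Q R :: "real \<Rightarrow> real"
      by (intro continuous_intros that) (use a in auto)
    show "continuous_on {0..1} G" unfolding G_def
      by (rule cG[OF c' c c']) (use a in auto)
    fix t :: real assume t: "t \<in> {0<..<1}"
    define x where "x = real n + t"
    have x: "x > 0" using t by (simp add: x_def add_nonneg_pos)
    have p: "x powr a = x\<^sup>2 * x powr (a - 2)" "x powr (a - 1) = x * x powr (a - 2)"
      using x powr_add[of x 2 "a - 2"] powr_add[of x 1 "a - 2"] by (auto simp: powr_numeral)
    have d: "((\<lambda>t. (real n + t) powr r) has_real_derivative r * x powr (r - 1)) (at t)" for r
      using x by (auto intro!: derivative_eq_intros simp: x_def)
    have dG: "((\<lambda>t. - (1 - t) * a / 2 * (P t - Q t) + (1 - 2 * t) / 2 * P t + R t / (1 + a)) has_real_derivative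
        (a / 2 * (P t - Q t) - (1 - t) * a / 2 * (P' - Q') + (- P t + (1 - 2 * t) / 2 * P') + R' / (1 + a))) (at t)"
      if "(P has_real_derivative P') (at t)" "(Q has_real_derivative Q') (at t)" "(R has_real_derivative R') (at t)" for P Q R P' Q' R'
    proof -
      have 1: "((\<lambda>t. - (1 - t) * a / 2) has_real_derivative a / 2) (at t)"
        by (auto intro!: derivative_eq_intros)
      have 2: "((\<lambda>t. (1 - 2 * t) / 2) has_real_derivative - 1) (at t)"
        by (auto intro!: derivative_eq_intros)
      show ?thesis
        by (rule DERIV_cong[OF DERIV_add[OF DERIV_add[OF DERIV_mult[OF 1 DERIV_diff[OF that(1,2)]] DERIV_mult[OF 2 that(1)]]
              DERIV_cdivide[OF that(3)]]]) (simp add: field_simps)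
    qed
    have "(G has_real_derivative
        (a / 2 * (x powr a - real n * x powr (a - 1)) - (1 - t) * a / 2 * (a * x powr (a - 1) - real n * ((a - 1) * x powr (a - 1 - 1)))
         + (- (x powr a) + (1 - 2 * t) / 2 * (a * x powr (a - 1))) + x powr a)) (at t)"
      unfolding G_def
      by (rule DERIV_cong[OF dG[OF d DERIV_cmult[OF d] d]]) (use a in \<open>simp add: x_def\<close>)
    also have "(a / 2 * (x powr a - real n * x powr (a - 1)) - (1 - t) * a / 2 * (a * x powr (a - 1) - real n * ((a - 1) * x powr (a - 1 - 1)))
         + (- (x powr a) + (1 - 2 * t) / 2 * (a * x powr (a - 1))) + x powr a) = t * (1 - t) / 2 * (a * (1 - a) * x powr (a - 2))"
    proof -
      have n: "real n = x - t" by (simp add: x_def)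
      have "a - 1 - 1 = a - 2" by simp
      show ?thesis unfolding \<open>a - 1 - 1 = a - 2\<close> p n by (simp add: field_simps power2_eq_square)
    qed
    finally show "(G has_vector_derivative t * (1 - t) / 2 * (a * (1 - a) * (real n + t) powr (a - 2))) (at t)"
      by (simp add: has_real_derivative_iff_has_vector_derivative x_def)
  qed auto
  also have "G 1 - G 0 = (real (Suc n) powr (1 + a) - real n powr (1 + a)) / (1 + a) - (real n powr a + real (Suc n) powr a) / 2"
  proof -
    have "real n * real n powr (a - 1) = real n powr a"
      using a by (cases "n = 0") (auto simp: powr_mult_base)
    then show ?thesis by (simp add: G_def diff_divide_distrib add_divide_distrib add.commute)
  qed
  finally show ?thesis .
qed

lemma trapezoid_kernel_has_integral:
  fixes w :: real
  assumes w: "w > 0"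
  shows "((\<lambda>t. t * (1 - t) / 2 * exp (- (t * w))) has_integral
     ((1 + exp (- w)) / 2 - (1 - exp (- w)) / w) / w\<^sup>2) {0..1}"
proof -
  define H where "H = (\<lambda>t. exp (- (t * w)) * (- (t * (1 - t)) / (2 * w) - (1 - 2 * t) / (2 * w\<^sup>2) + 1 / w ^ 3))"
  have "((\<lambda>t. t * (1 - t) / 2 * exp (- (t * w))) has_integral H 1 - H 0) {0..1}"
  proof (rule fundamental_theorem_of_calculus)
    fix t :: real
    have "(H has_real_derivative t * (1 - t) / 2 * exp (- (t * w))) (at t within {0..1})"
      unfolding H_def using w
      by (auto intro!: derivative_eq_intros simp: field_simps power2_eq_square power3_eq_cube)
    then show "(H has_vector_derivative t * (1 - t) / 2 * exp (- (t * w))) (at t within {0..1})"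
      by (simp add: has_real_derivative_iff_has_vector_derivative)
  qed auto
  also have "H 1 - H 0 = ((1 + exp (- w)) / 2 - (1 - exp (- w)) / w) / w\<^sup>2"
    unfolding H_def using w by (simp add: field_simps power2_eq_square power3_eq_cube)
  finally show ?thesis .
qed

section \<open>The functional equation\<close>

text \<open>
  The integral of x^a over [n, n + 1] minus its trapezoid approximation; the sign is chosen to make
  it nonnegative for the concave function x^a, 0 < a < 1.
\<close>
definition trapezoid_powr_error :: "real \<Rightarrow> nat \<Rightarrow> real" where
  "trapezoid_powr_error a n = (real (Suc n) powr (1 + a) - real n powr (1 + a)) / (1 + a)
     - (real n powr a + real (Suc n) powr a) / 2"

text \<open>
  Insert (n + t)^(a-2) Gamma(2 - a) = integral of w^(1-a) exp(-(n + t) w) over w > 0 into the Peano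
  representation of the error, interchange, and do the t-integral.
\<close>
lemma nn_integral_trapezoid_powr_error:
  fixes a :: real
  assumes a: "0 < a" "a < 1"
  shows "ennreal (trapezoid_powr_error a n) = (\<integral>\<^sup>+w. ennreal (a * (1 - a) / Gamma (2 - a) *
     (w powr (- 1 - a) * exp (- (real n * w)) * ((1 + exp (- w)) / 2 - (1 - exp (- w)) / w))) * indicator {0<..} w \<partial>lborel)"
proof -
  define c where "c = a * (1 - a) / Gamma (2 - a)"
  have G: "Gamma (2 - a) > 0" using a by (intro Gamma_real_pos) auto
  have cancel: "x / y * y = x" if "y > 0" for x y :: real using that by simp
  have c: "c \<ge> 0" using a G by (simp add: c_def)
  have cG: "c * Gamma (2 - a) = a * (1 - a)" unfolding c_def by (rule cancel[OF G])
  define K where "K = (\<lambda>t w. ennreal (c * (t * (1 - t) / 2) * (w powr (1 - a) * exp (- ((real n + t) * w))))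
       * indicator {0..1} t * indicator {0<..} w)"
  have [measurable]: "case_prod K \<in> borel_measurable (lborel \<Otimes>\<^sub>M lborel)"
    unfolding K_def by measurable
  have inner_w: "(\<integral>\<^sup>+w. K t w \<partial>lborel) = ennreal (t * (1 - t) / 2 * (a * (1 - a) * (real n + t) powr (a - 2))) * indicator {0..1} t" for t
  proof (cases "t \<in> {0<..1}")
    case True
    then have p: "real n + t > 0" by auto
    have "(\<integral>\<^sup>+w. K t w \<partial>lborel) = (\<integral>\<^sup>+w. ennreal (c * (t * (1 - t) / 2)) * (ennreal (w powr ((2 - a) - 1) * exp (- ((real n + t) * w))) * indicator {0<..} w) \<partial>lborel)"
      using True c by (intro nn_integral_cong) (auto simp: K_def indicator_def ennreal_mult'[symmetric])
    also have "\<dots> = ennreal (c * (t * (1 - t) / 2)) * ennreal (Gamma (2 - a) * (real n + t) powr (- (2 - a)))"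
      using a by (subst nn_integral_cmult, measurable) (subst nn_integral_exp_powr[OF _ p], auto)
    also have "\<dots> = ennreal (c * (t * (1 - t) / 2) * (Gamma (2 - a) * (real n + t) powr (- (2 - a))))"
      using True c by (subst ennreal_mult'[symmetric]) auto
    also have "c * (t * (1 - t) / 2) * (Gamma (2 - a) * (real n + t) powr (- (2 - a))) = t * (1 - t) / 2 * ((c * Gamma (2 - a)) * (real n + t) powr (a - 2))"
      by simp
    finally show ?thesis using True cG by simp
  next
    case False
    then have "t \<notin> {0..1} \<or> t = 0" by auto
    then show ?thesis by (auto simp: K_def)
  qed
  have inner_t: "(\<integral>\<^sup>+t. K t w \<partial>lborel) = ennreal (c *
     (w powr (- 1 - a) * exp (- (real n * w)) * ((1 + exp (- w)) / 2 - (1 - exp (- w)) / w))) * indicator {0<..} w" for w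
  proof (cases "w > 0")
    case True
    define d where "d = c * w powr (1 - a) * exp (- (real n * w))"
    have d: "d \<ge> 0" using c by (simp add: d_def)
    have "(\<integral>\<^sup>+t. K t w \<partial>lborel) = (\<integral>\<^sup>+t. ennreal d * (ennreal (t * (1 - t) / 2 * exp (- (t * w))) * indicator {0..1} t) \<partial>lborel)"
    proof (rule nn_integral_cong)
      fix t :: real
      have "exp (- ((real n + t) * w)) = exp (- (real n * w)) * exp (- (t * w))"
        by (simp add: exp_add[symmetric] distrib_right)
      then show "K t w = ennreal d * (ennreal (t * (1 - t) / 2 * exp (- (t * w))) * indicator {0..1} t)"
        using True d by (auto simp: K_def d_def indicator_def ennreal_mult'[symmetric] mult_ac)
    qed
    also have "\<dots> = ennreal d * ennreal (((1 + exp (- w)) / 2 - (1 - exp (- w)) / w) / w\<^sup>2)"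
      by (subst nn_integral_cmult, measurable)
        (subst nn_integral_has_integral_lebesgue'[OF _ trapezoid_kernel_has_integral[OF True]], auto)
    also have "\<dots> = ennreal (d * (((1 + exp (- w)) / 2 - (1 - exp (- w)) / w) / w\<^sup>2))"
      using d by (subst ennreal_mult'[symmetric]) auto
    also have "d * (((1 + exp (- w)) / 2 - (1 - exp (- w)) / w) / w\<^sup>2) = 
       c * ((w powr (1 - a) / w\<^sup>2) * exp (- (real n * w)) * ((1 + exp (- w)) / 2 - (1 - exp (- w)) / w))"
      by (simp add: d_def)
    also have "w powr (1 - a) / w\<^sup>2 = w powr (- 1 - a)"
      using powr_diff[of w "1 - a" 2] True by (simp add: powr_numeral)
    finally show ?thesis using True by simp
  qed (simp add: K_def)
  have "ennreal (trapezoid_powr_error a n) = (\<integral>\<^sup>+t. ennreal (t * (1 - t) / 2 * (a * (1 - a) * (real n + t) powr (a - 2))) * indicator {0..1} t \<partial>lborel)"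
    unfolding trapezoid_powr_error_def
    by (rule nn_integral_has_integral_lebesgue'[OF _ trapezoid_error_powr_has_integral[OF a], symmetric]) (use a in auto)
  also have "\<dots> = (\<integral>\<^sup>+t. \<integral>\<^sup>+w. K t w \<partial>lborel \<partial>lborel)" unfolding inner_w ..
  also have "\<dots> = (\<integral>\<^sup>+w. \<integral>\<^sup>+t. K t w \<partial>lborel \<partial>lborel)" by (rule lborel_pair.Fubini'[symmetric]) measurable
  finally show ?thesis unfolding inner_t c_def .
qed

lemma trapezoid_powr_error_nonneg:
  assumes a: "0 < a" "a < 1"
  shows "trapezoid_powr_error a n \<ge> 0"
  using has_integral_nonneg[OF trapezoid_error_powr_has_integral[OF a, of n]] a
  by (simp add: trapezoid_powr_error_def)

lemma trapezoid_error_minus_of_real: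
  assumes "0 < a"
  shows "trapezoid_error n (of_real (- a)) = - of_real (trapezoid_powr_error a n)"
  using trapezoid_error_of_real[of "- a" n] assms by (simp add: trapezoid_powr_error_def)

text \<open>
  For s = -a < 0 the constants 1 / (s - 1) + 1 / 2 are the trapezoid error on [0, 1], because 0^a =
  0.  So the sum over all n, including n = 0, has no further terms.
\<close>
lemma zeta_right_minus_of_real:
  assumes a: "0 < a" "a < 1"
  shows "summable (trapezoid_powr_error a)"
    and "zeta_right (of_real (- a)) = - of_real (\<Sum>n. trapezoid_powr_error a n)"
proof -
  have e: "trapezoid_error (Suc n) (of_real (- a)) = - of_real (trapezoid_powr_error a (Suc n))" for n
    by (rule trapezoid_error_minus_of_real) (use a in auto)
  have "summable (\<lambda>n. trapezoid_error (Suc n) (of_real (- a)))"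
    by (rule summable_trapezoid_error) (use a in \<open>auto simp: complex_eq_iff\<close>)
  then have "summable (\<lambda>n. complex_of_real (trapezoid_powr_error a (Suc n)))"
    unfolding e by (simp only: summable_minus_iff)
  then have s: "summable (\<lambda>n. trapezoid_powr_error a (Suc n))"
    by (simp only: summable_complex_of_real)
  then show S: "summable (trapezoid_powr_error a)" by (simp only: summable_Suc_iff)
  have 0: "trapezoid_powr_error a 0 = 1 / (1 + a) - 1 / 2"
    using a by (simp add: trapezoid_powr_error_def)
  have "zeta_right (of_real (- a)) = - of_real (1 / (1 + a)) + 1 / 2 + (\<Sum>n. - of_real (trapezoid_powr_error a (Suc n)))"
    unfolding zeta_right_def e
    using minus_divide_right[of 1 "1 + complex_of_real a"] by simp
  also have "\<dots> = - (of_real (trapezoid_powr_error a 0 + (\<Sum>n. trapezoid_powr_error a (Suc n))))"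
    using s by (simp add: 0 suminf_minus suminf_of_real summable_complex_of_real)
  also have "trapezoid_powr_error a 0 + (\<Sum>n. trapezoid_powr_error a (Suc n)) = (\<Sum>n. trapezoid_powr_error a n)"
    using suminf_split_head[OF S] by simp
  finally show "zeta_right (of_real (- a)) = - of_real (\<Sum>n. trapezoid_powr_error a n)" .
qed

text \<open>
  Summing the Laplace representations over n gives a geometric series in exp(-w), hence coth(w/2) /
  2 - 1 / w. Its partial fractions are integrated term by term.
\<close>
lemma ennreal_suminf_trapezoid_powr_error:
  fixes a :: real
  assumes a: "0 < a" "a < 1"
  shows "ennreal (\<Sum>n. trapezoid_powr_error a n) =
    (\<Sum>k. ennreal (a * (1 - a) / Gamma (2 - a) * 2 * ((2 * pi * real (Suc k)) powr (- a - 1) * pi / (2 * cos (pi * a / 2)))))"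
proof -
  define c where "c = a * (1 - a) / Gamma (2 - a)"
  have G: "Gamma (2 - a) > 0" using a by (intro Gamma_real_pos) auto
  have c: "c \<ge> 0" using a G by (simp add: c_def)
  define q :: "real \<Rightarrow> real" where "q = (\<lambda>w. (1 + exp (- w)) / 2 - (1 - exp (- w)) / w)"
  have q: "q w \<ge> 0" if "w > 0" for w
  proof -
    have "0 \<le> q w / w\<^sup>2"
      using has_integral_nonneg[OF trapezoid_kernel_has_integral[OF that]] by (simp add: q_def)
    then show ?thesis using that by (simp add: zero_le_divide_iff)
  qed
  have "ennreal (\<Sum>n. trapezoid_powr_error a n) = (\<Sum>n. ennreal (trapezoid_powr_error a n))"
    by (rule suminf_ennreal2[symmetric]) (use a in \<open>auto intro: trapezoid_powr_error_nonneg zeta_right_minus_of_real\<close>)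
  also have "\<dots> = (\<Sum>n. \<integral>\<^sup>+w. ennreal (c * (w powr (- 1 - a) * exp (- (real n * w)) * q w)) * indicator {0<..} w \<partial>lborel)"
    unfolding nn_integral_trapezoid_powr_error[OF a] c_def q_def ..
  also have "\<dots> = (\<integral>\<^sup>+w. (\<Sum>n. ennreal (c * (w powr (- 1 - a) * exp (- (real n * w)) * q w)) * indicator {0<..} w) \<partial>lborel)"
    by (rule nn_integral_suminf[symmetric]) (simp add: q_def)
  also have "\<dots> = (\<integral>\<^sup>+w. (\<Sum>k. ennreal (c * 2) * (ennreal (w powr (- a) / (w\<^sup>2 + (2 * pi * real (Suc k))\<^sup>2)) * indicator {0<..} w)) \<partial>lborel)"
  proof (rule nn_integral_cong)
    fix w :: real
    show "(\<Sum>n. ennreal (c * (w powr (- 1 - a) * exp (- (real n * w)) * q w)) * indicator {0<..} w)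
       = (\<Sum>k. ennreal (c * 2) * (ennreal (w powr (- a) / (w\<^sup>2 + (2 * pi * real (Suc k))\<^sup>2)) * indicator {0<..} w))"
    proof (cases "w > 0")
      case w: True
      have e: "exp (- w) < 1" using w by simp
      have "(\<lambda>n. exp (- w) ^ n) sums (1 / (1 - exp (- w)))" using e by (intro geometric_sums) auto
      then have "(\<lambda>n. (c * w powr (- 1 - a) * q w) * exp (- w) ^ n) sums ((c * w powr (- 1 - a) * q w) * (1 / (1 - exp (- w))))"
        by (rule sums_mult)
      moreover have "(c * w powr (- 1 - a) * q w) * exp (- w) ^ n = c * (w powr (- 1 - a) * exp (- (real n * w)) * q w)" for n
        by (simp add: exp_of_nat_mult[symmetric])
      ultimately have s1: "(\<lambda>n. c * (w powr (- 1 - a) * exp (- (real n * w)) * q w)) sums (c * w powr (- 1 - a) * (q w / (1 - exp (- w))))"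
        by simp
      have "(\<lambda>k. (c * w powr (- 1 - a)) * (2 * w / (w\<^sup>2 + (2 * pi * real (Suc k))\<^sup>2))) sums ((c * w powr (- 1 - a)) * ((1 + exp (- w)) / (2 * (1 - exp (- w))) - 1 / w))"
        by (intro sums_mult coth_partial_fractions w)
      also have "(1 + exp (- w)) / (2 * (1 - exp (- w))) - 1 / w = q w / (1 - exp (- w))"
      proof -
        have "(1 + r) / (2 * (1 - r)) - 1 / w = ((1 + r) / 2 - (1 - r) / w) / (1 - r)" if "r < 1" for r
          using that w by (simp add: field_simps)
        from this[OF e] show ?thesis by (simp add: q_def)
      qed
      also have "(\<lambda>k. (c * w powr (- 1 - a)) * (2 * w / (w\<^sup>2 + (2 * pi * real (Suc k))\<^sup>2))) = (\<lambda>k. c * 2 * (w powr (- a) / (w\<^sup>2 + (2 * pi * real (Suc k))\<^sup>2)))"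
      proof
        fix k
        have "w powr (- 1 - a) * w = w powr (- a)"
          using powr_add[of w "- 1 - a" 1] w by simp
        then show "(c * w powr (- 1 - a)) * (2 * w / (w\<^sup>2 + (2 * pi * real (Suc k))\<^sup>2)) = c * 2 * (w powr (- a) / (w\<^sup>2 + (2 * pi * real (Suc k))\<^sup>2))"
          by (simp add: mult_ac del: of_nat_Suc)
      qed
      finally have s2: "(\<lambda>k. c * 2 * (w powr (- a) / (w\<^sup>2 + (2 * pi * real (Suc k))\<^sup>2))) sums (c * w powr (- 1 - a) * (q w / (1 - exp (- w))))" .
      have "(\<Sum>n. ennreal (c * (w powr (- 1 - a) * exp (- (real n * w)) * q w))) = ennreal (c * w powr (- 1 - a) * (q w / (1 - exp (- w))))"
        using s1 c q[OF w] by (subst suminf_ennreal2) (auto simp: sums_iff)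
      also have "\<dots> = (\<Sum>k. ennreal (c * 2 * (w powr (- a) / (w\<^sup>2 + (2 * pi * real (Suc k))\<^sup>2))))"
        using s2 c by (subst suminf_ennreal2) (auto simp: sums_iff)
      also have "\<dots> = (\<Sum>k. ennreal (c * 2) * ennreal (w powr (- a) / (w\<^sup>2 + (2 * pi * real (Suc k))\<^sup>2)))"
        using c by (subst ennreal_mult') auto
      finally show ?thesis using w by simp
    qed simp
  qed
  also have "\<dots> = (\<Sum>k. \<integral>\<^sup>+w. ennreal (c * 2) * (ennreal (w powr (- a) / (w\<^sup>2 + (2 * pi * real (Suc k))\<^sup>2)) * indicator {0<..} w) \<partial>lborel)"
    by (rule nn_integral_suminf) measurable
  also have "\<dots> = (\<Sum>k. ennreal (c * 2 * ((2 * pi * real (Suc k)) powr (- a - 1) * pi / (2 * cos (pi * a / 2)))))"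
  proof (rule suminf_cong)
    fix k
    have "(\<integral>\<^sup>+w. ennreal (c * 2) * (ennreal (w powr (- a) / (w\<^sup>2 + (2 * pi * real (Suc k))\<^sup>2)) * indicator {0<..} w) \<partial>lborel)
      = ennreal (c * 2) * (\<integral>\<^sup>+w. ennreal (w powr (- a) / (w\<^sup>2 + (2 * pi * real (Suc k))\<^sup>2)) * indicator {0<..} w \<partial>lborel)"
      by (rule nn_integral_cmult) measurable
    also have "\<dots> = ennreal (c * 2) * ennreal ((2 * pi * real (Suc k)) powr (- a - 1) * pi / (2 * cos (pi * a / 2)))"
      by (subst nn_integral_powr_over_square_plus[OF a]) auto
    also have "\<dots> = ennreal (c * 2 * ((2 * pi * real (Suc k)) powr (- a - 1) * pi / (2 * cos (pi * a / 2))))"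
      using c by (subst ennreal_mult'[symmetric]) auto
    finally show "(\<integral>\<^sup>+w. ennreal (c * 2) * (ennreal (w powr (- a) / (w\<^sup>2 + (2 * pi * real (Suc k))\<^sup>2)) * indicator {0<..} w) \<partial>lborel)
      = ennreal (c * 2 * ((2 * pi * real (Suc k)) powr (- a - 1) * pi / (2 * cos (pi * a / 2))))" .
  qed
  finally show ?thesis by (simp add: c_def)
qed

text \<open>
  The right-hand side of the functional equation.
\<close>
definition zeta_left :: "complex \<Rightarrow> complex" where
  "zeta_left s = 2 * (2 * of_real pi) powr (s - 1) * sin (of_real pi * s / 2) * Gamma (1 - s) * zeta_right (1 - s)"

text \<open>
  In ennreal_suminf_trapezoid_powr_error, k^(-1-a) has the same factor in all terms; the reflection
  formula brings this factor into the usual form.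
\<close>
lemma zeta_right_functional_equation:
  fixes a :: real
  assumes a: "0 < a" "a < 1"
  shows "zeta_right (of_real (- a)) = zeta_left (of_real (- a))"
proof -
  define c where "c = a * (1 - a) / Gamma (2 - a) * 2 * ((2 * pi) powr (- a - 1) * pi / (2 * cos (pi * a / 2)))"
  have G: "Gamma (2 - a) > 0" using a by (intro Gamma_real_pos) auto
  have cos: "cos (pi * a / 2) > 0" using a by (intro cos_gt_zero) (auto simp: field_simps)
  have c: "c \<ge> 0" using a G cos unfolding c_def
    by (intro mult_nonneg_nonneg divide_nonneg_nonneg) auto
  have summand: "a * (1 - a) / Gamma (2 - a) * 2 * ((2 * pi * real (Suc k)) powr (- a - 1) * pi / (2 * cos (pi * a / 2)))
      = c * (1 / real (Suc k) powr (1 + a))" for k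
  proof -
    have "(2 * pi * real (Suc k)) powr (- a - 1) = (2 * pi) powr (- a - 1) * real (Suc k) powr (- (1 + a))"
    proof -
      have "- a - 1 = - (1 + a)" by simp
      then show ?thesis by (simp only: powr_mult)
    qed
    moreover have "real (Suc k) powr (- (1 + a)) = 1 / real (Suc k) powr (1 + a)" by (rule powr_minus_divide)
    ultimately show ?thesis by (simp add: c_def del: of_nat_Suc)
  qed
  have summ: "summable (\<lambda>k. 1 / real (Suc k) powr (1 + a))"
  proof -
    have "summable (\<lambda>k. real k powr (- (1 + a)))" using a by (subst summable_real_powr_iff) auto
    then have "summable (\<lambda>k. real (Suc k) powr (- (1 + a)))" by (subst summable_Suc_iff)
    then show ?thesis unfolding powr_minus_divide .
  qed
  have "ennreal (\<Sum>n. trapezoid_powr_error a n) = (\<Sum>k. ennreal (c * (1 / real (Suc k) powr (1 + a))))"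
    unfolding ennreal_suminf_trapezoid_powr_error[OF a] summand ..
  also have "\<dots> = ennreal (\<Sum>k. c * (1 / real (Suc k) powr (1 + a)))"
    using c by (intro suminf_ennreal2 summable_mult summ) auto
  finally have "(\<Sum>n. trapezoid_powr_error a n) = (\<Sum>k. c * (1 / real (Suc k) powr (1 + a)))"
  proof -
    assume *: "ennreal (\<Sum>n. trapezoid_powr_error a n) = ennreal (\<Sum>k. c * (1 / real (Suc k) powr (1 + a)))"
    have "(\<Sum>n. trapezoid_powr_error a n) \<ge> 0"
      by (intro suminf_nonneg zeta_right_minus_of_real trapezoid_powr_error_nonneg a)
    moreover have "(\<Sum>k. c * (1 / real (Suc k) powr (1 + a))) \<ge> 0"
      by (rule suminf_nonneg[OF summable_mult[OF summ]]) (use c in auto)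
    ultimately show ?thesis using * by (simp only: ennreal_inj)
  qed
  also have "\<dots> = c * (\<Sum>k. 1 / real (Suc k) powr (1 + a))" by (rule suminf_mult[OF summ])
  finally have 1: "zeta_right (of_real (- a)) = - of_real c * of_real (\<Sum>k. 1 / real (Suc k) powr (1 + a))"
    using zeta_right_minus_of_real(2)[OF a] by simp
  have "(\<lambda>k. 1 / of_nat (Suc k) powr of_real (1 + a)) sums zeta_right (of_real (1 + a))"
    by (rule zeta_right_sums) (use a in auto)
  moreover have "1 / complex_of_nat (Suc k) powr of_real (1 + a) = of_real (1 / real (Suc k) powr (1 + a))" for k
    using powr_of_real[of "real (Suc k)" "1 + a"] by (simp del: of_real_add of_nat_Suc)
  ultimately have 2: "zeta_right (of_real (1 + a)) = of_real (\<Sum>k. 1 / real (Suc k) powr (1 + a))"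
    using sums_of_real[OF summable_sums[OF summ], where 'a = complex] by (simp only: sums_iff)
  have "Gamma (2 - a) = (1 - a) * Gamma (1 - a)"
    using Gamma_plus1[of "1 - a"] a nonpos_Ints_nonpos[of "1 - a"] by (auto simp: algebra_simps)
  moreover have G1: "Gamma (1 - a) > 0" using a by (intro Gamma_real_pos) auto
  moreover have "Gamma (1 + a) * Gamma (1 - a) = a * (pi / sin (pi * a))"
  proof -
    have "Gamma (1 + a) = a * Gamma a"
      using Gamma_plus1[of a] a nonpos_Ints_nonpos[of a] by (auto simp: add.commute)
    then have "Gamma (1 + a) * Gamma (1 - a) = a * (Gamma a * Gamma (1 - a))" by simp
    then show ?thesis unfolding Gamma_reflection_real .
  qed
  moreover have "sin (pi * a) = 2 * sin (pi * a / 2) * cos (pi * a / 2)"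
    using sin_double[of "pi * a / 2"] by simp
  moreover have s: "sin (pi * a / 2) > 0" using a by (intro sin_gt_zero) (auto simp: field_simps)
  ultimately have 3: "a * (1 - a) / Gamma (2 - a) * (pi / (2 * cos (pi * a / 2))) = sin (pi * a / 2) * Gamma (1 + a)"
  proof -
    assume h: "Gamma (2 - a) = (1 - a) * Gamma (1 - a)" "Gamma (1 - a) > 0"
      "Gamma (1 + a) * Gamma (1 - a) = a * (pi / sin (pi * a))"
      "sin (pi * a) = 2 * sin (pi * a / 2) * cos (pi * a / 2)"
    have gen: "a * (1 - a) / (b * g) * (p / (2 * co)) = si * h"
      if "h * g = a * (p / S)" "S = 2 * si * co" "b = 1 - a" "g > 0" "co > 0" "si > 0" for b g p co si h S
    proof -
      have 1: "h = a * (p / (2 * si * co)) / g" using that by (simp add: field_simps)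
      have 2: "a * (1 - a) / (b * g) = a / g" using that(3) a by simp
      show ?thesis unfolding 1 2 using that(4-6) by (simp add: field_simps)
    qed
    show ?thesis unfolding h(1) by (rule gen[OF h(3,4) refl h(2) cos s])
  qed
  have "c = 2 * (2 * pi) powr (- a - 1) * (a * (1 - a) / Gamma (2 - a) * (pi / (2 * cos (pi * a / 2))))"
    by (simp add: c_def)
  then have c': "c = 2 * (2 * pi) powr (- a - 1) * sin (pi * a / 2) * Gamma (1 + a)"
    unfolding 3 by simp
  have "zeta_left (of_real (- a)) = 2 * of_real (2 * pi) powr of_real (- a - 1) * sin (of_real (- (pi * a / 2))) * Gamma (of_real (1 + a)) * zeta_right (of_real (1 + a))"
    by (simp add: zeta_left_def)
  also have "\<dots> = 2 * of_real ((2 * pi) powr (- a - 1)) * of_real (- sin (pi * a / 2)) * of_real (Gamma (1 + a)) * of_real (\<Sum>k. 1 / real (Suc k) powr (1 + a))"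
  proof -
    have "sin (complex_of_real (- y)) = of_real (- sin y)" for y
      by (metis sin_of_real sin_minus)
    then show ?thesis unfolding 2 by (subst powr_of_real, simp) (simp only: Gamma_complex_of_real)
  qed
  also have "\<dots> = - of_real c * of_real (\<Sum>k. 1 / real (Suc k) powr (1 + a))"
    unfolding c' by simp
  finally show ?thesis using 1 by simp
qed

lemma holomorphic_zeta_left: "zeta_left holomorphic_on {s. Re s < 0}"
proof -
  have "(\<lambda>s. zeta_right (1 - s)) holomorphic_on {s. Re s < 0}"
  proof -
    have "(zeta_right \<circ> (\<lambda>s. 1 - s)) holomorphic_on {s. Re s < 0}"
      by (rule holomorphic_on_compose_gen[OF _ holomorphic_zeta_right]) (auto intro!: holomorphic_intros)
    then show ?thesis by (simp add: o_def)
  qed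
  moreover have "1 - s \<notin> \<int>\<^sub>\<le>\<^sub>0" if "Re s < 0" for s
  proof
    assume "1 - s \<in> \<int>\<^sub>\<le>\<^sub>0"
    then obtain n where "1 - s = - of_nat n" by (elim nonpos_Ints_cases')
    then have "Re (1 - s) = - real n" by simp
    with that show False by simp
  qed
  ultimately show ?thesis
    unfolding zeta_left_def by (intro holomorphic_intros) auto
qed

text \<open>
  The identity theorem: both sides are holomorphic on the strip and agree on a real interval.
\<close>
lemma zeta_right_eq_zeta_left:
  assumes "- 1 < Re s" "Re s < 0"
  shows "zeta_right s = zeta_left s"
proof -
  define A where "A = {s. Re s > -1} \<inter> {s. Re s < 0}"
  have A: "open A" "connected A" "A \<subseteq> {s. Re s > -1} - {1}" "A \<subseteq> {s. Re s < 0}"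
    unfolding A_def by (auto intro!: convex_connected convex_Int convex_halfspace_Re_gt convex_halfspace_Re_lt
        open_Int open_halfspace_Re_gt open_halfspace_Re_lt)
  have hol: "(\<lambda>s. zeta_right s - zeta_left s) holomorphic_on A"
    using A holomorphic_on_subset[OF holomorphic_zeta_right A(3)] holomorphic_on_subset[OF holomorphic_zeta_left A(4)]
    by (intro holomorphic_intros)
  have lim: "of_real (- 1 / 2) islimpt (complex_of_real ` {-1<..<0})"
  proof (rule islimpt_approachable[THEN iffD2], intro allI impI)
    fix e :: real assume e: "e > 0"
    define x where "x = - 1 / 2 + min (e / 2) (1 / 4)"
    have "x \<in> {-1<..<0}" "x \<noteq> - 1 / 2" "dist (complex_of_real x) (of_real (- 1 / 2)) < e"
      using e unfolding dist_of_real by (auto simp: x_def dist_real_def)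
    then show "\<exists>x'\<in>complex_of_real ` {-1<..<0}. x' \<noteq> of_real (- 1 / 2) \<and> dist x' (of_real (- 1 / 2)) < e"
      by (metis imageI of_real_eq_iff)
  qed
  have "zeta_right s - zeta_left s = 0"
  proof (rule analytic_continuation[OF hol A(1,2) _ _ lim])
    show "complex_of_real ` {-1<..<0} \<subseteq> A" "complex_of_real (- 1 / 2) \<in> A" "s \<in> A"
      using assms by (auto simp: A_def)
    fix z assume "z \<in> complex_of_real ` {-1<..<0}"
    then obtain x where "x \<in> {-1<..<0}" "z = of_real x" by blast
    then show "zeta_right z - zeta_left z = 0"
      using zeta_right_functional_equation[of "- x"] by simp
  qed
  then show ?thesis by simp
qed

text \<open>
  The two formulas overlap in the strip -1 < Re s < 0, where they agree.  The value at 1 is the one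
  that makes riemann_zeta unique.
\<close>
definition zeta_continuation :: "complex \<Rightarrow> complex" where
  "zeta_continuation s = (if s = 1 then 0 else if Re s > -1 then zeta_right s else zeta_left s)"

lemma holomorphic_zeta_continuation: "zeta_continuation holomorphic_on - {1}"
proof -
  have "zeta_continuation holomorphic_on ({s. Re s > -1} - {1}) \<union> {s. Re s < 0}"
  proof (rule holomorphic_on_Un)
    show "zeta_continuation holomorphic_on {s. Re s > -1} - {1}"
      using holomorphic_zeta_right by (rule holomorphic_transform) (auto simp: zeta_continuation_def)
    show "zeta_continuation holomorphic_on {s. Re s < 0}"
      using holomorphic_zeta_left
      by (rule holomorphic_transform) (auto simp: zeta_continuation_def zeta_right_eq_zeta_left)
  qed (auto intro!: open_Diff open_halfspace_Re_gt open_halfspace_Re_lt)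
  then show ?thesis by (rule holomorphic_on_subset) auto
qed

lemma riemann_zeta_eq_continuation: "riemann_zeta = zeta_continuation"
proof -
  have U: "connected (- {1::complex})" by (rule connected_punctured_universe) simp
  note hol = holomorphic_zeta_continuation
  have sums: "(\<lambda>n. 1 / of_nat (Suc n) powr s) sums zeta_continuation s" if "Re s > 1" for s
    using that zeta_right_sums[OF that] by (auto simp: zeta_continuation_def)
  show ?thesis unfolding riemann_zeta_def
  proof (rule the_equality)
    show "zeta_continuation holomorphic_on - {1} \<and> (\<forall>s. 1 < Re s \<longrightarrow> (\<lambda>n. 1 / of_nat (Suc n) powr s) sums zeta_continuation s) \<and> zeta_continuation 1 = 0"
      using hol sums by (auto simp: zeta_continuation_def)
  next
    fix f assume f: "f holomorphic_on - {1} \<and> (\<forall>s. 1 < Re s \<longrightarrow> (\<lambda>n. 1 / of_nat (Suc n) powr s) sums f s) \<and> f 1 = 0"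
    have "f s = zeta_continuation s" if "s \<noteq> 1" for s
    proof (rule analytic_continuation_open[of "{s. Re s > 1}" "- {1}" f zeta_continuation s])
      have "(2::complex) \<in> {s. Re s > 1}" by simp
      then show "{s. Re s > 1} \<noteq> {}" by blast
      show "f z = zeta_continuation z" if "z \<in> {s. Re s > 1}" for z
        using f sums[of z] that sums_unique2 by blast
    qed (use f hol U that in \<open>auto intro: open_halfspace_Re_gt\<close>)
    then show "f = zeta_continuation"
      using f by (intro ext) (metis zeta_continuation_def)
  qed
qed

lemma holomorphic_riemann_zeta: "riemann_zeta holomorphic_on - {1}"
  unfolding riemann_zeta_eq_continuation by (rule holomorphic_zeta_continuation)

section \<open>The zeta function on the real line\<close>

definition real_zeta :: "real \<Rightarrow> real" where
  "real_zeta x = Re (riemann_zeta (of_real x))"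

lemma zeta_right_of_real_in_Reals:
  assumes "x \<noteq> 1" "x > -1"
  shows "zeta_right (of_real x) \<in> \<real>"
proof -
  have "summable (\<lambda>n. trapezoid_error (Suc n) (of_real x))"
    by (rule summable_trapezoid_error) (use assms in \<open>auto simp: complex_eq_iff\<close>)
  then have "(\<Sum>n. trapezoid_error (Suc n) (of_real x)) \<in> \<real>"
    unfolding trapezoid_error_of_real[OF assms(1)] summable_complex_of_real
    by (simp only: suminf_of_real[symmetric] Reals_of_real)
  moreover have "1 / (complex_of_real x - 1) + 1 / 2 \<in> \<real>"
    by (intro Reals_add Reals_divide Reals_diff Reals_of_real Reals_1 Reals_numeral)
  ultimately show ?thesis unfolding zeta_right_def by (rule Reals_add[rotated])
qed

lemma riemann_zeta_of_real:
  assumes "x \<noteq> 1"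
  shows "riemann_zeta (of_real x) = of_real (real_zeta x)"
proof -
  have "riemann_zeta (of_real x) \<in> \<real>"
  proof (cases "x > -1")
    case True
    then show ?thesis
      using zeta_right_of_real_in_Reals[OF assms] assms by (simp add: riemann_zeta_eq_continuation zeta_continuation_def)
  next
    case False
    have "of_real (2 * pi) powr of_real (x - 1) \<in> (\<real> :: complex set)"
      by (subst powr_of_real) auto
    moreover have "sin (of_real (pi * x / 2)) \<in> (\<real> :: complex set)"
      unfolding sin_of_real by auto
    moreover have "Gamma (of_real (1 - x)) \<in> (\<real> :: complex set)"
      unfolding Gamma_complex_of_real by auto
    moreover have "zeta_right (of_real (1 - x)) \<in> \<real>"
      by (rule zeta_right_of_real_in_Reals) (use False in auto)
    ultimately have "zeta_left (of_real x) \<in> \<real>"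
      by (auto simp: zeta_left_def intro!: Reals_mult)
    then show ?thesis
      using False assms by (simp add: riemann_zeta_eq_continuation zeta_continuation_def)
  qed
  then show ?thesis by (auto simp: real_zeta_def elim!: Reals_cases)
qed

lemma real_zeta_sums:
  assumes "x > 1"
  shows "(\<lambda>n. real (Suc n) powr (- x)) sums real_zeta x"
proof -
  have "(\<lambda>n. 1 / of_nat (Suc n) powr complex_of_real x) sums riemann_zeta (of_real x)"
    using assms zeta_right_sums[of "of_real x"] by (simp add: riemann_zeta_eq_continuation zeta_continuation_def)
  moreover have "1 / of_nat (Suc n) powr complex_of_real x = of_real (real (Suc n) powr (- x))" for n
    using powr_of_real[of "real (Suc n)" x] by (simp add: powr_minus_divide)
  ultimately show ?thesis using assms by (simp add: riemann_zeta_of_real sums_of_real_iff del: of_nat_Suc)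
qed

lemma real_zeta_ge_1: "x > 1 \<Longrightarrow> real_zeta x \<ge> 1"
  using sum_le_suminf[of "\<lambda>n. real (Suc n) powr (- x)" "{0}"] real_zeta_sums[of x]
  by (auto simp: sums_iff)

lemma real_zeta_antimono: "1 < x \<Longrightarrow> x \<le> y \<Longrightarrow> real_zeta y \<le> real_zeta x"
  by (rule sums_le[OF _ real_zeta_sums real_zeta_sums]) (auto intro!: powr_mono)

text \<open>
  Since y^(-x) is decreasing in y, the trapezoid error on [n, n + 1] is at most half the decrease
  n^(-x) - (n + 1)^(-x).  For x > 0 these bounds telescope to 1 / 2, so that zeta(x) is at most 1 /
  (x - 1) + 1 = x / (x - 1) < 0.  At x = 0 all errors vanish and the value is -1/2.
\<close>
lemma real_zeta_neg_unit_interval: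
  assumes x: "0 \<le> x" "x < 1"
  shows "real_zeta x < 0"
proof -
  define T where "T = (\<lambda>n. (real n powr (- x) + real (Suc n) powr (- x)) / 2
     - (real (Suc n) powr (1 - x) - real n powr (1 - x)) / (1 - x))"
  have "summable (\<lambda>n. trapezoid_error (Suc n) (of_real x))"
    by (rule summable_trapezoid_error) (use x in \<open>auto simp: complex_eq_iff\<close>)
  moreover have tr: "trapezoid_error n (of_real x) = of_real (T n)" for n
    unfolding T_def by (rule trapezoid_error_of_real) (use x in auto)
  ultimately have sT: "summable (\<lambda>n. T (Suc n))" by (simp only: summable_complex_of_real)
  have "complex_of_real (real_zeta x) = zeta_right (of_real x)"
    using x riemann_zeta_of_real[of x] by (simp add: riemann_zeta_eq_continuation zeta_continuation_def)
  also have "\<dots> = of_real (1 / (x - 1) + 1 / 2 + (\<Sum>n. T (Suc n)))"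
    unfolding zeta_right_def tr using suminf_of_real[OF sT, where 'a = complex] by simp
  finally have eq: "real_zeta x = 1 / (x - 1) + 1 / 2 + (\<Sum>n. T (Suc n))" by (simp only: of_real_eq_iff)
  show ?thesis
  proof (cases "x = 0")
    case True
    have "T (Suc n) = 0" for n by (simp add: T_def True)
    then show ?thesis unfolding eq by (simp add: True)
  next
    case False
    define P where "P = (\<lambda>n. real (Suc n) powr (- x) / 2)"
    have "P \<longlonglongrightarrow> 0" unfolding P_def using False x by real_asymp
    then have tel: "(\<lambda>n. P n - P (Suc n)) sums (P 0 - 0)" by (rule telescope_sums')
    have "T (Suc n) \<le> P n - P (Suc n)" for n
    proof -
      have "\<exists>z. real (Suc n) < z \<and> z < real (Suc (Suc n)) \<and>
         real (Suc (Suc n)) powr (1 - x) - real (Suc n) powr (1 - x) = (real (Suc (Suc n)) - real (Suc n)) * ((1 - x) * z powr (- x))"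
        by (rule MVT2) (auto intro!: derivative_eq_intros)
      then obtain z where z: "real (Suc n) < z" "z < real (Suc (Suc n))"
        and zeq: "real (Suc (Suc n)) powr (1 - x) - real (Suc n) powr (1 - x) = (1 - x) * z powr (- x)" by auto
      have "real (Suc (Suc n)) powr (- x) \<le> z powr (- x)"
        using z x by (intro powr_mono2') auto
      moreover have "T (Suc n) = (real (Suc n) powr (- x) + real (Suc (Suc n)) powr (- x)) / 2 - z powr (- x)"
        unfolding T_def zeq using x by simp
      moreover have "t \<le> p / 2 - q / 2" if "q \<le> z" "t = (p + q) / 2 - z" for t p q z :: real
        using that by (simp add: field_simps)
      ultimately show ?thesis unfolding P_def by blast
    qed
    then have "(\<Sum>n. T (Suc n)) \<le> (\<Sum>n. P n - P (Suc n))"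
      by (rule suminf_le[OF _ sT sums_summable[OF tel]])
    also have "\<dots> = P 0 - 0" by (rule sums_unique[OF tel, symmetric])
    finally have "(\<Sum>n. T (Suc n)) \<le> P 0 - 0" .
    then have "real_zeta x \<le> 1 / (x - 1) + 1" by (simp add: eq P_def)
    also have "\<dots> = x / (x - 1)" using x by (simp add: field_simps)
    also have "\<dots> < 0" using x False by (simp add: divide_pos_neg)
    finally show ?thesis .
  qed
qed

text \<open>
  In the functional equation all factors except the sine are positive for negative x.
\<close>
lemma real_zeta_negative_axis:
  assumes "x < 0"
  shows "\<exists>c>0. real_zeta x = c * sin (pi * x / 2)"
proof -
  have "complex_of_real (real_zeta x) = riemann_zeta (of_real x)"
    using assms by (intro riemann_zeta_of_real[symmetric]) auto
  also have "\<dots> = zeta_left (of_real x)"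
    using assms zeta_right_eq_zeta_left[of "of_real x"]
    by (cases "x > -1") (auto simp: riemann_zeta_eq_continuation zeta_continuation_def)
  also have "\<dots> = 2 * of_real (2 * pi) powr of_real (x - 1) * sin (of_real (pi * x / 2)) * Gamma (of_real (1 - x)) * riemann_zeta (of_real (1 - x))"
    using assms by (simp add: zeta_left_def riemann_zeta_eq_continuation zeta_continuation_def)
  also have "\<dots> = of_real (2 * (2 * pi) powr (x - 1) * sin (pi * x / 2) * Gamma (1 - x) * real_zeta (1 - x))"
    using riemann_zeta_of_real[of "1 - x"] assms
    by (subst powr_of_real, simp) (simp add: Gamma_complex_of_real[symmetric] sin_of_real[symmetric] del: of_real_diff)
  finally have "real_zeta x = 2 * (2 * pi) powr (x - 1) * sin (pi * x / 2) * Gamma (1 - x) * real_zeta (1 - x)"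
    by (simp only: of_real_eq_iff)
  moreover have "2 * (2 * pi) powr (x - 1) * Gamma (1 - x) * real_zeta (1 - x) > 0"
    using assms real_zeta_ge_1[of "1 - x"] by (auto intro!: mult_pos_pos Gamma_real_pos)
  ultimately show ?thesis
    by (intro exI[of _ "2 * (2 * pi) powr (x - 1) * Gamma (1 - x) * real_zeta (1 - x)"]) (simp add: mult_ac)
qed

lemma real_zeta_even_negative: "k \<ge> 1 \<Longrightarrow> real_zeta (- 2 * real k) = 0"
  using real_zeta_negative_axis[of "- 2 * real k"] sin_npi[of k] by (auto simp: mult_ac)

lemma real_zeta_pos:
  fixes n :: nat
  assumes "n \<ge> 1" "x \<in> {- 4 * real n<..<- 4 * real n + 2}"
  shows "real_zeta x > 0"
proof -
  have "x < 0" using assms by auto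
  then obtain c where c: "c > 0" "real_zeta x = c * sin (pi * x / 2)"
    using real_zeta_negative_axis by blast
  have "sin (pi * x / 2) = sin (pi * x / 2 + of_nat n * (2 * pi))" using sin.plus_of_nat[of "pi * x / 2" n] by simp
  also have "pi * x / 2 + of_nat n * (2 * pi) = pi * ((x + 4 * real n) / 2)" by (simp add: field_simps)
  also have "sin \<dots> > 0"
  proof (rule sin_gt_zero)
    show "0 < pi * ((x + 4 * real n) / 2)" using assms by simp
    show "pi * ((x + 4 * real n) / 2) < pi"
      using assms mult_strict_left_mono[of "(x + 4 * real n) / 2" 1 pi] by auto
  qed
  finally show ?thesis using c by simp
qed

lemma real_zeta_neg:
  fixes n :: nat
  assumes "n \<ge> 1" "x \<in> {- 4 * real n + 2<..<- 4 * real n + 4}"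
  shows "real_zeta x < 0"
proof -
  have "x < 0" using assms by auto
  then obtain c where c: "c > 0" "real_zeta x = c * sin (pi * x / 2)"
    using real_zeta_negative_axis by blast
  have "sin (pi * x / 2) = sin (pi * x / 2 + of_nat n * (2 * pi))" using sin.plus_of_nat[of "pi * x / 2" n] by simp
  also have "pi * x / 2 + of_nat n * (2 * pi) = pi * ((x + 4 * real n) / 2)" by (simp add: field_simps)
  also have "sin \<dots> < 0"
  proof (rule sin_lt_zero)
    show "pi < pi * ((x + 4 * real n) / 2)"
      using assms mult_strict_left_mono[of 1 "(x + 4 * real n) / 2" pi] by auto
    show "pi * ((x + 4 * real n) / 2) < 2 * pi"
      using assms mult_strict_left_mono[of "(x + 4 * real n) / 2" 2 pi] by auto
  qed
  finally show ?thesis using c by (simp add: mult_pos_neg)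
qed

lemma real_zeta_neg_near_zero: "- 2 < x \<Longrightarrow> x < 1 \<Longrightarrow> real_zeta x < 0"
  using real_zeta_neg[of 1 x] real_zeta_neg_unit_interval[of x] by (cases "x < 0") auto

text \<open>
  The region is compact but not convex.  Points closer than d / 2 are joined by a segment that stays
  at distance d / 2 from p, where the derivative is bounded; for points further apart the bound of f
  itself suffices.
\<close>
lemma holomorphic_imp_Lipschitz_off_point:
  fixes f :: "complex \<Rightarrow> complex"
  assumes f: "f holomorphic_on - {p}" and d: "d > 0"
  shows "\<exists>L\<ge>0. \<forall>a b. cmod a \<le> R \<longrightarrow> cmod b \<le> R \<longrightarrow> d \<le> cmod (a - p) \<longrightarrow> d \<le> cmod (b - p)
      \<longrightarrow> cmod (f a - f b) \<le> L * cmod (a - b)"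
proof -
  define K where "K = cball 0 R - ball p (d / 2)"
  have K: "compact K" "K \<subseteq> - {p}" using d by (auto simp: K_def intro!: compact_diff)
  have cf: "continuous_on K f"
    using f K(2) holomorphic_on_imp_continuous_on holomorphic_on_subset by blast
  have "deriv f holomorphic_on - {p}" by (rule holomorphic_deriv[OF f]) auto
  then have cd: "continuous_on K (deriv f)"
    using K(2) holomorphic_on_imp_continuous_on holomorphic_on_subset by blast
  obtain B where B: "\<And>z. z \<in> K \<Longrightarrow> cmod (f z) \<le> B"
    using compact_imp_bounded[OF compact_continuous_image[OF cf K(1)]] by (auto simp: bounded_iff)
  obtain D where D: "\<And>z. z \<in> K \<Longrightarrow> cmod (deriv f z) \<le> D"
    using compact_imp_bounded[OF compact_continuous_image[OF cd K(1)]] by (auto simp: bounded_iff)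
  define L where "L = max \<bar>D\<bar> (4 * \<bar>B\<bar> / d)"
  have "cmod (f a - f b) \<le> L * cmod (a - b)"
    if ab: "cmod a \<le> R" "cmod b \<le> R" "d \<le> cmod (a - p)" "d \<le> cmod (b - p)" for a b
  proof (cases "cmod (a - b) \<ge> d / 2")
    case True
    have "a \<in> K" "b \<in> K" using ab d by (auto simp: K_def dist_norm norm_minus_commute)
    then have "cmod (f a - f b) \<le> 2 * \<bar>B\<bar>"
      using norm_triangle_ineq4[of "f a" "f b"] B[of a] B[of b] by linarith
    also have "\<dots> = (4 * \<bar>B\<bar> / d) * (d / 2)" using d by simp
    also have "\<dots> \<le> L * cmod (a - b)" using True d by (intro mult_mono) (auto simp: L_def)
    finally show ?thesis .
  next
    case False
    have seg: "z \<in> K" if z: "z \<in> closed_segment a b" for z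
    proof -
      have "cmod z \<le> R"
        using z ab closed_segment_subset[of a "cball 0 R" b] by (auto simp: subset_iff)
      moreover have "cmod (z - a) \<le> cmod (a - b)"
        using segment_bound(1)[OF z] by (simp add: norm_minus_commute)
      moreover have "cmod (a - p) \<le> cmod (z - p) + cmod (z - a)"
        using norm_triangle_ineq4[of "z - p" "z - a"] by simp
      ultimately show ?thesis using False ab by (auto simp: K_def dist_norm norm_minus_commute)
    qed
    have "cmod (f a - f b) \<le> D * cmod (a - b)"
    proof (rule field_differentiable_bound[of "closed_segment a b" f "deriv f"])
      show "(f has_field_derivative deriv f z) (at z within closed_segment a b)" if "z \<in> closed_segment a b" for z
        using holomorphic_derivI[OF f _ ] seg[OF that] K(2) has_field_derivative_at_within by blast
    qed (use D seg in auto)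
    also have "\<dots> \<le> L * cmod (a - b)" by (intro mult_right_mono) (auto simp: L_def)
    finally show ?thesis .
  qed
  moreover have "L \<ge> 0" by (simp add: L_def)
  ultimately show ?thesis by blast
qed

lemma real_zeta_Lipschitz_compact:
  assumes "b < 1"
  shows "\<exists>L>0. \<forall>x\<in>{a..b}. \<forall>y\<in>{a..b}. \<bar>real_zeta x - real_zeta y\<bar> \<le> L * \<bar>x - y\<bar>"
proof -
  obtain L where L: "L \<ge> 0" "\<And>z w. cmod z \<le> \<bar>a\<bar> + \<bar>b\<bar> \<Longrightarrow> cmod w \<le> \<bar>a\<bar> + \<bar>b\<bar> \<Longrightarrow> 1 - b \<le> cmod (z - 1) \<Longrightarrow> 1 - b \<le> cmod (w - 1)
      \<Longrightarrow> cmod (riemann_zeta z - riemann_zeta w) \<le> L * cmod (z - w)"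
    using holomorphic_imp_Lipschitz_off_point[OF holomorphic_riemann_zeta, of "1 - b" "\<bar>a\<bar> + \<bar>b\<bar>"] assms by auto
  have "\<bar>real_zeta x - real_zeta y\<bar> \<le> (L + 1) * \<bar>x - y\<bar>" if "x \<in> {a..b}" "y \<in> {a..b}" for x y
  proof -
    have n: "cmod (complex_of_real z - 1) = \<bar>z - 1\<bar>" for z :: real
      using norm_of_real[of "z - 1", where 'a = complex] by simp
    have "cmod (riemann_zeta (of_real x) - riemann_zeta (of_real y)) \<le> L * cmod (of_real x - of_real y)"
      using that assms by (intro L(2)) (auto simp: n)
    also have "cmod (riemann_zeta (of_real x) - riemann_zeta (of_real y)) = \<bar>real_zeta x - real_zeta y\<bar>"
      using that assms riemann_zeta_of_real[of x] riemann_zeta_of_real[of y] norm_of_real[of "real_zeta x - real_zeta y", where 'a = complex] by auto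
    also have "cmod (complex_of_real x - of_real y) = \<bar>x - y\<bar>"
      using norm_of_real[of "x - y", where 'a = complex] by simp
    also have "L * \<bar>x - y\<bar> \<le> (L + 1) * \<bar>x - y\<bar>" by (intro mult_right_mono) auto
    finally show ?thesis .
  qed
  then show ?thesis using L(1) by (intro exI[of _ "L + 1"]) auto
qed

text \<open>
  The Dirichlet series bounds zeta uniformly on a half plane to the right of 1, and Cauchy's
  inequality bounds the derivative on a smaller half plane.
\<close>
lemma real_zeta_Lipschitz_right:
  assumes "a > 1"
  shows "\<exists>L>0. \<forall>x\<ge>a. \<forall>y\<ge>a. \<bar>real_zeta x - real_zeta y\<bar> \<le> L * \<bar>x - y\<bar>"
proof -
  define r where "r = (a - 1) / 2"
  have r: "r > 0" "1 + r > 1" "a - r = 1 + r" using assms by (auto simp: r_def field_simps)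
  have bound: "cmod (riemann_zeta z) \<le> real_zeta (1 + r)" if z: "Re z \<ge> 1 + r" for z
  proof -
    have "z \<noteq> 1" "Re z > 1" using z r by auto
    then have s: "(\<lambda>n. 1 / of_nat (Suc n) powr z) sums riemann_zeta z"
      using zeta_right_sums[of z] by (simp add: riemann_zeta_eq_continuation zeta_continuation_def)
    have "cmod (1 / of_nat (Suc n) powr z) \<le> real (Suc n) powr (- (1 + r))" for n
    proof -
      have "cmod (of_nat (Suc n) powr z) = real (Suc n) powr Re z"
        using norm_powr_real_powr[of "of_nat (Suc n)" z] by simp
      then have "cmod (1 / of_nat (Suc n) powr z) = real (Suc n) powr (- Re z)"
        by (simp add: norm_divide powr_minus_divide del: of_nat_Suc)
      also have "\<dots> \<le> real (Suc n) powr (- (1 + r))" using z by (intro powr_mono) auto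
      finally show ?thesis .
    qed
    then show ?thesis
      using norm_suminf_le[of "\<lambda>n. 1 / of_nat (Suc n) powr z" "\<lambda>n. real (Suc n) powr (- (1 + r))"] s real_zeta_sums[OF r(2)]
      by (simp add: sums_iff)
  qed
  define B where "B = real_zeta (1 + r) / r"
  have "cmod (deriv riemann_zeta z) \<le> B" if z: "Re z \<ge> a" for z
  proof -
    have ball: "Re w \<ge> 1 + r" if "w \<in> cball z r" for w
      using that z r abs_Re_le_cmod[of "z - w"] by (auto simp: dist_norm)
    have sub: "cball z r \<subseteq> - {1}" using ball r by force
    have "cmod ((deriv ^^ 1) riemann_zeta z) \<le> fact 1 * real_zeta (1 + r) / r ^ 1"
    proof (rule Cauchy_inequality)
      show "riemann_zeta holomorphic_on ball z r" "continuous_on (cball z r) riemann_zeta"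
        using sub holomorphic_on_subset[OF holomorphic_riemann_zeta] holomorphic_on_imp_continuous_on
        by (meson ball_subset_cball order_trans)+
    qed (use r bound ball in \<open>auto simp: dist_norm\<close>)
    then show ?thesis by (simp add: B_def)
  qed
  note dB = this
  have "\<bar>real_zeta x - real_zeta y\<bar> \<le> B * \<bar>x - y\<bar>" if xy: "x \<ge> a" "y \<ge> a" for x y
  proof -
    have "cmod (riemann_zeta (of_real x) - riemann_zeta (of_real y)) \<le> B * cmod (of_real x - of_real y)"
    proof (rule field_differentiable_bound[of "{z. Re z \<ge> a}" _ "deriv riemann_zeta"])
      show "(riemann_zeta has_field_derivative deriv riemann_zeta z) (at z within {z. Re z \<ge> a})" if "z \<in> {z. Re z \<ge> a}" for z
        by (rule has_field_derivative_at_within, rule holomorphic_derivI[OF holomorphic_riemann_zeta])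
          (use that assms in auto)
    qed (use dB xy in \<open>auto simp: convex_halfspace_Re_ge\<close>)
    also have "cmod (riemann_zeta (of_real x) - riemann_zeta (of_real y)) = \<bar>real_zeta x - real_zeta y\<bar>"
      using xy assms riemann_zeta_of_real[of x] riemann_zeta_of_real[of y] norm_of_real[of "real_zeta x - real_zeta y", where 'a = complex] by auto
    also have "cmod (complex_of_real x - of_real y) = \<bar>x - y\<bar>"
      using norm_of_real[of "x - y", where 'a = complex] by simp
    finally show ?thesis .
  qed
  moreover have "B > 0" using r real_zeta_ge_1[OF r(2)] by (auto simp: B_def)
  ultimately show ?thesis by blast
qed

section \<open>The heat semigroup\<close>

lemma heat_kernel_nonneg [simp]: "0 \<le> heat_kernel t x"
  by (simp add: heat_kernel_def)

lemma borel_measurable_heat_kernel [measurable]: "heat_kernel t \<in> borel_measurable borel"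
  unfolding heat_kernel_def by measurable

lemma nn_integral_heat_kernel:
  assumes t: "t > 0"
  shows "(\<integral>\<^sup>+x. ennreal (heat_kernel t (x :: real ^ 'n)) \<partial>lborel) = 1"
proof -
  define \<sigma> where "\<sigma> = sqrt (2 * t)"
  have \<sigma>: "\<sigma> > 0" "\<sigma>\<^sup>2 = 2 * t" using t by (auto simp: \<sigma>_def)
  have K: "heat_kernel t x = (\<Prod>b\<in>Basis. normal_density 0 \<sigma> (x \<bullet> b))" for x :: "real ^ 'n"
  proof -
    have "(\<Prod>b\<in>Basis. normal_density 0 \<sigma> (x \<bullet> b)) = (\<Prod>b\<in>(Basis :: (real ^ 'n) set). 1 / sqrt (4 * pi * t)) * exp (\<Sum>b\<in>Basis. - (x \<bullet> b)\<^sup>2 / (4 * t))"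
      unfolding normal_density_def \<sigma> by (simp add: prod_dividef exp_sum mult_ac power_divide)
    also have "(\<Sum>b\<in>Basis. - (x \<bullet> b)\<^sup>2 / (4 * t)) = - (norm x)\<^sup>2 / (4 * t)"
    proof -
      have "(norm x)\<^sup>2 = (\<Sum>b\<in>Basis. (x \<bullet> b)\<^sup>2)"
        unfolding power2_norm_eq_inner by (subst euclidean_inner) (simp add: power2_eq_square)
      then show ?thesis by (simp add: sum_negf sum_divide_distrib)
    qed
    also have "(\<Prod>b\<in>(Basis :: (real ^ 'n) set). 1 / sqrt (4 * pi * t)) = (4 * pi * t) powr (- real CARD('n) / 2)"
    proof -
      have "(\<Prod>b\<in>(Basis :: (real ^ 'n) set). 1 / sqrt (4 * pi * t)) = ((4 * pi * t) powr (- 1 / 2)) powr real CARD('n)"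
        using t by (simp add: powr_realpow powr_half_sqrt[symmetric] powr_minus_divide)
      then show ?thesis using t by (simp add: powr_powr)
    qed
    finally show ?thesis by (simp add: heat_kernel_def)
  qed
  have "(\<integral>\<^sup>+x. ennreal (heat_kernel t (x :: real ^ 'n)) \<partial>lborel) = (\<integral>\<^sup>+x. (\<Prod>b\<in>Basis. ennreal (normal_density 0 \<sigma> (x \<bullet> b))) \<partial>(lborel :: (real ^ 'n) measure))"
    unfolding K by (intro nn_integral_cong prod_ennreal[symmetric]) auto
  also have "\<dots> = (\<Prod>b\<in>(Basis :: (real ^ 'n) set). \<integral>\<^sup>+y. ennreal (normal_density 0 \<sigma> y) \<partial>lborel)"
    by (rule nn_integral_lborel_prod) auto
  also have "(\<integral>\<^sup>+y. ennreal (normal_density 0 \<sigma> y) \<partial>lborel) = 1"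
  proof -
    interpret N: prob_space "density lborel (normal_density 0 \<sigma>)" by (rule prob_space_normal_density[OF \<sigma>(1)])
    show ?thesis using N.emeasure_space_1 by (simp add: emeasure_density)
  qed
  finally show ?thesis by simp
qed

definition heat_measure :: "real \<Rightarrow> (real ^ 'n) measure" where
  "heat_measure t = density lborel (\<lambda>y. ennreal (heat_kernel t y))"

lemma sets_heat_measure [simp, measurable_cong]: "sets (heat_measure t) = sets borel"
  by (simp add: heat_measure_def)

lemma space_heat_measure [simp]: "space (heat_measure t) = UNIV"
  by (simp add: heat_measure_def)

lemma prob_space_heat_measure: "t > 0 \<Longrightarrow> prob_space (heat_measure t)"
  by (intro prob_spaceI) (simp add: heat_measure_def emeasure_density nn_integral_heat_kernel)

abbreviation gauss :: "(real ^ 'n) measure" where "gauss \<equiv> heat_measure 1"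

interpretation gauss: prob_space "gauss :: (real ^ 'n) measure"
  by (rule prob_space_heat_measure) simp

lemma distr_gauss:
  assumes t: "t > 0"
  shows "distr gauss borel (\<lambda>z. sqrt t *\<^sub>R z) = (heat_measure t :: (real ^ 'n) measure)"
proof -
  have c: "sqrt t \<noteq> 0" "sqrt t > 0" using t by auto
  have scale: "ennreal (\<bar>sqrt t\<bar> ^ CARD('n)) * ennreal (heat_kernel t (sqrt t *\<^sub>R z)) = ennreal (heat_kernel 1 z)" for z :: "real ^ 'n"
  proof -
    have "sqrt t ^ CARD('n) = t powr (real CARD('n) / 2)"
    proof -
      have "sqrt t ^ CARD('n) = (t powr (1 / 2)) powr real CARD('n)"
        using t by (simp add: powr_realpow powr_half_sqrt)
      then show ?thesis by (simp add: powr_powr)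
    qed
    then have "sqrt t ^ CARD('n) * heat_kernel t (sqrt t *\<^sub>R z) = heat_kernel 1 z"
      using t by (simp add: heat_kernel_def powr_mult power_mult_distrib powr_add[symmetric] field_simps)
    then show ?thesis using c by (simp add: ennreal_mult'[symmetric])
  qed
  have "heat_measure t = density (density (distr lborel borel (\<lambda>z. 0 + sqrt t *\<^sub>R z)) (\<lambda>_. ennreal (\<bar>sqrt t\<bar> ^ DIM(real ^ 'n)))) (\<lambda>y :: real ^ 'n. ennreal (heat_kernel t y))"
    unfolding heat_measure_def by (subst lborel_affine[OF c(1), of 0]) (rule refl)
  also have "\<dots> = density (distr lborel borel (\<lambda>z. sqrt t *\<^sub>R z)) (\<lambda>y. ennreal (\<bar>sqrt t\<bar> ^ CARD('n)) * ennreal (heat_kernel t y))"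
    by (subst density_density_eq) auto
  also have "\<dots> = distr (density lborel (\<lambda>z. ennreal (\<bar>sqrt t\<bar> ^ CARD('n)) * ennreal (heat_kernel t (sqrt t *\<^sub>R z)))) borel (\<lambda>z. sqrt t *\<^sub>R z)"
    by (subst density_distr) auto
  finally show ?thesis unfolding scale heat_measure_def by simp
qed

lemma measure_gauss_UNIV [simp]: "measure (gauss :: (real ^ 'n) measure) UNIV = 1"
  using gauss.prob_space by simp

text \<open>
  The heat semigroup as an average over one fixed Gaussian measure, the heat kernel at time 1.  Its
  integrand is continuous in time up to and including t = 0, so dominated convergence gives
  continuity in time and space at once.
\<close>
definition heat_op :: "real \<Rightarrow> (real ^ 'n \<Rightarrow> 'b) \<Rightarrow> real ^ 'n \<Rightarrow> 'b::{banach, second_countable_topology}" where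
  "heat_op t f x = (LINT z|gauss. f (x - sqrt t *\<^sub>R z))"

lemma heat_op_0 [simp]: "heat_op 0 f x = f x"
  by (simp add: heat_op_def)

lemma heat_op_const [simp]: "heat_op t (\<lambda>_. c) x = c"
  by (simp add: heat_op_def)

lemma lborel_integral_reflect:
  fixes f :: "real ^ 'n \<Rightarrow> 'b::{banach, second_countable_topology}"
  assumes [measurable]: "f \<in> borel_measurable borel"
  shows "(LINT y|lborel. f y) = (LINT z|lborel. f (x - z))"
proof -
  have *: "(lborel :: (real ^ 'n) measure) = distr lborel borel (\<lambda>z. x - z)"
    using lborel_affine[of "- 1 :: real" x] by (simp add: density_1)
  show ?thesis by (subst *) (simp add: integral_distr)
qed

lemma nn_integral_lborel_shift:
  fixes f :: "real ^ 'n \<Rightarrow> ennreal"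
  assumes [measurable]: "f \<in> borel_measurable borel"
  shows "(\<integral>\<^sup>+y. f y \<partial>lborel) = (\<integral>\<^sup>+z. f (x + z) \<partial>lborel)"
proof -
  have *: "(lborel :: (real ^ 'n) measure) = distr lborel borel (\<lambda>z. x + z)"
    using lborel_affine[of "1 :: real" x] by (simp add: density_1)
  show ?thesis by (subst *) (simp add: nn_integral_distr)
qed

lemma heat_op_eq_lborel_integral:
  fixes f :: "real ^ 'n \<Rightarrow> 'b::{banach, second_countable_topology}"
  assumes t: "t > 0" and [measurable]: "f \<in> borel_measurable borel"
  shows "heat_op t f x = (LINT y|lborel. heat_kernel t (x - y) *\<^sub>R f y)"
proof -
  have "heat_op t f x = (LINT y|(distr gauss borel (\<lambda>z. sqrt t *\<^sub>R z)). f (x - y))"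
    unfolding heat_op_def by (subst integral_distr) auto
  also have "\<dots> = (LINT y|heat_measure t. f (x - y))" unfolding distr_gauss[OF t] ..
  also have "\<dots> = (LINT z|lborel. heat_kernel t z *\<^sub>R f (x - z))"
    unfolding heat_measure_def by (subst integral_density) auto
  also have "\<dots> = (LINT y|lborel. heat_kernel t (x - y) *\<^sub>R f y)"
    using lborel_integral_reflect[of "\<lambda>y. heat_kernel t (x - y) *\<^sub>R f y" x] by simp
  finally show ?thesis .
qed

lemma heat_semigroup_eq_heat_op:
  assumes "t \<ge> 0" "f \<in> borel_measurable borel"
  shows "heat_semigroup t f x = heat_op t f x"
  using assms heat_op_eq_lborel_integral[of t f x] by (cases "t = 0") (auto simp: heat_semigroup_def)

text \<open>
  Completing the square: as a function of y, the product of two heat kernels is a constant multiple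
  of the heat kernel at time a b / (a + b), centred at a / (a + b) p.
\<close>
lemma heat_kernel_mult:
  fixes p y :: "real ^ 'n"
  assumes a: "a > 0" and b: "b > 0"
  shows "heat_kernel b (p - y) * heat_kernel a y
     = heat_kernel (a + b) p * heat_kernel (a * b / (a + b)) (y - (a / (a + b)) *\<^sub>R p)"
proof -
  have ab: "a + b > 0" using a b by simp
  have n: "(norm v)\<^sup>2 = v \<bullet> v" for v :: "real ^ 'n" by (rule power2_norm_eq_inner)
  have e: "- (norm (p - y))\<^sup>2 / (4 * b) + - (norm y)\<^sup>2 / (4 * a) = - (norm p)\<^sup>2 / (4 * (a + b)) + - (norm (y - (a / (a + b)) *\<^sub>R p))\<^sup>2 / (4 * (a * b / (a + b)))"
  proof -
    define P Y Q where "P = p \<bullet> p" and "Y = y \<bullet> y" and "Q = p \<bullet> y"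
    have 1: "(norm (p - y))\<^sup>2 = P - 2 * Q + Y"
      unfolding n P_def Y_def Q_def by (simp add: inner_diff inner_commute)
    have 2: "(norm (y - (a / (a + b)) *\<^sub>R p))\<^sup>2 = Y - 2 * (a / (a + b)) * Q + (a / (a + b))\<^sup>2 * P"
      unfolding n P_def Y_def Q_def by (simp add: inner_diff inner_commute power2_eq_square algebra_simps)
    have 3: "(norm p)\<^sup>2 = P" "(norm y)\<^sup>2 = Y" by (simp_all only: n P_def Y_def)
    have "(a / r)\<^sup>2 * P / (4 * (a * b / r)) = a * P / (4 * b * r)" if "r > 0" for r
      using a b that by (simp add: field_simps power2_eq_square)
    from this[OF ab] have "(a / (a + b))\<^sup>2 * P / (4 * (a * b / (a + b))) = a * P / (4 * b * (a + b))" .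
    note A = this
    have "2 * (a / r) * Q / (4 * (a * b / r)) = Q / (2 * b)" if "r > 0" for r
      using a b that by (simp add: field_simps)
    from this[OF ab] have "2 * (a / (a + b)) * Q / (4 * (a * b / (a + b))) = Q / (2 * b)" .
    moreover note A
    moreover have "Y / (4 * (a * b / (a + b))) = Y / (4 * b) + Y / (4 * a)"
      using a b ab by (simp add: field_simps)
    moreover have "P / (4 * b) = P / (4 * (a + b)) + a * P / (4 * b * (a + b))"
    proof -
      have "P / (4 * r) + a * P / (4 * b * r) = (a + b) * P / (4 * b * r)" if "r > 0" for r
        using b that by (simp add: field_simps)
      from this[OF ab] show ?thesis using ab by simp
    qed
    moreover have "2 * Q / (4 * b) = Q / (2 * b)" by simp
    ultimately show ?thesis unfolding 1 2 3 minus_divide_left[symmetric] add_divide_distrib diff_divide_distrib by linarith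
  qed
  have c: "(4 * pi * b) powr r * (4 * pi * a) powr r = (4 * pi * (a + b)) powr r * (4 * pi * (a * b / (a + b))) powr r" for r
  proof -
    have *: "(4 * pi * b) * (4 * pi * a) = (4 * pi * (a + b)) * (4 * pi * (a * b / (a + b)))"
      using ab by simp
    have "((4 * pi * b) * (4 * pi * a)) powr r = (4 * pi * b) powr r * (4 * pi * a) powr r"
      by (rule powr_mult)
    moreover have "((4 * pi * (a + b)) * (4 * pi * (a * b / (a + b)))) powr r = (4 * pi * (a + b)) powr r * (4 * pi * (a * b / (a + b))) powr r"
      by (rule powr_mult)
    ultimately show ?thesis unfolding * by simp
  qed
  have "heat_kernel b (p - y) * heat_kernel a y = ((4 * pi * b) powr (- real CARD('n) / 2) * (4 * pi * a) powr (- real CARD('n) / 2)) *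
       exp (- (norm (p - y))\<^sup>2 / (4 * b) + - (norm y)\<^sup>2 / (4 * a))"
    by (simp only: heat_kernel_def exp_add mult_ac)
  also have "\<dots> = heat_kernel (a + b) p * heat_kernel (a * b / (a + b)) (y - (a / (a + b)) *\<^sub>R p)"
    unfolding e c heat_kernel_def exp_add by (simp only: mult_ac)
  finally show ?thesis .
qed

lemma nn_integral_heat_kernel_convolution:
  fixes p :: "real ^ 'n"
  assumes a: "a > 0" and b: "b > 0"
  shows "(\<integral>\<^sup>+y. ennreal (heat_kernel b (p - y) * heat_kernel a y) \<partial>lborel) = ennreal (heat_kernel (a + b) p)"
proof -
  define q where "q = - (a / (a + b)) *\<^sub>R p"
  have "(\<integral>\<^sup>+y. ennreal (heat_kernel b (p - y) * heat_kernel a y) \<partial>lborel)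
     = (\<integral>\<^sup>+y. ennreal (heat_kernel (a + b) p) * ennreal (heat_kernel (a * b / (a + b)) (q + y)) \<partial>lborel)"
    unfolding heat_kernel_mult[OF a b] by (simp add: ennreal_mult' q_def add.commute)
  also have "\<dots> = ennreal (heat_kernel (a + b) p) * (\<integral>\<^sup>+y. ennreal (heat_kernel (a * b / (a + b)) (q + y)) \<partial>lborel)"
    by (rule nn_integral_cmult) measurable
  also have "(\<integral>\<^sup>+y. ennreal (heat_kernel (a * b / (a + b)) (q + y)) \<partial>lborel) = 1"
    using nn_integral_lborel_shift[of "\<lambda>y. ennreal (heat_kernel (a * b / (a + b)) y)" q, symmetric]
      nn_integral_heat_kernel[of "a * b / (a + b)"] a b by simp
  finally show ?thesis by simp
qed

text \<open>
  Sums of independent Gaussian variables are Gaussian.  This is the semigroup law on the level of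
  measures, so that only nonnegative integrands occur in the proof.
\<close>
lemma distr_gauss_pair:
  assumes a: "a > 0" and b: "b > 0"
  shows "distr (gauss \<Otimes>\<^sub>M gauss) borel (\<lambda>(z, w). sqrt a *\<^sub>R z + sqrt b *\<^sub>R w) = distr gauss borel (\<lambda>v :: real ^ 'n. sqrt (a + b) *\<^sub>R v)"
proof (rule measure_eqI)
  fix A assume "A \<in> sets (distr (gauss \<Otimes>\<^sub>M gauss) borel (\<lambda>(z, w :: real ^ 'n). sqrt a *\<^sub>R z + sqrt b *\<^sub>R w))"
  then have [measurable]: "A \<in> sets borel" by simp
  interpret pair_sigma_finite "gauss :: (real ^ 'n) measure" "gauss :: (real ^ 'n) measure" ..
  have "emeasure (distr (gauss \<Otimes>\<^sub>M gauss) borel (\<lambda>(z, w). sqrt a *\<^sub>R z + sqrt b *\<^sub>R w)) A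
      = (\<integral>\<^sup>+y. indicator A y \<partial>distr (gauss \<Otimes>\<^sub>M gauss) borel (\<lambda>(z, w). sqrt a *\<^sub>R z + sqrt b *\<^sub>R w))"
    by simp
  also have "\<dots> = (\<integral>\<^sup>+y. indicator A (case y of (z, w) \<Rightarrow> sqrt a *\<^sub>R z + sqrt b *\<^sub>R w) \<partial>(gauss \<Otimes>\<^sub>M gauss))"
    by (rule nn_integral_distr) measurable
  also have "\<dots> = (\<integral>\<^sup>+z. \<integral>\<^sup>+w. indicator A (sqrt a *\<^sub>R z + sqrt b *\<^sub>R w) \<partial>gauss \<partial>gauss)"
    by (subst gauss.nn_integral_fst[symmetric]) auto
  also have "\<dots> = (\<integral>\<^sup>+z. \<integral>\<^sup>+w. indicator A (sqrt a *\<^sub>R z + w) \<partial>heat_measure b \<partial>gauss)"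
    unfolding distr_gauss[OF b, symmetric] by (subst nn_integral_distr) auto
  also have "\<dots> = (\<integral>\<^sup>+z. \<integral>\<^sup>+w. indicator A (z + w) \<partial>heat_measure b \<partial>heat_measure a)"
  proof -
    interpret B: prob_space "heat_measure b :: (real ^ 'n) measure" by (rule prob_space_heat_measure[OF b])
    show ?thesis unfolding distr_gauss[OF a, symmetric] by (subst nn_integral_distr) auto
  qed
  also have "\<dots> = (\<integral>\<^sup>+z. ennreal (heat_kernel a z) * (\<integral>\<^sup>+w. ennreal (heat_kernel b w) * indicator A (z + w) \<partial>lborel) \<partial>lborel)"
    unfolding heat_measure_def by (subst (1 2) nn_integral_density) auto
  also have "\<dots> = (\<integral>\<^sup>+z. ennreal (heat_kernel a z) * (\<integral>\<^sup>+p. ennreal (heat_kernel b (p - z)) * indicator A p \<partial>lborel) \<partial>lborel)"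
  proof -
    have "(\<integral>\<^sup>+p. ennreal (heat_kernel b (p - z)) * indicator A p \<partial>lborel) = (\<integral>\<^sup>+w. ennreal (heat_kernel b w) * indicator A (z + w) \<partial>lborel)" for z :: "real ^ 'n"
      by (subst nn_integral_lborel_shift[of _ z]) auto
    then show ?thesis by simp
  qed
  also have "\<dots> = (\<integral>\<^sup>+z. \<integral>\<^sup>+p. ennreal (heat_kernel b (p - z) * heat_kernel a z) * indicator A p \<partial>lborel \<partial>lborel)"
    by (subst nn_integral_cmult[symmetric]) (auto simp: ennreal_mult' mult_ac)
  also have "\<dots> = (\<integral>\<^sup>+p. \<integral>\<^sup>+z. ennreal (heat_kernel b (p - z) * heat_kernel a z) * indicator A p \<partial>lborel \<partial>lborel)"
    by (rule lborel_pair.Fubini'[symmetric]) measurable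
  also have "\<dots> = (\<integral>\<^sup>+p. ennreal (heat_kernel (a + b) p) * indicator A p \<partial>lborel)"
    by (subst nn_integral_multc) (auto simp: nn_integral_heat_kernel_convolution[OF a b])
  also have "\<dots> = emeasure (heat_measure (a + b)) A"
    unfolding heat_measure_def by (rule emeasure_density[symmetric]) auto
  also have "heat_measure (a + b) = distr gauss borel (\<lambda>v :: real ^ 'n. sqrt (a + b) *\<^sub>R v)"
    by (rule distr_gauss[symmetric]) (use a b in simp)
  finally show "emeasure (distr (gauss \<Otimes>\<^sub>M gauss) borel (\<lambda>(z, w). sqrt a *\<^sub>R z + sqrt b *\<^sub>R w)) A = emeasure (distr gauss borel (\<lambda>v :: real ^ 'n. sqrt (a + b) *\<^sub>R v)) A" .
qed simp

lemma heat_op_heat_op: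
  fixes f :: "real ^ 'n \<Rightarrow> 'b::{banach, second_countable_topology}"
  assumes a: "a \<ge> 0" and b: "b \<ge> 0" and [measurable]: "f \<in> borel_measurable borel" and B: "\<And>x. norm (f x) \<le> B"
  shows "heat_op a (heat_op b f) x = heat_op (a + b) f x"
proof (cases "a = 0 \<or> b = 0")
  case True
  moreover have "heat_op 0 g = g" for g :: "real ^ 'n \<Rightarrow> 'b" by (rule ext) simp
  ultimately show ?thesis by auto
next
  case False
  then have ab: "a > 0" "b > 0" using a b by auto
  interpret pair_prob_space "gauss :: (real ^ 'n) measure" "gauss :: (real ^ 'n) measure" ..
  have "heat_op (a + b) f x = (LINT y|(distr gauss borel (\<lambda>v :: real ^ 'n. sqrt (a + b) *\<^sub>R v)). f (x - y))"
    unfolding heat_op_def by (subst integral_distr) auto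
  also have "\<dots> = (LINT y|(gauss \<Otimes>\<^sub>M gauss). f (x - (case y of (z, w) \<Rightarrow> sqrt a *\<^sub>R z + sqrt b *\<^sub>R w)))"
    unfolding distr_gauss_pair[OF ab, symmetric] by (subst integral_distr) auto
  also have "\<dots> = (LINT y|(gauss \<Otimes>\<^sub>M gauss). (case y of (z, w) \<Rightarrow> f (x - sqrt a *\<^sub>R z - sqrt b *\<^sub>R w)))"
    by (simp add: split_beta diff_diff_eq)
  also have "\<dots> = (LINT z|gauss. LINT w|gauss. f (x - sqrt a *\<^sub>R z - sqrt b *\<^sub>R w))"
  proof -
    have "integrable (gauss \<Otimes>\<^sub>M gauss) (\<lambda>(z, w). f (x - sqrt a *\<^sub>R z - sqrt b *\<^sub>R w))"
      by (rule integrable_const_bound[of _ B]) (use B in \<open>auto simp: split_beta\<close>)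
    from integral_fst'[OF this] show ?thesis by simp
  qed
  finally show ?thesis by (simp add: heat_op_def)
qed

lemma continuous_on_integral_parameter:
  fixes F :: "'a::metric_space \<Rightarrow> 'c \<Rightarrow> 'b::{banach, second_countable_topology}"
  assumes M: "finite_measure M"
    and meas: "\<And>a. a \<in> A \<Longrightarrow> F a \<in> borel_measurable M"
    and cont: "\<And>c. c \<in> space M \<Longrightarrow> continuous_on A (\<lambda>a. F a c)"
    and B: "\<And>a c. a \<in> A \<Longrightarrow> c \<in> space M \<Longrightarrow> norm (F a c) \<le> B"
  shows "continuous_on A (\<lambda>a. integral\<^sup>L M (F a))"
proof -
  interpret finite_measure M by fact
  show ?thesis unfolding continuous_on_sequentially
  proof (intro allI ballI impI)
    fix x a assume x: "a \<in> A" "(\<forall>n. x n \<in> A) \<and> x \<longlonglongrightarrow> a"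
    have "(\<lambda>n. integral\<^sup>L M (F (x n))) \<longlonglongrightarrow> integral\<^sup>L M (F a)"
    proof (rule integral_dominated_convergence[where w = "\<lambda>_. B"])
      show "AE c in M. (\<lambda>n. F (x n) c) \<longlonglongrightarrow> F a c"
      proof (rule AE_I2)
        fix c assume "c \<in> space M"
        from cont[OF this] show "(\<lambda>n. F (x n) c) \<longlonglongrightarrow> F a c"
          using x unfolding continuous_on_sequentially by (auto simp: o_def)
      qed
    qed (use x meas B in auto)
    then show "((\<lambda>a. integral\<^sup>L M (F a)) \<circ> x) \<longlonglongrightarrow> integral\<^sup>L M (F a)" by (simp add: o_def)
  qed
qed

lemma gauss_measurable:
  fixes f :: "real ^ 'n \<Rightarrow> 'b::{banach, second_countable_topology}"
  assumes "continuous_on UNIV f"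
  shows "(\<lambda>z. f (x - c *\<^sub>R z)) \<in> borel_measurable gauss"
proof -
  have [measurable]: "f \<in> borel_measurable borel" using assms by (rule borel_measurable_continuous_onI)
  show ?thesis by measurable
qed

lemma gauss_integrable:
  fixes f :: "real ^ 'n \<Rightarrow> 'b::{banach, second_countable_topology}"
  assumes "continuous_on UNIV f" "\<And>x. norm (f x) \<le> B"
  shows "integrable gauss (\<lambda>z. f (x - c *\<^sub>R z))"
  by (rule gauss.integrable_const_bound[of _ B]) (use assms gauss_measurable in auto)

lemma norm_heat_op_le:
  fixes f :: "real ^ 'n \<Rightarrow> 'b::{banach, second_countable_topology}"
  assumes "continuous_on UNIV f" "\<And>x. norm (f x) \<le> B"
  shows "norm (heat_op t f x) \<le> B"
proof -
  have "norm (heat_op t f x) \<le> (LINT z|(gauss :: (real ^ 'n) measure). B)"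
    unfolding heat_op_def
    by (rule Bochner_Integration.integral_norm_bound_integral) (use gauss_integrable[OF assms] assms(2) in auto)
  then show ?thesis by simp
qed

lemma heat_op_mono:
  fixes f g :: "real ^ 'n \<Rightarrow> real"
  assumes "continuous_on UNIV f" "\<And>x. norm (f x) \<le> B" "continuous_on UNIV g" "\<And>x. norm (g x) \<le> B'"
    and "\<And>x. f x \<le> g x"
  shows "heat_op t f x \<le> heat_op t g x"
  unfolding heat_op_def
  by (rule integral_mono) (use gauss_integrable[OF assms(1,2)] gauss_integrable[OF assms(3,4)] assms(5) in auto)

lemma heat_op_ge_const:
  fixes f :: "real ^ 'n \<Rightarrow> real"
  assumes "continuous_on UNIV f" "\<And>x. norm (f x) \<le> B" "\<And>x. c \<le> f x"
  shows "c \<le> heat_op t f x"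
  using heat_op_mono[of "\<lambda>_. c" "\<bar>c\<bar>" f B t x] assms by simp

lemma heat_op_le_const:
  fixes f :: "real ^ 'n \<Rightarrow> real"
  assumes "continuous_on UNIV f" "\<And>x. norm (f x) \<le> B" "\<And>x. f x \<le> c"
  shows "heat_op t f x \<le> c"
  using heat_op_mono[of f B "\<lambda>_. c" "\<bar>c\<bar>" t x] assms by simp

lemma heat_op_diff:
  fixes f g :: "real ^ 'n \<Rightarrow> 'b::{banach, second_countable_topology}"
  assumes "continuous_on UNIV f" "\<And>x. norm (f x) \<le> B" "continuous_on UNIV g" "\<And>x. norm (g x) \<le> B'"
  shows "heat_op t (\<lambda>y. f y - g y) x = heat_op t f x - heat_op t g x"
  unfolding heat_op_def by (rule Bochner_Integration.integral_diff) (rule gauss_integrable[OF assms(1,2)] gauss_integrable[OF assms(3,4)])+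

lemma heat_op_scaleR: "heat_op t (\<lambda>y. c *\<^sub>R f y) x = c *\<^sub>R heat_op t f x"
  unfolding heat_op_def by simp

lemma heat_op_of_real:
  fixes f :: "real ^ 'n \<Rightarrow> real"
  shows "heat_op t (\<lambda>y. complex_of_real (f y)) x = complex_of_real (heat_op t f x)"
  unfolding heat_op_def by simp

lemma continuous_on_compose_2:
  assumes "continuous_on UNIV (\<lambda>(s, y). h s y)" "continuous_on A f" "continuous_on A g"
  shows "continuous_on A (\<lambda>x. h (f x) (g x))"
proof -
  have "continuous_on A (\<lambda>x. (\<lambda>(s, y). h s y) (f x, g x))"
    by (rule continuous_on_compose2[OF assms(1) continuous_on_Pair[OF assms(2,3)]]) auto
  then show ?thesis by simp
qed

lemma continuous_on_compose_3:
  assumes "continuous_on UNIV (\<lambda>(r, s, y). h r s y)" "continuous_on A e" "continuous_on A f" "continuous_on A g"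
  shows "continuous_on A (\<lambda>x. h (e x) (f x) (g x))"
proof -
  have "continuous_on A (\<lambda>x. (\<lambda>(r, s, y). h r s y) (e x, f x, g x))"
    by (rule continuous_on_compose2[OF assms(1) continuous_on_Pair[OF assms(2) continuous_on_Pair[OF assms(3,4)]]]) auto
  then show ?thesis by simp
qed

lemma continuous_on_slice:
  assumes "continuous_on UNIV (\<lambda>(s, y). h s y)"
  shows "continuous_on UNIV (h s)"
  using continuous_on_compose_2[OF assms continuous_on_const[of _ s] continuous_on_id] by simp

lemma continuous_on_heat_op:
  fixes h :: "real \<Rightarrow> real ^ 'n \<Rightarrow> 'b::{banach, second_countable_topology}"
  assumes h: "continuous_on UNIV (\<lambda>(s, y). h s y)" and B: "\<And>s y. norm (h s y) \<le> B"
  shows "continuous_on UNIV (\<lambda>(s, t, x). heat_op t (h s) x)"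
proof -
  have "continuous_on UNIV (\<lambda>a :: real \<times> real \<times> (real ^ 'n). LINT z|gauss. (case a of (s, t, x) \<Rightarrow> h s (x - sqrt t *\<^sub>R z)))"
  proof (rule continuous_on_integral_parameter[where B = B])
    show "finite_measure (gauss :: (real ^ 'n) measure)" by (rule gauss.finite_measure_axioms)
    fix a :: "real \<times> real \<times> (real ^ 'n)"
    show "(\<lambda>z. case a of (s, t, x) \<Rightarrow> h s (x - sqrt t *\<^sub>R z)) \<in> borel_measurable gauss"
      using gauss_measurable[OF continuous_on_slice[OF h]] by (simp add: split_beta)
  next
    fix z :: "real ^ 'n"
    show "continuous_on UNIV (\<lambda>a :: real \<times> real \<times> (real ^ 'n). case a of (s, t, x) \<Rightarrow> h s (x - sqrt t *\<^sub>R z))"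
      unfolding split_beta by (rule continuous_on_compose_2[OF h]) (intro continuous_intros)+
  qed (use B in \<open>auto simp: split_beta\<close>)
  then show ?thesis by (simp add: heat_op_def split_beta)
qed

lemma continuous_on_heat_op_time_space:
  fixes f :: "real ^ 'n \<Rightarrow> 'b::{banach, second_countable_topology}"
  assumes f: "continuous_on UNIV f" and B: "\<And>y. norm (f y) \<le> B"
  shows "continuous_on UNIV (\<lambda>(t, x). heat_op t f x)"
proof -
  have "continuous_on UNIV (\<lambda>(s :: real, t, x). heat_op t ((\<lambda>_. f) s) x)"
    by (rule continuous_on_heat_op[where B = B])
      (use B in \<open>auto simp: split_beta intro!: continuous_on_compose2[OF f] continuous_intros\<close>)
  from continuous_on_compose_3[OF this continuous_on_const continuous_on_fst[OF continuous_on_id] continuous_on_snd[OF continuous_on_id]]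
  show ?thesis by (simp add: split_beta)
qed

section \<open>The Duhamel integral\<close>

text \<open>
  The Duhamel integral for the damped semigroup exp(-m t) exp(t Laplace), applied to a source h.
\<close>
definition duhamel :: "real \<Rightarrow> (real \<Rightarrow> real ^ 'n \<Rightarrow> 'b) \<Rightarrow> real \<Rightarrow> real ^ 'n \<Rightarrow> 'b::{banach, second_countable_topology}" where
  "duhamel m h t x = (LINT s:{0..t}|lborel. exp (- m * (t - s)) *\<^sub>R heat_op (t - s) (h s) x)"

lemma continuous_on_duhamel_integrand:
  fixes h :: "real \<Rightarrow> real ^ 'n \<Rightarrow> 'b::{banach, second_countable_topology}"
  assumes h: "continuous_on UNIV (\<lambda>(s, y). h s y)" and B: "\<And>s y. norm (h s y) \<le> B"
  shows "continuous_on A (\<lambda>s. exp (- m * (t - s)) *\<^sub>R heat_op (t - s) (h s) x)"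
  by (intro continuous_intros continuous_on_compose_3[OF continuous_on_heat_op[OF h B]])

lemma duhamel_integrable:
  fixes h :: "real \<Rightarrow> real ^ 'n \<Rightarrow> 'b::{banach, second_countable_topology}"
  assumes h: "continuous_on UNIV (\<lambda>(s, y). h s y)" and B: "\<And>s y. norm (h s y) \<le> B"
  shows "set_integrable lborel {0..t} (\<lambda>s. exp (- m * (t - s)) *\<^sub>R heat_op (t - s) (h s) x)"
  by (rule borel_integrable_atLeastAtMost', rule continuous_on_duhamel_integrand[OF h B])

text \<open>
  Substituting s = t r makes the domain of integration independent of t, so that continuity in t
  follows by dominated convergence.
\<close>
lemma duhamel_rescaled:
  fixes h :: "real \<Rightarrow> real ^ 'n \<Rightarrow> 'b::{banach, second_countable_topology}"
  assumes t: "t \<ge> 0"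
  shows "duhamel m h t x = t *\<^sub>R (LINT r:{0..1}|lborel. exp (- m * (t * (1 - r))) *\<^sub>R heat_op (t * (1 - r)) (h (t * r)) x)"
proof (cases "t = 0")
  case True
  have "AE s in lborel. s \<noteq> (0 :: real)" by (rule AE_lborel_singleton)
  then have "AE s in lborel. indicator {0..0} s *\<^sub>R (exp (- m * (0 - s)) *\<^sub>R heat_op (0 - s) (h s) x) = 0"
    by eventually_elim (simp add: indicator_def)
  then have "duhamel m h 0 x = 0"
    unfolding duhamel_def set_lebesgue_integral_def by (rule integral_eq_zero_AE)
  then show ?thesis using True by simp
next
  case False
  then have t: "t > 0" using t by simp
  have "duhamel m h t x = \<bar>t\<bar> *\<^sub>R (LINT r|lborel. indicator {0..t} (0 + t * r) *\<^sub>R (exp (- m * (t - (0 + t * r))) *\<^sub>R heat_op (t - (0 + t * r)) (h (0 + t * r)) x))"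
    unfolding duhamel_def set_lebesgue_integral_def by (rule lborel_integral_real_affine) (use t in simp)
  also have "(\<lambda>r. indicator {0..t} (0 + t * r) *\<^sub>R (exp (- m * (t - (0 + t * r))) *\<^sub>R heat_op (t - (0 + t * r)) (h (0 + t * r)) x))
     = (\<lambda>r. indicator {0..1} r *\<^sub>R (exp (- m * (t * (1 - r))) *\<^sub>R heat_op (t * (1 - r)) (h (t * r)) x))"
  proof
    fix r
    have "(0 + t * r \<in> {0..t}) = (r \<in> {0..1})"
      using t by (auto simp: zero_le_mult_iff)
    moreover have "t - (0 + t * r) = t * (1 - r)" by (simp add: algebra_simps)
    ultimately show "indicator {0..t} (0 + t * r) *\<^sub>R (exp (- m * (t - (0 + t * r))) *\<^sub>R heat_op (t - (0 + t * r)) (h (0 + t * r)) x)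
     = indicator {0..1} r *\<^sub>R (exp (- m * (t * (1 - r))) *\<^sub>R heat_op (t * (1 - r)) (h (t * r)) x)"
      by (simp add: indicator_def)
  qed
  finally show ?thesis using t by (simp add: set_lebesgue_integral_def)
qed

lemma continuous_on_duhamel:
  fixes h :: "real \<Rightarrow> real ^ 'n \<Rightarrow> 'b::{banach, second_countable_topology}"
  assumes h: "continuous_on UNIV (\<lambda>(s, y). h s y)" and B: "\<And>s y. norm (h s y) \<le> B" and m: "m \<ge> 0"
  shows "continuous_on ({0..} \<times> UNIV) (\<lambda>(t, x). duhamel m h t x)"
proof -
  define F where "F = (\<lambda>(t, x) r. exp (- m * (t * (1 - r))) *\<^sub>R heat_op (t * (1 - r)) (h (t * r)) (x :: real ^ 'n))"
  define M where "M = restrict_space lborel {0..1 :: real}"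
  have F_cont: "continuous_on UNIV (\<lambda>(a, r). F a r)"
  proof -
    have 1: "continuous_on UNIV (\<lambda>p :: (real \<times> (real ^ 'n)) \<times> real. heat_op (fst (fst p) * (1 - snd p)) (h (fst (fst p) * snd p)) (snd (fst p)))"
      by (rule continuous_on_compose_3[OF continuous_on_heat_op[OF h B]]) (intro continuous_intros)+
    show ?thesis unfolding F_def split_beta
      by (intro continuous_intros 1)
  qed
  have "continuous_on ({0..} \<times> UNIV) (\<lambda>a. LINT r|M. F a r)"
  proof (rule continuous_on_integral_parameter[where B = B])
    show "finite_measure M"
      by (intro finite_measureI) (simp add: M_def emeasure_restrict_space)
    fix a :: "real \<times> (real ^ 'n)" assume a: "a \<in> {0..} \<times> UNIV"
    have "continuous_on UNIV (F a)"
      using continuous_on_compose_2[OF F_cont continuous_on_const[of _ a] continuous_on_id] by simp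
    then show "F a \<in> borel_measurable M"
      unfolding M_def by (intro measurable_restrict_space1) (simp add: borel_measurable_continuous_onI)
    fix r assume "r \<in> space M"
    then have r: "r \<in> {0..1}" by (simp add: M_def space_restrict_space)
    have "exp (- m * (fst a * (1 - r))) * norm (heat_op (fst a * (1 - r)) (h (fst a * r)) (snd a)) \<le> 1 * B"
      using r a m by (intro mult_mono norm_heat_op_le continuous_on_slice[OF h] B) auto
    then show "norm (F a r) \<le> B" by (simp add: F_def split_beta)
  next
    fix r
    show "continuous_on ({0..} \<times> UNIV) (\<lambda>a. F a r)"
      by (rule continuous_on_compose_2[OF F_cont]) (intro continuous_intros)+
  qed
  then have "continuous_on ({0..} \<times> UNIV) (\<lambda>a. fst a *\<^sub>R (LINT r|M. F a r))"
    by (intro continuous_intros)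
  moreover have "(case a of (t, x) \<Rightarrow> duhamel m h t x) = fst a *\<^sub>R (LINT r|M. F a r)" if "a \<in> {0..} \<times> UNIV" for a
    using that unfolding M_def
    by (subst integral_restrict_space) (auto simp: split_beta duhamel_rescaled F_def set_lebesgue_integral_def)
  ultimately show ?thesis by (subst continuous_on_cong[OF refl]) auto
qed

lemma set_integral_exp:
  fixes m t :: real
  assumes "t \<ge> 0" "m > 0"
  shows "(LINT s:{0..t}|lborel. exp (- m * (t - s))) = (1 - exp (- m * t)) / m"
proof -
  have "((\<lambda>s. exp (- m * (t - s))) has_integral exp (- m * (t - t)) / m - exp (- m * (t - 0)) / m) {0..t}"
    by (rule fundamental_theorem_of_calculus)
      (use assms in \<open>auto intro!: derivative_eq_intros simp: has_real_derivative_iff_has_vector_derivative[symmetric]\<close>)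
  moreover have "set_integrable lborel {0..t} (\<lambda>s. exp (- m * (t - s)))"
    by (rule borel_integrable_atLeastAtMost') (auto intro!: continuous_intros)
  ultimately show ?thesis
    using set_borel_integral_eq_integral(2)[of "{0..t}" "\<lambda>s. exp (- m * (t - s))"]
    by (auto simp: diff_divide_distrib dest!: integral_unique)
qed

lemma norm_duhamel_le:
  fixes h :: "real \<Rightarrow> real ^ 'n \<Rightarrow> 'b::{banach, second_countable_topology}"
  assumes h: "continuous_on UNIV (\<lambda>(s, y). h s y)" and B: "\<And>s y. norm (h s y) \<le> B" and "t \<ge> 0" "m > 0"
  shows "norm (duhamel m h t x) \<le> B / m"
proof -
  have "B \<ge> 0" using order_trans[OF norm_ge_zero B] .
  have "norm (duhamel m h t x) \<le> (LINT s:{0..t}|lborel. exp (- m * (t - s)) * B)"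
    unfolding duhamel_def
  proof (rule order_trans[OF set_integral_norm_bound[OF duhamel_integrable[OF h B]]], rule set_integral_mono)
    show "set_integrable lborel {0..t} (\<lambda>s. norm (exp (- m * (t - s)) *\<^sub>R heat_op (t - s) (h s) x))"
      by (rule set_integrable_norm[OF duhamel_integrable[OF h B]])
    show "set_integrable lborel {0..t} (\<lambda>s. exp (- m * (t - s)) * B)"
      by (rule borel_integrable_atLeastAtMost') (auto intro!: continuous_intros)
  qed (auto intro!: mult_left_mono norm_heat_op_le continuous_on_slice[OF h] B)
  also have "\<dots> = (1 - exp (- m * t)) / m * B"
    using set_integral_exp[OF assms(3,4)] by simp
  also have "\<dots> \<le> 1 / m * B"
    using assms(4) \<open>B \<ge> 0\<close> by (intro mult_right_mono divide_right_mono) auto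
  finally show ?thesis by simp
qed

text \<open>
  Fubini's theorem and the semigroup law.
\<close>
lemma heat_op_duhamel:
  fixes h :: "real \<Rightarrow> real ^ 'n \<Rightarrow> 'b::{banach, second_countable_topology}"
  assumes h: "continuous_on UNIV (\<lambda>(s, y). h s y)" and B: "\<And>s y. norm (h s y) \<le> B"
    and s: "0 \<le> s" "s \<le> t" and m: "m \<ge> 0"
  shows "heat_op (t - s) (duhamel m h s) x = (LINT r:{0..s}|lborel. exp (- m * (s - r)) *\<^sub>R heat_op (t - r) (h r) x)"
proof -
  define M where "M = restrict_space lborel {0..s}"
  define F where "F = (\<lambda>r z. exp (- m * (s - r)) *\<^sub>R heat_op (s - r) (h r) (x - sqrt (t - s) *\<^sub>R z))"
  interpret M: finite_measure M
    using s by (intro finite_measureI) (simp add: M_def emeasure_restrict_space)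
  interpret pair_sigma_finite M "gauss :: (real ^ 'n) measure" ..
  interpret P: finite_measure "M \<Otimes>\<^sub>M (gauss :: (real ^ 'n) measure)"
    by (rule finite_measure_pair_measure) unfold_locales
  have set_M: "(LINT r:{0..s}|lborel. k r) = (LINT r|M. k r)" for k :: "real \<Rightarrow> 'b"
    unfolding M_def by (subst integral_restrict_space) (auto simp: set_lebesgue_integral_def)
  have F_cont: "continuous_on UNIV (\<lambda>(r, z). F r z)"
    unfolding F_def split_beta
    by (intro continuous_intros continuous_on_compose_3[OF continuous_on_heat_op[OF h B]])
  have F_bound: "norm (F r z) \<le> B" if "r \<in> space M" for r z
  proof -
    have "exp (- m * (s - r)) * norm (heat_op (s - r) (h r) (x - sqrt (t - s) *\<^sub>R z)) \<le> 1 * B"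
      using that m by (intro mult_mono norm_heat_op_le continuous_on_slice[OF h] B)
        (auto simp: M_def space_restrict_space)
    then show ?thesis by (simp add: F_def)
  qed
  have int: "integrable (M \<Otimes>\<^sub>M gauss) (\<lambda>(r, z). F r z)"
  proof (rule P.integrable_const_bound[of _ B])
    show "AE p in M \<Otimes>\<^sub>M gauss. norm (case p of (r, z) \<Rightarrow> F r z) \<le> B"
      using F_bound by (intro AE_I2) (auto simp: space_pair_measure)
    have F_meas: "(\<lambda>(r, z). F r z) \<in> borel_measurable (borel \<Otimes>\<^sub>M borel)"
      unfolding borel_prod by (rule borel_measurable_continuous_onI[OF F_cont])
    have "(\<lambda>r. r) \<in> borel_measurable M"
      unfolding M_def by (intro measurable_restrict_space1) simp
    then have "(\<lambda>p. (fst p, snd p)) \<in> M \<Otimes>\<^sub>M gauss \<rightarrow>\<^sub>M borel \<Otimes>\<^sub>M borel"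
      by measurable
    from measurable_compose[OF this F_meas] show "(\<lambda>(r, z). F r z) \<in> borel_measurable (M \<Otimes>\<^sub>M gauss)" by simp
  qed
  have "heat_op (t - s) (duhamel m h s) x = (LINT z|gauss. LINT r|M. F r z)"
    unfolding heat_op_def[of "t - s"] duhamel_def set_M F_def ..
  also have "\<dots> = (LINT r|M. LINT z|gauss. F r z)"
    by (rule Fubini_integral[OF int])
  also have "\<dots> = (LINT r|M. exp (- m * (s - r)) *\<^sub>R heat_op (t - r) (h r) x)"
  proof (rule Bochner_Integration.integral_cong[OF refl])
    fix r assume "r \<in> space M"
    then have r: "0 \<le> r" "r \<le> s" by (auto simp: M_def space_restrict_space)
    have [measurable]: "h r \<in> borel_measurable borel"
      by (rule borel_measurable_continuous_onI[OF continuous_on_slice[OF h]])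
    have "(LINT z|gauss. F r z) = exp (- m * (s - r)) *\<^sub>R heat_op (t - s) (heat_op (s - r) (h r)) x"
      unfolding F_def heat_op_def[of "t - s"] by simp
    also have "heat_op (t - s) (heat_op (s - r) (h r)) x = heat_op ((t - s) + (s - r)) (h r) x"
      by (rule heat_op_heat_op[of _ _ _ B]) (use r s B in auto)
    finally show "(LINT z|gauss. F r z) = exp (- m * (s - r)) *\<^sub>R heat_op (t - r) (h r) x" by simp
  qed
  finally show ?thesis unfolding set_M .
qed

text \<open>
  Formally, W solves W' = Laplace W - m W + h, and subtracting (m - m') W from the source changes
  the damping from m to m'. The rigorous version follows R(s), the heat flow for the remaining time
  t - s applied to W(s): by the semigroup law R is differentiable with R' = A - m R, where A(s) is
  the same flow applied to h(s), although W itself need not be differentiable in time.  Integrating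
  (exp(m' s) R)' from 0 to t gives the claim.
\<close>
lemma mild_change_damping:
  fixes W h :: "real \<Rightarrow> real ^ 'n \<Rightarrow> real" and g :: "real ^ 'n \<Rightarrow> real"
  assumes h: "continuous_on UNIV (\<lambda>(s, y). h s y)" and B: "\<And>s y. norm (h s y) \<le> B"
    and g: "continuous_on UNIV g" and C: "\<And>y. norm (g y) \<le> C"
    and W: "continuous_on UNIV (\<lambda>(s, y). W s y)" and D: "\<And>s y. norm (W s y) \<le> D"
    and eq: "\<And>s y. s \<ge> 0 \<Longrightarrow> W s y = exp (- m * s) * heat_op s g y + duhamel m h s y"
    and m: "m \<ge> 0" and t: "t \<ge> 0"
  shows "W t x = exp (- m' * t) * heat_op t g x + duhamel m' (\<lambda>s y. h s y - (m - m') * W s y) t x"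
proof -
  define A where "A = (\<lambda>r. heat_op (t - r) (h r) x)"
  define G where "G = heat_op t g x"
  define R where "R = (\<lambda>s. heat_op (t - s) (W s) x)"
  define P where "P = (\<lambda>s. G + integral {0..s} (\<lambda>r. exp (m * r) * A r))"
  have A_cont: "continuous_on S A" for S
    unfolding A_def by (rule continuous_on_compose_3[OF continuous_on_heat_op[OF h B]]) (intro continuous_intros)+
  have R_eq: "R s = exp (- m * s) * P s" if s: "s \<in> {0..t}" for s
  proof -
    have gc: "continuous_on UNIV (heat_op s g)"
      by (rule continuous_on_slice[OF continuous_on_heat_op_time_space[OF g C]])
    have dc: "continuous_on UNIV (duhamel m h s)"
    proof -
      have "continuous_on UNIV (\<lambda>y. (\<lambda>(t, x). duhamel m h t x) (s, y))"
        by (rule continuous_on_compose2[OF continuous_on_duhamel[OF h B m]])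
          (use s in \<open>auto intro!: continuous_intros\<close>)
      then show ?thesis by simp
    qed
    have Wg: "W s y - exp (- m * s) *\<^sub>R heat_op s g y = duhamel m h s y" for y
      using eq[of s y] s by simp
    have "duhamel m h s = (\<lambda>y. W s y - exp (- m * s) *\<^sub>R heat_op s g y)"
      using Wg by auto
    then have "heat_op (t - s) (duhamel m h s) x = heat_op (t - s) (\<lambda>y. W s y - exp (- m * s) *\<^sub>R heat_op s g y) x" by simp
    also have "\<dots> = heat_op (t - s) (W s) x - heat_op (t - s) (\<lambda>y. exp (- m * s) *\<^sub>R heat_op s g y) x"
    proof (rule heat_op_diff[OF continuous_on_slice[OF W] D])
      show "norm (exp (- m * s) *\<^sub>R heat_op s g y) \<le> exp (- m * s) * C" for y
        using norm_heat_op_le[OF g C, of s y] by (simp add: abs_mult)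
    qed (intro continuous_intros gc)
    also have "heat_op (t - s) (\<lambda>y. exp (- m * s) *\<^sub>R heat_op s g y) x = exp (- m * s) * G"
      using heat_op_heat_op[of "t - s" s g C x] s C borel_measurable_continuous_onI[OF g]
      by (simp add: heat_op_scaleR G_def del: real_scaleR_def) simp
    finally have "R s = exp (- m * s) * G + heat_op (t - s) (duhamel m h s) x" by (simp add: R_def)
    also have "heat_op (t - s) (duhamel m h s) x = (LINT r:{0..s}|lborel. exp (- m * (s - r)) *\<^sub>R A r)"
      unfolding A_def by (rule heat_op_duhamel[OF h B]) (use s m in auto)
    also have "\<dots> = (LINT r:{0..s}|lborel. exp (- m * s) * (exp (m * r) * A r))"
    proof (intro set_lebesgue_integral_cong ballI allI impI)
      fix r
      have "exp (- m * (s - r)) = exp (- m * s) * exp (m * r)"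
        by (simp add: exp_add[symmetric] algebra_simps)
      then show "exp (- m * (s - r)) *\<^sub>R A r = exp (- m * s) * (exp (m * r) * A r)" by simp
    qed simp
    also have "\<dots> = exp (- m * s) * (LINT r:{0..s}|lborel. exp (m * r) * A r)"
      by (rule set_integral_mult_right)
    also have "(LINT r:{0..s}|lborel. exp (m * r) * A r) = integral {0..s} (\<lambda>r. exp (m * r) * A r)"
      by (rule set_borel_integral_eq_integral(2), rule borel_integrable_atLeastAtMost')
        (intro continuous_intros A_cont)
    finally show ?thesis by (simp add: P_def distrib_left)
  qed
  define Q where "Q = (\<lambda>s. exp ((m' - m) * s) * P s)"
  have Q_R: "Q s = exp (m' * s) * R s" if "s \<in> {0..t}" for s
  proof -
    have "exp ((m' - m) * s) = exp (m' * s) * exp (- m * s)"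
      by (simp add: exp_add[symmetric] algebra_simps)
    then show ?thesis unfolding Q_def R_eq[OF that] by (simp only: mult.assoc)
  qed
  have "(Q has_vector_derivative exp (m' * s) * (A s - (m - m') * R s)) (at s within {0..t})" if s: "s \<in> {0..t}" for s
  proof -
    have "((\<lambda>u. integral {0..u} (\<lambda>r. exp (m * r) * A r)) has_vector_derivative exp (m * s) * A s) (at s within {0..t})"
      by (rule integral_has_vector_derivative[OF _ s]) (intro continuous_intros A_cont)
    then have "(P has_real_derivative exp (m * s) * A s) (at s within {0..t})"
      unfolding P_def has_real_derivative_iff_has_vector_derivative[symmetric]
      by (auto intro!: derivative_eq_intros)
    moreover have "((\<lambda>s. exp ((m' - m) * s)) has_real_derivative (m' - m) * exp ((m' - m) * s)) (at s within {0..t})"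
      by (auto intro!: derivative_eq_intros)
    ultimately have "(Q has_real_derivative (m' - m) * exp ((m' - m) * s) * P s + exp (m * s) * A s * exp ((m' - m) * s)) (at s within {0..t})"
      unfolding Q_def by (rule DERIV_mult[rotated])
    also have "(m' - m) * exp ((m' - m) * s) * P s + exp (m * s) * A s * exp ((m' - m) * s) = (m' - m) * Q s + (exp (m * s) * exp ((m' - m) * s)) * A s"
      by (simp add: Q_def)
    also have "exp (m * s) * exp ((m' - m) * s) = exp (m' * s)"
      by (simp add: exp_add[symmetric] algebra_simps)
    also have "(m' - m) * Q s + exp (m' * s) * A s = exp (m' * s) * (A s - (m - m') * R s)"
      unfolding Q_R[OF s] by (simp add: algebra_simps)
    finally show ?thesis by (simp add: has_real_derivative_iff_has_vector_derivative)
  qed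
  then have int: "((\<lambda>s. exp (m' * s) * (A s - (m - m') * R s)) has_integral Q t - Q 0) {0..t}"
    by (rule fundamental_theorem_of_calculus[OF t])
  have Qt: "Q t = exp (m' * t) * W t x" using t by (simp add: Q_R R_def)
  have Q0: "Q 0 = G" by (simp add: Q_def P_def)
  have R_cont: "continuous_on {0..t} R"
    unfolding R_def by (rule continuous_on_compose_3[OF continuous_on_heat_op[OF W D]]) (intro continuous_intros)+
  have "duhamel m' (\<lambda>s y. h s y - (m - m') * W s y) t x = (LINT s:{0..t}|lborel. exp (- m' * t) * (exp (m' * s) * (A s - (m - m') * R s)))"
    unfolding duhamel_def
  proof (intro set_lebesgue_integral_cong ballI allI impI)
    fix s assume s: "s \<in> {0..t}"
    have "heat_op (t - s) (\<lambda>y. h s y - (m - m') *\<^sub>R W s y) x = heat_op (t - s) (h s) x - heat_op (t - s) (\<lambda>y. (m - m') *\<^sub>R W s y) x"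
    proof (rule heat_op_diff[OF continuous_on_slice[OF h] B])
      show "norm ((m - m') *\<^sub>R W s y) \<le> \<bar>m - m'\<bar> * D" for y
        using D[of s y] by (simp add: abs_mult mult_left_mono)
    qed (intro continuous_intros continuous_on_slice[OF W])
    then have "heat_op (t - s) (\<lambda>y. h s y - (m - m') * W s y) x = A s - (m - m') * R s"
      by (simp add: heat_op_scaleR A_def R_def del: real_scaleR_def) simp
    moreover have "exp (- m' * (t - s)) = exp (- m' * t) * exp (m' * s)"
      by (simp add: exp_add[symmetric] algebra_simps)
    ultimately show "exp (- m' * (t - s)) *\<^sub>R heat_op (t - s) (\<lambda>y. h s y - (m - m') * W s y) x = exp (- m' * t) * (exp (m' * s) * (A s - (m - m') * R s))"
      by simp
  qed simp
  also have "\<dots> = exp (- m' * t) * (LINT s:{0..t}|lborel. exp (m' * s) * (A s - (m - m') * R s))"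
    by (rule set_integral_mult_right)
  also have "(LINT s:{0..t}|lborel. exp (m' * s) * (A s - (m - m') * R s)) = integral {0..t} (\<lambda>s. exp (m' * s) * (A s - (m - m') * R s))"
    by (rule set_borel_integral_eq_integral(2), rule borel_integrable_atLeastAtMost')
      (intro continuous_intros A_cont R_cont)
  also have "\<dots> = Q t - Q 0" using int by (rule integral_unique)
  finally show ?thesis
    unfolding Qt Q0 G_def by (simp add: right_diff_distrib mult.assoc[symmetric] exp_add[symmetric])
qed

section \<open>Continuity of the heat semigroup in time\<close>

lemma heat_op_eq_lborel_integral':
  fixes f :: "real ^ 'n \<Rightarrow> 'b::{banach, second_countable_topology}"
  assumes "t > 0" "f \<in> borel_measurable borel"
  shows "heat_op t f x = (LINT z|lborel. heat_kernel t z *\<^sub>R f (x - z))"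
  using heat_op_eq_lborel_integral[OF assms, of x] lborel_integral_reflect[of "\<lambda>y. heat_kernel t (x - y) *\<^sub>R f y" x] assms(2) by simp

lemma integrable_heat_kernel: "t > 0 \<Longrightarrow> integrable lborel (heat_kernel t :: real ^ 'n \<Rightarrow> real)"
  by (rule integrableI_nonneg) (auto simp: nn_integral_heat_kernel)

lemma integral_heat_kernel: "t > 0 \<Longrightarrow> (LINT z|lborel. heat_kernel t (z :: real ^ 'n)) = 1"
  by (rule has_bochner_integral_integral_eq, rule has_bochner_integral_nn_integral) (auto simp: nn_integral_heat_kernel)

text \<open>
  A pointwise inequality replaces an estimate of the time derivative of the kernel: the kernel at
  the later time r' is at least (r/r')^(d/2) times the kernel at time r.  Both have mass 1, so their
  distance in L^1 is at most 2 (1 - (r/r')^(d/2)), and Bernoulli's inequality bounds this by a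
  multiple of (r' - r) / r'.
\<close>
lemma norm_heat_op_time_diff_le:
  fixes f :: "real ^ 'n \<Rightarrow> 'b::{banach, second_countable_topology}"
  assumes f: "continuous_on UNIV f" and C: "\<And>x. norm (f x) \<le> C" and r: "0 < r" "r \<le> r'"
  shows "norm (heat_op r' f x - heat_op r f x) \<le> 2 * real CARD('n) * C * ((r' - r) / r')"
proof -
  have [measurable]: "f \<in> borel_measurable borel" by (rule borel_measurable_continuous_onI[OF f])
  have C0: "C \<ge> 0" using order_trans[OF norm_ge_zero C] .
  have r': "r' > 0" using r by simp
  define \<theta> where "\<theta> = (r / r') powr (real CARD('n) / 2)"
  have \<theta>: "0 \<le> \<theta>" "\<theta> \<le> 1" using r r' by (auto simp: \<theta>_def powr_le_one_le intro!: powr_le1)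
  have K: "\<theta> * heat_kernel r z \<le> heat_kernel r' z" for z :: "real ^ 'n"
  proof -
    have e: "exp (- (norm z)\<^sup>2 / (4 * r)) \<le> exp (- (norm z)\<^sup>2 / (4 * r'))"
      using r r' by (simp add: frac_le)
    have c: "\<theta> * (4 * pi * r) powr (- real CARD('n) / 2) = (4 * pi * r') powr (- real CARD('n) / 2)"
    proof -
      have "(4 * pi * r) powr (- real CARD('n) / 2) = (r / r' * (4 * pi * r')) powr (- real CARD('n) / 2)"
        using r' by (simp add: mult_ac)
      also have "\<dots> = (r / r') powr (- (real CARD('n) / 2)) * (4 * pi * r') powr (- real CARD('n) / 2)"
        by (simp only: powr_mult minus_divide_left)
      finally show ?thesis using r r' by (simp add: \<theta>_def powr_add[symmetric] mult.assoc[symmetric])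
    qed
    show ?thesis unfolding heat_kernel_def mult.assoc[symmetric] c
      by (rule mult_left_mono[OF e]) simp
  qed
  have i: "integrable lborel (\<lambda>z. heat_kernel s z *\<^sub>R f (x - z))" if "s > 0" for s
  proof (rule Bochner_Integration.integrable_bound)
    show "integrable lborel (\<lambda>z :: real ^ 'n. C * heat_kernel s z)"
      using integrable_heat_kernel[OF that, where 'n = 'n] by simp
    show "AE z in lborel. norm (heat_kernel s z *\<^sub>R f (x - z)) \<le> norm (C * heat_kernel s z)"
    proof (rule AE_I2)
      fix z
      have "heat_kernel s z * norm (f (x - z)) \<le> heat_kernel s z * C" by (intro mult_left_mono C) simp
      then show "norm (heat_kernel s z *\<^sub>R f (x - z)) \<le> norm (C * heat_kernel s z)"
        using C0 by (simp add: mult.commute)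
    qed
  qed measurable
  have "heat_op r' f x - \<theta> *\<^sub>R heat_op r f x = (LINT z|lborel. (heat_kernel r' z - \<theta> * heat_kernel r z) *\<^sub>R f (x - z))"
    using i[OF r(1)] i[OF r'] r(1) r'
    by (simp add: heat_op_eq_lborel_integral' scaleR_diff_left flip: scaleR_scaleR)
  also have "norm \<dots> \<le> (LINT z|lborel. (heat_kernel r' (z :: real ^ 'n) - \<theta> * heat_kernel r z) * C)"
  proof (rule Bochner_Integration.integral_norm_bound_integral)
    show "integrable lborel (\<lambda>z. (heat_kernel r' z - \<theta> * heat_kernel r z) *\<^sub>R f (x - z))"
      using i[OF r(1)] i[OF r'] by (simp add: scaleR_diff_left flip: scaleR_scaleR)
    show "integrable lborel (\<lambda>z :: real ^ 'n. (heat_kernel r' z - \<theta> * heat_kernel r z) * C)"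
      using integrable_heat_kernel[OF r(1), where 'n = 'n] integrable_heat_kernel[OF r', where 'n = 'n] by simp
    show "norm ((heat_kernel r' z - \<theta> * heat_kernel r z) *\<^sub>R f (x - z)) \<le> (heat_kernel r' z - \<theta> * heat_kernel r z) * C" for z
      using K[of z] C[of "x - z"] by (simp add: mult_left_mono)
  qed
  also have "\<dots> = (1 - \<theta>) * C"
    using integrable_heat_kernel[OF r(1), where 'n = 'n] integrable_heat_kernel[OF r', where 'n = 'n]
      integral_heat_kernel[OF r(1), where 'n = 'n] integral_heat_kernel[OF r', where 'n = 'n] by simp
  finally have 1: "norm (heat_op r' f x - \<theta> *\<^sub>R heat_op r f x) \<le> (1 - \<theta>) * C" .
  have "norm ((1 - \<theta>) *\<^sub>R heat_op r f x) \<le> (1 - \<theta>) * C"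
    using \<theta> norm_heat_op_le[OF f C, of r x] by (simp add: mult_left_mono)
  moreover have "norm (heat_op r' f x - heat_op r f x) = norm ((heat_op r' f x - \<theta> *\<^sub>R heat_op r f x) - (1 - \<theta>) *\<^sub>R heat_op r f x)"
    by (rule arg_cong[where f = norm]) (simp add: algebra_simps)
  moreover note norm_triangle_ineq4[of "heat_op r' f x - \<theta> *\<^sub>R heat_op r f x" "(1 - \<theta>) *\<^sub>R heat_op r f x"]
  ultimately have "norm (heat_op r' f x - heat_op r f x) \<le> (1 - \<theta>) * C + (1 - \<theta>) * C"
    using 1 by linarith
  also have "\<dots> = 2 * C * (1 - \<theta>)" by simp
  also have "\<dots> \<le> 2 * C * (real CARD('n) * ((r' - r) / r'))"
  proof (rule mult_left_mono)
    have "1 - real CARD('n) * ((r' - r) / r') \<le> (1 + (- ((r' - r) / r'))) ^ CARD('n)"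
      using Bernoulli_inequality[of "- ((r' - r) / r')" "CARD('n)"] r r' by simp
    also have "1 + (- ((r' - r) / r')) = r / r'" using r' by (simp add: field_simps)
    also have "(r / r') ^ CARD('n) = (r / r') powr real CARD('n)" using r r' by (simp add: powr_realpow)
    also have "\<dots> \<le> \<theta>" unfolding \<theta>_def using r r' by (intro powr_mono') auto
    finally show "1 - \<theta> \<le> real CARD('n) * ((r' - r) / r')" by simp
  qed (use C0 in simp)
  finally show ?thesis by (simp only: mult_ac)
qed

text \<open>
  The increment of g over w is at most e / 2 + K (1 - exp(-|w|^2)): the first summand covers small
  w, the second large w. The Gaussian average of this bound at scale sqrt t is continuous in t, with
  value e / 2 at t = 0.
\<close>
lemma heat_op_uniformly_continuous_at_0:
  fixes g :: "real ^ 'n \<Rightarrow> 'b::{banach, second_countable_topology}"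
  assumes g: "uniformly_continuous_on UNIV g" and C: "\<And>x. norm (g x) \<le> C" and e: "e > 0"
  shows "\<exists>d>0. \<forall>t\<in>{0..<d}. \<forall>x. norm (heat_op t g x - g x) \<le> e"
proof -
  have gc: "continuous_on UNIV g" by (rule uniformly_continuous_imp_continuous[OF g])
  have C0: "C \<ge> 0" using order_trans[OF norm_ge_zero C] .
  obtain \<rho> where \<rho>: "\<rho> > 0" "\<And>x y. dist y x < \<rho> \<Longrightarrow> dist (g y) (g x) < e / 2"
    using g e unfolding uniformly_continuous_on_def by (metis UNIV_I half_gt_zero)
  define K where "K = 2 * C / (1 - exp (- (\<rho>\<^sup>2)))"
  have K0: "K \<ge> 0" using C0 by (simp add: K_def)
  have pt: "norm (g (x - w) - g x) \<le> e / 2 + K * (1 - exp (- ((norm w)\<^sup>2)))" for x w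
  proof (cases "norm w < \<rho>")
    case True
    then have "norm (g (x - w) - g x) < e / 2"
      using \<rho>(2)[of "x - w" x] by (simp add: dist_norm)
    moreover have "K * (1 - exp (- ((norm w)\<^sup>2))) \<ge> 0" using K0 by simp
    ultimately show ?thesis by simp
  next
    case False
    have "norm (g (x - w) - g x) \<le> 2 * C"
      using norm_triangle_ineq4[of "g (x - w)" "g x"] C[of "x - w"] C[of x] by simp
    also have "2 * C = K * (1 - exp (- (\<rho>\<^sup>2)))" using \<rho>(1) by (simp add: K_def)
    also have "\<dots> \<le> K * (1 - exp (- ((norm w)\<^sup>2)))"
      using False \<rho>(1) K0 by (intro mult_left_mono) (auto intro!: power_mono)
    finally show ?thesis using e by simp
  qed
  define \<Phi> where "\<Phi> = (\<lambda>t. LINT z|(gauss :: (real ^ 'n) measure). e / 2 + K * (1 - exp (- ((norm (sqrt t *\<^sub>R z))\<^sup>2))))"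
  have meas: "(\<lambda>z. e / 2 + K * (1 - exp (- ((norm (sqrt t *\<^sub>R z))\<^sup>2)))) \<in> borel_measurable (gauss :: (real ^ 'n) measure)" for t
    by measurable
  have bd: "norm (e / 2 + K * (1 - exp (- ((norm (sqrt t *\<^sub>R z))\<^sup>2)))) \<le> e / 2 + K" for t and z :: "real ^ 'n"
  proof -
    have "0 \<le> K * (1 - exp (- q))" "K * (1 - exp (- q)) \<le> K" if "q \<ge> 0" for q
      using K0 mult_left_mono[of "1 - exp (- q)" 1 K] that by auto
    from this[of "(norm (sqrt t *\<^sub>R z))\<^sup>2"] show ?thesis using e by simp
  qed
  have "continuous_on UNIV \<Phi>"
    unfolding \<Phi>_def
    by (rule continuous_on_integral_parameter[where B = "e / 2 + K", OF gauss.finite_measure_axioms meas _ bd])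
      (auto intro!: continuous_intros)
  moreover have "\<Phi> 0 = e / 2" by (simp add: \<Phi>_def)
  ultimately have "(\<Phi> \<longlongrightarrow> e / 2) (at 0)"
    by (metis UNIV_I continuous_on_def)
  then have "\<forall>\<^sub>F t in at 0. \<Phi> t < e" using order_tendstoD(2)[of \<Phi> "e / 2" "at 0" e] e by simp
  then obtain d where d: "d > 0" "\<And>t. t \<noteq> 0 \<Longrightarrow> dist t 0 < d \<Longrightarrow> \<Phi> t < e"
    unfolding eventually_at by auto
  have "norm (heat_op t g x - g x) \<le> e" if t: "t \<in> {0..<d}" for t x
  proof -
    have "heat_op t g x - g x = (LINT z|gauss. g (x - sqrt t *\<^sub>R z) - g x)"
      unfolding heat_op_def using gauss_integrable[OF gc C, of x "sqrt t"] by simp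
    also have "norm \<dots> \<le> \<Phi> t"
      unfolding \<Phi>_def
    proof (rule Bochner_Integration.integral_norm_bound_integral)
      show "integrable gauss (\<lambda>z. g (x - sqrt t *\<^sub>R z) - g x)"
        using gauss_integrable[OF gc C, of x "sqrt t"] by simp
      show "integrable gauss (\<lambda>z :: real ^ 'n. e / 2 + K * (1 - exp (- ((norm (sqrt t *\<^sub>R z))\<^sup>2))))"
        by (rule gauss.integrable_const_bound[OF AE_I2[OF bd] meas])
      show "norm (g (x - sqrt t *\<^sub>R z) - g x) \<le> e / 2 + K * (1 - exp (- ((norm (sqrt t *\<^sub>R z))\<^sup>2)))" for z
        by (rule pt)
    qed
    also have "\<dots> \<le> e" using d(2)[of t] t e \<open>\<Phi> 0 = e / 2\<close> by (cases "t = 0") (auto intro: less_imp_le)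
    finally show ?thesis .
  qed
  then show ?thesis using d(1) by blast
qed

section \<open>Global solutions for Lipschitz reactions\<close>

lemma duhamel_cong:
  assumes "\<And>s y. 0 \<le> s \<Longrightarrow> s \<le> t \<Longrightarrow> h s y = k s y"
  shows "duhamel m h t x = duhamel m k t x"
  unfolding duhamel_def
proof (intro set_lebesgue_integral_cong ballI allI impI)
  fix s assume "s \<in> {0..t}"
  then have "h s = k s" using assms by auto
  then show "exp (- m * (t - s)) *\<^sub>R heat_op (t - s) (h s) x = exp (- m * (t - s)) *\<^sub>R heat_op (t - s) (k s) x" by simp
qed simp

lemma duhamel_diff:
  fixes h k :: "real \<Rightarrow> real ^ 'n \<Rightarrow> 'b::{banach, second_countable_topology}"
  assumes h: "continuous_on UNIV (\<lambda>(s, y). h s y)" "\<And>s y. norm (h s y) \<le> B"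
    and k: "continuous_on UNIV (\<lambda>(s, y). k s y)" "\<And>s y. norm (k s y) \<le> C"
  shows "duhamel m (\<lambda>s y. h s y - k s y) t x = duhamel m h t x - duhamel m k t x"
  unfolding duhamel_def
    heat_op_diff[OF continuous_on_slice[OF h(1)] h(2) continuous_on_slice[OF k(1)] k(2)] scaleR_diff_right
  by (rule set_integral_diff(2)[OF duhamel_integrable[OF h] duhamel_integrable[OF k]])

lemma duhamel_uminus: "duhamel m (\<lambda>s y. - h s y) t x = - duhamel m h t x"
  by (simp add: duhamel_def heat_op_def set_lebesgue_integral_def)

lemma duhamel_mono:
  fixes h k :: "real \<Rightarrow> real ^ 'n \<Rightarrow> real"
  assumes h: "continuous_on UNIV (\<lambda>(s, y). h s y)" "\<And>s y. norm (h s y) \<le> B"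
    and k: "continuous_on UNIV (\<lambda>(s, y). k s y)" "\<And>s y. norm (k s y) \<le> C"
    and le: "\<And>s y. 0 \<le> s \<Longrightarrow> s \<le> t \<Longrightarrow> h s y \<le> k s y"
  shows "duhamel m h t x \<le> duhamel m k t x"
  unfolding duhamel_def
proof (rule set_integral_mono[OF duhamel_integrable[OF h] duhamel_integrable[OF k]])
  fix s assume "s \<in> {0..t}"
  then show "exp (- m * (t - s)) *\<^sub>R heat_op (t - s) (h s) x \<le> exp (- m * (t - s)) *\<^sub>R heat_op (t - s) (k s) x"
    using le heat_op_mono[OF continuous_on_slice[OF h(1)] h(2) continuous_on_slice[OF k(1)] k(2)]
    by (auto intro!: mult_left_mono)
qed

lemma duhamel_space_const: "duhamel m (\<lambda>s _. \<phi> s) t x = (LINT s:{0..t}|lborel. exp (- m * (t - s)) *\<^sub>R \<phi> s)"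
  by (simp add: duhamel_def)

text \<open>
  The reaction F(u) + L u in terms of the rescaled unknown w = exp(-2 L s) u.  It is nondecreasing
  and 2L-Lipschitz in w. Cutting the time off at 0 keeps the factor exp(-2 L s) bounded on the whole
  time axis, so that fixed points can be sought among bounded continuous functions on the full
  space-time.
\<close>
definition damped_reaction :: "(real \<Rightarrow> real) \<Rightarrow> real \<Rightarrow> real \<Rightarrow> real \<Rightarrow> real" where
  "damped_reaction F L s w = exp (- 2 * L * max 0 s) * F (exp (2 * L * max 0 s) * w) + L * w"

text \<open>
  The total damping 3 L is the sum of L, which makes the reaction nondecreasing, and 2 L, which
  comes from the rescaling.
\<close>
definition damped_solution :: "(real \<Rightarrow> real) \<Rightarrow> real \<Rightarrow> (real ^ 'n \<Rightarrow> real) \<Rightarrow> (real \<Rightarrow> real ^ 'n \<Rightarrow> real) \<Rightarrow> bool" where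
  "damped_solution F L g W \<longleftrightarrow> continuous_on UNIV (\<lambda>(s, y). W s y) \<and> (\<exists>D. \<forall>s y. norm (W s y) \<le> D) \<and>
     (\<forall>t\<ge>0. \<forall>x. W t x = exp (- (3 * L) * t) * heat_op t g x + duhamel (3 * L) (\<lambda>s y. damped_reaction F L s (W s y)) t x)"

locale lipschitz_reaction =
  fixes F :: "real \<Rightarrow> real" and L B :: real
  assumes L: "L > 0" and Lip: "\<And>x y. \<bar>F x - F y\<bar> \<le> L * \<bar>x - y\<bar>" and FB: "\<And>x. \<bar>F x\<bar> \<le> B"
begin

lemma continuous_F: "continuous_on A F"
proof -
  have "L-lipschitz_on A F"
    using L Lip by (intro lipschitz_onI) (auto simp: dist_real_def)
  then show ?thesis by (rule lipschitz_on_continuous_on)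
qed

lemma F_continuous_on_compose: "continuous_on A f \<Longrightarrow> continuous_on A (\<lambda>x. F (f x))"
  by (rule continuous_on_compose2[OF continuous_F[of UNIV]]) auto

lemma damped_reaction_bounds:
  assumes "w \<le> w'"
  shows "damped_reaction F L s w \<le> damped_reaction F L s w'"
    and "damped_reaction F L s w' - damped_reaction F L s w \<le> 2 * L * (w' - w)"
proof -
  define e where "e = exp (2 * L * max 0 s)"
  have e: "e > 0" "exp (- 2 * L * max 0 s) = inverse e" by (simp_all add: e_def exp_minus)
  have "\<bar>F (e * w') - F (e * w)\<bar> \<le> L * (e * (w' - w))"
    using Lip[of "e * w'" "e * w"] assms e by (simp add: abs_mult flip: right_diff_distrib)
  then have "\<bar>inverse e * (F (e * w') - F (e * w))\<bar> \<le> L * (w' - w)"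
    using e by (simp add: abs_mult field_simps)
  then show "damped_reaction F L s w \<le> damped_reaction F L s w'"
    and "damped_reaction F L s w' - damped_reaction F L s w \<le> 2 * L * (w' - w)"
    unfolding damped_reaction_def e(2) e_def[symmetric] by (auto simp: algebra_simps)
qed

lemma damped_reaction_lipschitz: "\<bar>damped_reaction F L s w' - damped_reaction F L s w\<bar> \<le> 2 * L * \<bar>w' - w\<bar>"
  using damped_reaction_bounds[of w w' s] damped_reaction_bounds[of w' w s] by (cases "w \<le> w'") auto

lemma norm_damped_reaction_le: "norm w \<le> D \<Longrightarrow> norm (damped_reaction F L s w) \<le> B + L * D"
proof -
  assume D: "norm w \<le> D"
  have "\<bar>exp (- 2 * L * max 0 s) * F (exp (2 * L * max 0 s) * w)\<bar> \<le> 1 * B"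
    unfolding abs_mult using L FB by (intro mult_mono) auto
  moreover have "\<bar>L * w\<bar> \<le> L * D" using D L by (simp add: abs_mult)
  ultimately show ?thesis unfolding damped_reaction_def by (simp add: abs_le_iff)
qed

lemma continuous_on_damped_reaction:
  assumes "continuous_on UNIV (\<lambda>(s, y). W s y)"
  shows "continuous_on UNIV (\<lambda>(s, y). damped_reaction F L s (W s y))"
  unfolding damped_reaction_def split_beta
  by (intro continuous_intros F_continuous_on_compose assms[unfolded split_beta])

text \<open>
  The integral of exp(-3 L t) over all times is 1 / (3 L), and the reaction is 2L-Lipschitz.  So
  Duhamel's formula defines a contraction with constant 2 / 3 on the bounded continuous functions of
  time and space.
\<close>
lemma damped_solution_exists:
  fixes g :: "real ^ 'n \<Rightarrow> real"
  assumes g: "continuous_on UNIV g" and C: "\<And>y. norm (g y) \<le> C"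
  shows "\<exists>W. damped_solution F L g W"
proof -
  define source where "source = (\<lambda>(w :: (real \<times> (real ^ 'n)) \<Rightarrow>\<^sub>C real) s y. damped_reaction F L s (apply_bcontfun w (s, y)))"
  have w_norm: "norm (apply_bcontfun w p) \<le> norm w" for w :: "(real \<times> (real ^ 'n)) \<Rightarrow>\<^sub>C real" and p
    by (rule norm_bounded)
  have src: "continuous_on UNIV (\<lambda>(s, y). source w s y)" "norm (source w s y) \<le> B + L * norm w" for w s y
    unfolding source_def
    by (rule continuous_on_damped_reaction, simp) (rule norm_damped_reaction_le[OF w_norm])
  define \<phi> where "\<phi> = (\<lambda>w (t, x). exp (- (3 * L) * max 0 t) * heat_op (max 0 t) g x + duhamel (3 * L) (source w) (max 0 t) x)"
  have \<phi>: "\<phi> w \<in> bcontfun" for w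
    unfolding bcontfun_def
  proof (rule CollectI, rule conjI)
    have 1: "continuous_on UNIV (\<lambda>p :: real \<times> (real ^ 'n). heat_op (max 0 (fst p)) g (snd p))"
      by (rule continuous_on_compose_2[OF continuous_on_heat_op_time_space[OF g C]]) (intro continuous_intros)+
    have "continuous_on UNIV (\<lambda>p :: real \<times> (real ^ 'n). (\<lambda>(t, x). duhamel (3 * L) (source w) t x) (max 0 (fst p), snd p))"
      by (rule continuous_on_compose2[OF continuous_on_duhamel[OF src]])
        (use L in \<open>auto intro!: continuous_intros\<close>)
    then have 2: "continuous_on UNIV (\<lambda>p :: real \<times> (real ^ 'n). duhamel (3 * L) (source w) (max 0 (fst p)) (snd p))" by simp
    show "continuous_on UNIV (\<phi> w)" unfolding \<phi>_def split_beta by (intro continuous_intros 1 2)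
    have "norm (\<phi> w p) \<le> C + (B + L * norm w) / (3 * L)" for p
    proof -
      have "norm (exp (- (3 * L) * max 0 (fst p)) * heat_op (max 0 (fst p)) g (snd p)) \<le> 1 * C"
        unfolding norm_mult using L by (intro mult_mono norm_heat_op_le[OF g C]) auto
      moreover have "norm (duhamel (3 * L) (source w) (max 0 (fst p)) (snd p)) \<le> (B + L * norm w) / (3 * L)"
        by (rule norm_duhamel_le[OF src]) (use L in auto)
      ultimately show ?thesis
        unfolding \<phi>_def split_beta by (intro norm_triangle_le add_mono) auto
    qed
    then show "bounded (range (\<phi> w))" by (auto simp: bounded_iff)
  qed
  define \<Phi> where "\<Phi> = (\<lambda>w. Bcontfun (\<phi> w))"
  have \<Phi>: "apply_bcontfun (\<Phi> w) = \<phi> w" for w unfolding \<Phi>_def by (rule Bcontfun_inverse[OF \<phi>])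
  have contr: "dist (\<Phi> w) (\<Phi> w') \<le> 2 / 3 * dist w w'" for w w'
  proof (rule dist_bound)
    fix p :: "real \<times> (real ^ 'n)"
    have "dist (\<phi> w p) (\<phi> w' p) = norm (duhamel (3 * L) (\<lambda>s y. source w s y - source w' s y) (max 0 (fst p)) (snd p))"
      unfolding duhamel_diff[OF src src] by (simp add: \<phi>_def split_beta dist_norm)
    also have "\<dots> \<le> (2 * L * dist w w') / (3 * L)"
    proof (rule norm_duhamel_le)
      show "continuous_on UNIV (\<lambda>(s, y). source w s y - source w' s y)"
        using continuous_on_diff[OF src(1)[of w] src(1)[of w']] by (simp add: split_beta)
      show "norm (source w s y - source w' s y) \<le> 2 * L * dist w w'" for s y
      proof -
        have "norm (source w s y - source w' s y) \<le> 2 * L * \<bar>apply_bcontfun w (s, y) - apply_bcontfun w' (s, y)\<bar>"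
          unfolding source_def real_norm_def by (rule damped_reaction_lipschitz)
        also have "\<dots> \<le> 2 * L * dist w w'"
          using L dist_bounded[of w "(s, y)" w'] by (intro mult_left_mono) (auto simp: dist_real_def)
        finally show ?thesis .
      qed
    qed (use L in auto)
    also have "\<dots> = 2 / 3 * dist w w'" using L by simp
    finally show "dist (apply_bcontfun (\<Phi> w) p) (apply_bcontfun (\<Phi> w') p) \<le> 2 / 3 * dist w w'" unfolding \<Phi> .
  qed
  have "\<exists>!w. \<Phi> w = w"
    by (rule banach_fix_type[where c = "2 / 3"]) (use contr in auto)
  then obtain w where w: "\<Phi> w = w" by auto
  define W where "W = (\<lambda>s y. apply_bcontfun w (s, y))"
  have "damped_solution F L g W"
    unfolding damped_solution_def
  proof (intro conjI allI impI)
    show "continuous_on UNIV (\<lambda>(s, y). W s y)" by (simp add: W_def)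
    show "\<exists>D. \<forall>s y. norm (W s y) \<le> D" unfolding W_def using w_norm by blast
    fix t :: real and x assume t: "0 \<le> t"
    have "W t x = \<phi> w (t, x)" unfolding W_def using \<Phi>[of w] w by simp
    also have "\<dots> = exp (- (3 * L) * t) * heat_op t g x + duhamel (3 * L) (source w) t x"
      using t by (simp add: \<phi>_def max_absorb2)
    also have "source w = (\<lambda>s y. damped_reaction F L s (W s y))" by (simp add: source_def W_def)
    finally show "W t x = exp (- (3 * L) * t) * heat_op t g x + duhamel (3 * L) (\<lambda>s y. damped_reaction F L s (W s y)) t x" .
  qed
  then show ?thesis by blast
qed

text \<open>
  Let p be the rescaled subsolution.  If p exceeds the solution W by at most E, then monotonicity
  and the Lipschitz bound of the damped reaction show that the Duhamel formula reduces the excess to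
  2 / 3 E.  Iterating leaves no excess.
\<close>
lemma damped_solution_ge_subsolution:
  fixes g :: "real ^ 'n \<Rightarrow> real" and v :: "real \<Rightarrow> real"
  assumes g: "continuous_on UNIV g" and C: "\<And>y. norm (g y) \<le> C"
    and W: "damped_solution F L g W"
    and v0: "\<And>x. v 0 \<le> g x" and deriv: "\<And>t. t \<ge> 0 \<Longrightarrow> (v has_real_derivative v' t) (at t)"
    and sub: "\<And>t. t \<ge> 0 \<Longrightarrow> v' t \<le> F (v t)" and bd: "\<And>t. t \<ge> 0 \<Longrightarrow> \<bar>v t\<bar> \<le> V"
    and t: "t \<ge> 0"
  shows "v t \<le> exp (2 * L * t) * W t x"
proof -
  obtain D where Wc: "continuous_on UNIV (\<lambda>(s, y). W s y)" and WD: "\<And>s y. norm (W s y) \<le> D"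
    and Weq: "\<And>t x. t \<ge> 0 \<Longrightarrow> W t x = exp (- (3 * L) * t) * heat_op t g x + duhamel (3 * L) (\<lambda>s y. damped_reaction F L s (W s y)) t x"
    using W unfolding damped_solution_def by auto
  define p where "p = (\<lambda>t. exp (- 2 * L * max 0 t) * v (max 0 t))"
  have vc: "continuous_on {0..} v"
    using deriv by (auto intro!: continuous_at_imp_continuous_on DERIV_isCont)
  have pc: "continuous_on UNIV p"
    unfolding p_def by (intro continuous_intros continuous_on_compose2[OF vc]) auto
  have pV: "norm (p s) \<le> V" for s
  proof -
    have "\<bar>exp (- 2 * L * max 0 s) * v (max 0 s)\<bar> \<le> 1 * V"
      unfolding abs_mult using L bd by (intro mult_mono) auto
    then show ?thesis by (simp add: p_def)
  qed
  define q where "q = (\<lambda>s. damped_reaction F L s (p s))"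
  have qc: "continuous_on UNIV (\<lambda>(s, y :: real ^ 'n). q s)"
    unfolding q_def
    by (rule continuous_on_damped_reaction[of "\<lambda>s _. p s"]) (auto simp: split_beta intro!: continuous_on_compose2[OF pc] continuous_intros)
  have qB: "norm (q s) \<le> B + L * V" for s
    unfolding q_def by (rule norm_damped_reaction_le[OF pV])
  \<comment> \<open>the differential inequality for v, multiplied by the integrating factor exp(L s) and
    integrated, is the integral inequality for p\<close>
  have p_int: "p t \<le> exp (- (3 * L) * t) * v 0 + duhamel (3 * L) (\<lambda>s _. q s) t x" if t: "t \<ge> 0" for t and x :: "real ^ 'n"
  proof -
    have qc': "continuous_on {0..t} (\<lambda>s. exp (3 * L * s) * q s)"
      using continuous_on_compose_2[OF qc continuous_on_id continuous_on_const]
      by (intro continuous_intros) (auto intro: continuous_on_subset)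
    have i1: "((\<lambda>s. exp (L * s) * (v' s + L * v s)) has_integral exp (L * t) * v t - exp (L * 0) * v 0) {0..t}"
    proof (rule fundamental_theorem_of_calculus[OF t])
      fix s assume "s \<in> {0..t}"
      then have "((\<lambda>s. exp (L * s) * v s) has_real_derivative exp (L * s) * (v' s + L * v s)) (at s)"
        by (auto intro!: derivative_eq_intros deriv simp: algebra_simps)
      then show "((\<lambda>s. exp (L * s) * v s) has_vector_derivative exp (L * s) * (v' s + L * v s)) (at s within {0..t})"
        unfolding has_real_derivative_iff_has_vector_derivative by (rule has_vector_derivative_at_within)
    qed
    have "exp (L * t) * v t - exp (L * 0) * v 0 \<le> integral {0..t} (\<lambda>s. exp (3 * L * s) * q s)"
    proof (rule has_integral_le[OF i1 integrable_integral])
      show "(\<lambda>s. exp (3 * L * s) * q s) integrable_on {0..t}"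
        by (rule integrable_continuous_real[OF qc'])
      fix s assume s: "s \<in> {0..t}"
      have ms: "max 0 s = s" using s by simp
      have ps: "p s = exp (- 2 * L * s) * v s" unfolding p_def ms ..
      have "exp (2 * L * s) * p s = v s" unfolding ps by (simp add: exp_minus mult.assoc[symmetric])
      then have "q s = exp (- 2 * L * s) * F (v s) + L * p s"
        unfolding q_def damped_reaction_def ms by simp
      also have "\<dots> = exp (- 2 * L * s) * (F (v s) + L * v s)"
        unfolding ps by (simp add: distrib_left)
      finally have "exp (3 * L * s) * q s = exp (3 * L * s) * (exp (- 2 * L * s) * (F (v s) + L * v s))" by simp
      also have "\<dots> = exp (L * s) * (F (v s) + L * v s)"
        by (simp add: mult.assoc[symmetric] exp_add[symmetric])
      finally show "exp (L * s) * (v' s + L * v s) \<le> exp (3 * L * s) * q s"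
        using sub[of s] s by simp
    qed
    also have "\<dots> = (LINT s:{0..t}|lborel. exp (3 * L * s) * q s)"
      by (rule set_borel_integral_eq_integral(2)[symmetric], rule borel_integrable_atLeastAtMost'[OF qc'])
    finally have "exp (- (3 * L) * t) * (exp (L * t) * v t - v 0) \<le> exp (- (3 * L) * t) * (LINT s:{0..t}|lborel. exp (3 * L * s) * q s)"
      by (intro mult_left_mono) auto
    also have "\<dots> = (LINT s:{0..t}|lborel. exp (- (3 * L) * t) * (exp (3 * L * s) * q s))"
      by (rule set_integral_mult_right[symmetric])
    also have "\<dots> = duhamel (3 * L) (\<lambda>s _. q s) t x"
      unfolding duhamel_space_const
    proof (intro set_lebesgue_integral_cong ballI allI impI)
      fix s
      have "exp (- (3 * L) * (t - s)) = exp (- (3 * L) * t) * exp (3 * L * s)"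
        by (simp add: exp_add[symmetric] algebra_simps)
      then show "exp (- (3 * L) * t) * (exp (3 * L * s) * q s) = exp (- (3 * L) * (t - s)) *\<^sub>R q s" by simp
    qed simp
    also have "exp (- (3 * L) * t) * (exp (L * t) * v t - v 0) = p t - exp (- (3 * L) * t) * v 0"
    proof -
      have "exp (- (3 * L) * t) * exp (L * t) = exp (- 2 * L * t)"
        by (simp add: exp_add[symmetric])
      then show ?thesis using t by (simp add: p_def right_diff_distrib mult.assoc[symmetric])
    qed
    finally show ?thesis by simp
  qed
  have step: "p t - W t x \<le> 2 / 3 * E"
    if E: "E \<ge> 0" "\<And>t x. t \<ge> 0 \<Longrightarrow> p t - W t x \<le> E" and t: "t \<ge> 0" for E t x
  proof -
    have 1: "exp (- (3 * L) * t) * v 0 \<le> exp (- (3 * L) * t) * heat_op t g x"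
      by (intro mult_left_mono heat_op_ge_const[OF g C v0]) auto
    have "duhamel (3 * L) (\<lambda>s y. q s - 2 * L * E) t x \<le> duhamel (3 * L) (\<lambda>s y. damped_reaction F L s (W s y)) t x"
    proof (rule duhamel_mono)
      show "continuous_on UNIV (\<lambda>(s, y :: real ^ 'n). q s - 2 * L * E)"
        using qc by (auto simp: split_beta intro!: continuous_intros)
      show "norm (q s - 2 * L * E) \<le> B + L * V + 2 * L * E" for s
      proof -
        have "0 \<le> 2 * L * E" using L E by simp
        then show ?thesis using qB[of s] by (simp add: abs_le_iff)
      qed
      show "continuous_on UNIV (\<lambda>(s, y). damped_reaction F L s (W s y))"
        by (rule continuous_on_damped_reaction[OF Wc])
      show "norm (damped_reaction F L s (W s y)) \<le> B + L * D" for s y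
        by (rule norm_damped_reaction_le[OF WD])
      fix s :: real and y assume s: "0 \<le> s"
      show "q s - 2 * L * E \<le> damped_reaction F L s (W s y)"
      proof (cases "W s y \<le> p s")
        case True
        then have "q s - damped_reaction F L s (W s y) \<le> 2 * L * (p s - W s y)"
          unfolding q_def by (rule damped_reaction_bounds(2))
        also have "\<dots> \<le> 2 * L * E" using E(2)[OF s] L by (intro mult_left_mono) auto
        finally show ?thesis by simp
      next
        case False
        then have "q s \<le> damped_reaction F L s (W s y)"
          unfolding q_def by (intro damped_reaction_bounds(1)) auto
        moreover have "0 \<le> 2 * L * E" using L E by simp
        ultimately show ?thesis by linarith
      qed
    qed
    moreover have "duhamel (3 * L) (\<lambda>s y. q s - 2 * L * E) t x = duhamel (3 * L) (\<lambda>s y. q s) t x - duhamel (3 * L) (\<lambda>s y. 2 * L * E) t x"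
      by (rule duhamel_diff[OF qc qB, of "\<lambda>_ _. 2 * L * E" "\<bar>2 * L * E\<bar>"]) auto
    moreover have "duhamel (3 * L) (\<lambda>s (y :: real ^ 'n). 2 * L * E) t x \<le> 2 / 3 * E"
    proof -
      have "norm (duhamel (3 * L) (\<lambda>s (y :: real ^ 'n). 2 * L * E) t x) \<le> 2 * L * E / (3 * L)"
        by (rule norm_duhamel_le) (use L t E in auto)
      moreover have "2 * L * E / (3 * L) = 2 / 3 * E" using L by simp
      ultimately show ?thesis unfolding real_norm_def by linarith
    qed
    ultimately show ?thesis using 1 p_int[OF t, of x] Weq[OF t, of x] by linarith
  qed
  have iter: "p t - W t x \<le> (2 / 3) ^ n * (V + D)" if "t \<ge> 0" for n t x
    using that
  proof (induction n arbitrary: t x)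
    case 0
    then show ?case using pV[of t] WD[of t x] by (simp add: abs_le_iff)
  next
    case (Suc n)
    have "0 \<le> V" "0 \<le> D" using order_trans[OF norm_ge_zero pV] order_trans[OF norm_ge_zero WD] by auto
    then show ?case using step[of "(2 / 3) ^ n * (V + D)" t x] Suc by simp
  qed
  have "(\<lambda>n. (2 / 3) ^ n * (V + D)) \<longlonglongrightarrow> 0 * (V + D)"
    by (intro tendsto_mult LIMSEQ_power_zero tendsto_const) auto
  then have "p t - W t x \<le> 0 * (V + D)"
    by (rule LIMSEQ_le_const) (use iter[OF t] in auto)
  then have "exp (2 * L * t) * p t \<le> exp (2 * L * t) * W t x" by simp
  then show ?thesis using t by (simp add: p_def exp_minus mult.assoc[symmetric])
qed

end

lemma heat_op_uminus: "heat_op t (\<lambda>y. - g y) x = - heat_op t g x"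
  by (simp add: heat_op_def)

text \<open>
  The reflection u \<mapsto> -u turns supersolutions into subsolutions.
\<close>
lemma damped_solution_uminus:
  assumes W: "damped_solution F L g W"
  shows "damped_solution (\<lambda>x. - F (- x)) L (\<lambda>x. - g x) (\<lambda>s y. - W s y)"
proof -
  have r: "damped_reaction (\<lambda>x. - F (- x)) L s (- w) = - damped_reaction F L s w" for s w
    by (simp add: damped_reaction_def)
  have "continuous_on UNIV (\<lambda>(s, y). - W s y)"
    using W by (auto simp: damped_solution_def split_beta intro!: continuous_intros)
  moreover have "- W t x = exp (- (3 * L) * t) * heat_op t (\<lambda>x. - g x) x + duhamel (3 * L) (\<lambda>s y. damped_reaction (\<lambda>x. - F (- x)) L s (- W s y)) t x"
    if "t \<ge> 0" for t x
    using W that unfolding r duhamel_uminus heat_op_uminus damped_solution_def by simp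
  ultimately show ?thesis
    using W unfolding damped_solution_def by auto
qed

context lipschitz_reaction
begin

lemma lipschitz_reaction_reflect: "lipschitz_reaction (\<lambda>x. - F (- x)) L B"
proof
  show "\<bar>- F (- x) - - F (- y)\<bar> \<le> L * \<bar>x - y\<bar>" for x y
    using Lip[of "- x" "- y"] by (simp add: abs_minus_commute)
qed (use L FB in auto)

text \<open>
  The solution of the undamped equation, together with its comparison principle for spatially
  constant sub- and supersolutions.
\<close>
lemma global_solution_exists:
  fixes g :: "real ^ 'n \<Rightarrow> real"
  assumes g: "continuous_on UNIV g" and C: "\<And>y. norm (g y) \<le> C"
  obtains u where "continuous_on UNIV (\<lambda>(t, x). u t x)"
    and "\<And>t x. t \<ge> 0 \<Longrightarrow> u t x = heat_op t g x + duhamel 0 (\<lambda>s y. F (u s y)) t x"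
    and "\<And>v v' V t x. (\<And>x. v 0 \<le> g x) \<Longrightarrow> (\<And>t. t \<ge> 0 \<Longrightarrow> (v has_real_derivative v' t) (at t)) \<Longrightarrow>
       (\<And>t. t \<ge> 0 \<Longrightarrow> v' t \<le> F (v t)) \<Longrightarrow> (\<And>t. t \<ge> 0 \<Longrightarrow> \<bar>v t\<bar> \<le> V) \<Longrightarrow> t \<ge> 0 \<Longrightarrow> v t \<le> u t x"
    and "\<And>v v' V t x. (\<And>x. g x \<le> v 0) \<Longrightarrow> (\<And>t. t \<ge> 0 \<Longrightarrow> (v has_real_derivative v' t) (at t)) \<Longrightarrow>
       (\<And>t. t \<ge> 0 \<Longrightarrow> F (v t) \<le> v' t) \<Longrightarrow> (\<And>t. t \<ge> 0 \<Longrightarrow> \<bar>v t\<bar> \<le> V) \<Longrightarrow> t \<ge> 0 \<Longrightarrow> u t x \<le> v t"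
proof -
  obtain W where W: "damped_solution F L g W" using damped_solution_exists[OF g C] by blast
  obtain D where Wc: "continuous_on UNIV (\<lambda>(s, y). W s y)" and WD: "\<And>s y. norm (W s y) \<le> D"
    and Weq: "\<And>t x. t \<ge> 0 \<Longrightarrow> W t x = exp (- (3 * L) * t) * heat_op t g x + duhamel (3 * L) (\<lambda>s y. damped_reaction F L s (W s y)) t x"
    using W unfolding damped_solution_def by auto
  define u where "u = (\<lambda>t x. exp (2 * L * t) * W t x)"
  show thesis
  proof (rule that[of u])
    show uc: "continuous_on UNIV (\<lambda>(t, x). u t x)"
      unfolding u_def split_beta by (intro continuous_intros Wc[unfolded split_beta])
    show "u t x = heat_op t g x + duhamel 0 (\<lambda>s y. F (u s y)) t x" if t: "t \<ge> 0" for t x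
    proof -
      \<comment> \<open>lowering the damping from 3 L to 2 L cancels the summand L w of the damped reaction; the
        remaining 2 L is the rescaling\<close>
      have "W t x = exp (- (2 * L) * t) * heat_op t g x + duhamel (2 * L) (\<lambda>s y. damped_reaction F L s (W s y) - (3 * L - 2 * L) * W s y) t x"
        by (rule mild_change_damping[OF continuous_on_damped_reaction[OF Wc] norm_damped_reaction_le[OF WD] g C Wc WD Weq])
          (use L t in auto)
      also have "duhamel (2 * L) (\<lambda>s y. damped_reaction F L s (W s y) - (3 * L - 2 * L) * W s y) t x
         = duhamel (2 * L) (\<lambda>s y. exp (- 2 * L * s) * F (u s y)) t x"
        by (rule duhamel_cong) (simp add: damped_reaction_def u_def max_absorb2)
      also have "\<dots> = (LINT s:{0..t}|lborel. exp (- 2 * L * t) * heat_op (t - s) (\<lambda>y. F (u s y)) x)"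
        unfolding duhamel_def
      proof (intro set_lebesgue_integral_cong ballI allI impI)
        fix s
        have "heat_op (t - s) (\<lambda>y. exp (- 2 * L * s) * F (u s y)) x = exp (- 2 * L * s) * heat_op (t - s) (\<lambda>y. F (u s y)) x"
          using heat_op_scaleR[of "t - s" "exp (- 2 * L * s)" "\<lambda>y. F (u s y)" x] by simp
        moreover have "exp (- (2 * L) * (t - s)) * exp (- 2 * L * s) = exp (- 2 * L * t)"
          by (simp add: exp_add[symmetric] algebra_simps)
        ultimately show "exp (- (2 * L) * (t - s)) *\<^sub>R heat_op (t - s) (\<lambda>y. exp (- 2 * L * s) * F (u s y)) x = exp (- 2 * L * t) * heat_op (t - s) (\<lambda>y. F (u s y)) x"
          by (simp only: real_scaleR_def mult.assoc[symmetric])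
      qed simp
      also have "\<dots> = exp (- 2 * L * t) * duhamel 0 (\<lambda>s y. F (u s y)) t x"
        unfolding duhamel_def by (subst set_integral_mult_right[symmetric]) simp
      finally have "W t x = exp (- 2 * L * t) * (heat_op t g x + duhamel 0 (\<lambda>s y. F (u s y)) t x)"
        by (simp add: distrib_left)
      then show ?thesis by (simp add: u_def mult.assoc[symmetric] exp_add[symmetric])
    qed
    show "v t \<le> u t x"
      if "\<And>x. v 0 \<le> g x" "\<And>t. t \<ge> 0 \<Longrightarrow> (v has_real_derivative v' t) (at t)"
        "\<And>t. t \<ge> 0 \<Longrightarrow> v' t \<le> F (v t)" "\<And>t. t \<ge> 0 \<Longrightarrow> \<bar>v t\<bar> \<le> V" "t \<ge> 0" for v v' V t x
      unfolding u_def by (rule damped_solution_ge_subsolution[OF g C W that(1) that(2) that(3) that(4) that(5)])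
    show "u t x \<le> v t"
      if "\<And>x. g x \<le> v 0" "\<And>t. t \<ge> 0 \<Longrightarrow> (v has_real_derivative v' t) (at t)"
        "\<And>t. t \<ge> 0 \<Longrightarrow> F (v t) \<le> v' t" "\<And>t. t \<ge> 0 \<Longrightarrow> \<bar>v t\<bar> \<le> V" "t \<ge> 0" for v v' V t x
    proof -
      interpret R: lipschitz_reaction "\<lambda>x. - F (- x)" L B by (rule lipschitz_reaction_reflect)
      have "- v t \<le> exp (2 * L * t) * - W t x"
      proof (rule R.damped_solution_ge_subsolution[OF _ _ damped_solution_uminus[OF W], of C "\<lambda>t. - v t" "\<lambda>t. - v' t" V])
        show "continuous_on UNIV (\<lambda>x. - g x)" by (intro continuous_intros g)
        show "((\<lambda>t. - v t) has_real_derivative - v' t) (at t)" if "t \<ge> 0" for t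
          using \<open>\<And>t. t \<ge> 0 \<Longrightarrow> (v has_real_derivative v' t) (at t)\<close>[OF that] by (rule DERIV_minus)
      qed (use that C in auto)
      then show ?thesis by (simp add: u_def)
    qed
  qed
qed

text \<open>
  The bound is uniform in space.  Advancing the heat flow of the source at time s from t1 to t2
  costs a multiple of (t2 - t1) / (t2 - s), whose integral over s in [0, t1] produces the logarithm;
  the bound tends to 0 with t2 - t1.
\<close>
lemma mild_solution_time_modulus:
  fixes g :: "real ^ 'n \<Rightarrow> real"
  assumes g: "continuous_on UNIV g" and C: "\<And>y. norm (g y) \<le> C"
    and u: "continuous_on UNIV (\<lambda>(t, x). u t x)"
    and eq: "\<And>t x. t \<ge> 0 \<Longrightarrow> u t x = heat_op t g x + duhamel 0 (\<lambda>s y. F (u s y)) t x"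
    and t: "0 < a" "a \<le> t1" "t1 < t2" "t2 \<le> b"
  shows "\<bar>u t2 x - u t1 x\<bar> \<le> (2 * real CARD('n) * C / a + B) * (t2 - t1) + 2 * real CARD('n) * B * ((t2 - t1) * (ln b - ln (t2 - t1)))"
proof -
  define d where "d = t2 - t1"
  have d: "d > 0" using t by (simp add: d_def)
  define h where "h = (\<lambda>s y. F (u s y))"
  have hc: "continuous_on UNIV (\<lambda>(s, y). h s y)"
    unfolding h_def split_beta by (intro F_continuous_on_compose u[unfolded split_beta])
  have hB: "norm (h s y) \<le> B" for s y unfolding h_def using FB by simp
  have C0: "C \<ge> 0" using order_trans[OF norm_ge_zero C] .
  have B0: "B \<ge> 0" using order_trans[OF norm_ge_zero hB] .
  define k where "k = (\<lambda>t s. heat_op (t - s) (h s) x)"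
  have k_cont: "continuous_on A (k t)" for A t
    unfolding k_def by (rule continuous_on_compose_3[OF continuous_on_heat_op[OF hc hB]]) (intro continuous_intros)+
  have k_int: "set_integrable lborel {p..q} (k t)" for p q t
    by (rule borel_integrable_atLeastAtMost'[OF k_cont])
  have dk: "duhamel 0 h t x = integral {0..t} (k t)" for t
    using set_borel_integral_eq_integral(2)[OF k_int, of 0 t t] by (simp add: duhamel_def k_def)
  have k_HK: "k t integrable_on {p..q}" for p q t by (rule integrable_continuous_real[OF k_cont])
  have kB: "\<bar>k t s\<bar> \<le> B" for t s
    using norm_heat_op_le[OF continuous_on_slice[OF hc] hB, of "t - s" s x] by (simp add: k_def)
  have split: "integral {0..t2} (k t2) = integral {0..t1} (k t2) + integral {t1..t2} (k t2)"
    using t by (intro Henstock_Kurzweil_Integration.integral_combine[symmetric] k_HK) auto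
  have I2: "\<bar>integral {t1..t2} (k t2)\<bar> \<le> B * d"
    using integral_bound[of t1 t2 "k t2" B] t k_cont kB by (simp add: d_def)
  have I1: "\<bar>integral {0..t1} (k t2) - integral {0..t1} (k t1)\<bar> \<le> 2 * real CARD('n) * B * (d * (ln b - ln d))"
  proof -
    have G: "((\<lambda>s. 2 * real CARD('n) * B * (d / (t2 - s))) has_integral 2 * real CARD('n) * B * (d * (ln t2 - ln d))) {0..t1}"
    proof -
      have "((\<lambda>s. d / (t2 - s)) has_integral (- d * ln (t2 - t1)) - (- d * ln (t2 - 0))) {0..t1}"
      proof (rule fundamental_theorem_of_calculus)
        fix s assume "s \<in> {0..t1}"
        then have "t2 - s > 0" using t by auto
        then show "((\<lambda>s. - d * ln (t2 - s)) has_vector_derivative d / (t2 - s)) (at s within {0..t1})"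
          unfolding has_real_derivative_iff_has_vector_derivative[symmetric]
          by (auto intro!: derivative_eq_intros simp: field_simps)
      qed (use t in auto)
      also have "(- d * ln (t2 - t1)) - (- d * ln (t2 - 0)) = d * (ln t2 - ln d)"
        by (simp add: d_def[symmetric] right_diff_distrib)
      finally show ?thesis by (rule has_integral_mult_right)
    qed
    have "norm (integral {0..t1} (\<lambda>s. k t2 s - k t1 s)) \<le> integral {0..t1} (\<lambda>s. 2 * real CARD('n) * B * (d / (t2 - s)))"
    proof (rule integral_norm_bound_integral)
      show "(\<lambda>s. k t2 s - k t1 s) integrable_on {0..t1}"
        by (intro integrable_diff k_HK)
      show "(\<lambda>s. 2 * real CARD('n) * B * (d / (t2 - s))) integrable_on {0..t1}" using G by blast
      fix s assume s: "s \<in> {0..t1}"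
      show "norm (k t2 s - k t1 s) \<le> 2 * real CARD('n) * B * (d / (t2 - s))"
      proof (cases "s = t1")
        case True
        have n: "real CARD('n) \<ge> 1" using one_le_card_finite[where 'a = 'n] by simp
        have "\<bar>k t2 s - k t1 s\<bar> \<le> 2 * B" using kB[of t2 s] kB[of t1 s] by linarith
        also have "\<dots> \<le> 2 * real CARD('n) * B" using n B0 by (simp add: mult_left_mono mult_right_mono)
        finally show ?thesis using True d by (simp add: d_def)
      next
        case False
        then have "0 < t1 - s" "t1 - s \<le> t2 - s" using s t by auto
        from norm_heat_op_time_diff_le[OF continuous_on_slice[OF hc] hB this, of s x]
        show ?thesis by (simp add: k_def d_def)
      qed
    qed
    also have "\<dots> = 2 * real CARD('n) * B * (d * (ln t2 - ln d))" using G by (rule integral_unique)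
    also have "\<dots> \<le> 2 * real CARD('n) * B * (d * (ln b - ln d))"
      using B0 d t by (intro mult_left_mono) auto
    also have "integral {0..t1} (\<lambda>s. k t2 s - k t1 s) = integral {0..t1} (k t2) - integral {0..t1} (k t1)"
      by (intro Henstock_Kurzweil_Integration.integral_diff k_HK)
    finally show ?thesis by simp
  qed
  have I0: "\<bar>heat_op t2 g x - heat_op t1 g x\<bar> \<le> 2 * real CARD('n) * C / a * d"
  proof -
    have "norm (heat_op t2 g x - heat_op t1 g x) \<le> 2 * real CARD('n) * C * ((t2 - t1) / t2)"
      by (rule norm_heat_op_time_diff_le[OF g C]) (use t in auto)
    also have "\<dots> \<le> 2 * real CARD('n) * C * (d / a)"
      using t C0 d by (intro mult_left_mono frac_le) (auto simp: d_def)
    finally show ?thesis by simp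
  qed
  have "u t2 x - u t1 x = (heat_op t2 g x - heat_op t1 g x) + (integral {0..t1} (k t2) - integral {0..t1} (k t1)) + integral {t1..t2} (k t2)"
    using eq[of t1 x] eq[of t2 x] t dk[of t1] dk[of t2] split unfolding h_def by simp
  then have "\<bar>u t2 x - u t1 x\<bar> \<le> 2 * real CARD('n) * C / a * d + 2 * real CARD('n) * B * (d * (ln b - ln d)) + B * d"
    using I0 I1 I2 by linarith
  then show ?thesis by (simp add: d_def[symmetric] distrib_right)
qed

lemma norm_duhamel_0_le:
  fixes h :: "real \<Rightarrow> real ^ 'n \<Rightarrow> real"
  assumes hc: "continuous_on UNIV (\<lambda>(s, y). h s y)" and hB: "\<And>s y. norm (h s y) \<le> B" and t: "t \<ge> 0"
  shows "norm (duhamel 0 h t x) \<le> B * t"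
proof -
  define k where "k = (\<lambda>s. heat_op (t - s) (h s) x)"
  have k_cont: "continuous_on A k" for A
    unfolding k_def by (rule continuous_on_compose_3[OF continuous_on_heat_op[OF hc hB]]) (intro continuous_intros)+
  have "duhamel 0 h t x = integral {0..t} k"
    using set_borel_integral_eq_integral(2)[OF borel_integrable_atLeastAtMost'[OF k_cont], of 0 t] by (simp add: duhamel_def k_def)
  moreover have "norm (integral {0..t} k) \<le> B * (t - 0)"
    by (rule integral_bound[OF t k_cont]) (use norm_heat_op_le[OF continuous_on_slice[OF hc] hB] in \<open>simp add: k_def\<close>)
  ultimately show ?thesis by simp
qed

end

section \<open>Uniqueness of mild solutions\<close>

text \<open>
  Continuity is asked on (0, t] because mild solutions may be discontinuous in the supremum norm at
  the initial time.
\<close>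
lemma set_integrable_continuous_bounded:
  fixes k :: "real \<Rightarrow> 'b::{banach, second_countable_topology}"
  assumes k: "continuous_on {0<..t} k" and M: "\<And>s. s \<in> {0..t} \<Longrightarrow> norm (k s) \<le> M"
  shows "set_integrable lborel {0..t} k"
proof -
  have meas: "(\<lambda>s. indicator {0..t} s *\<^sub>R k s) \<in> borel_measurable lborel"
  proof -
    have "(\<lambda>s. indicator {0<..t} s *\<^sub>R k s) \<in> borel_measurable borel"
      by (rule borel_measurable_continuous_on_indicator[OF _ k]) simp
    then have "(\<lambda>s. indicator {0<..t} s *\<^sub>R k s + indicator ({0} \<inter> {0..t}) s *\<^sub>R k 0) \<in> borel_measurable borel"
      by measurable
    also have "(\<lambda>s. indicator {0<..t} s *\<^sub>R k s + indicator ({0} \<inter> {0..t}) s *\<^sub>R k 0) = (\<lambda>s. indicator {0..t} s *\<^sub>R k s)"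
      by (auto simp: indicator_def fun_eq_iff)
    finally show ?thesis by simp
  qed
  show ?thesis unfolding set_integrable_def
  proof (rule Bochner_Integration.integrable_bound[OF _ meas])
    show "integrable lborel (\<lambda>s. indicator {0..t} s *\<^sub>R M)"
      by (cases "t \<ge> 0") auto
    show "AE s in lborel. norm (indicator {0..t} s *\<^sub>R k s) \<le> norm (indicator {0..t} s *\<^sub>R M)"
      using M by (intro AE_I2) (auto simp: indicator_def intro: order_trans[OF _ abs_ge_self])
  qed
qed

lemma continuous_on_heat_op_curve:
  fixes w :: "real \<Rightarrow> (real ^ 'n) \<Rightarrow>\<^sub>C complex"
  assumes w: "continuous_on A w"
  shows "continuous_on A (\<lambda>s. heat_op (t - s) (apply_bcontfun (w s)) x)"
  unfolding continuous_on_iff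
proof (intro ballI allI impI)
  fix s0 and e :: real assume s0: "s0 \<in> A" and e: "e > 0"
  define f where "f = w s0"
  have nb: "norm (apply_bcontfun w y) \<le> norm w" for w :: "(real ^ 'n) \<Rightarrow>\<^sub>C complex" and y by (rule norm_bounded)
  have "continuous_on UNIV (\<lambda>s. heat_op (t - s) (apply_bcontfun f) x)"
    by (rule continuous_on_compose_2[OF continuous_on_heat_op_time_space[OF continuous_on_apply_bcontfun nb]])
      (intro continuous_intros)+
  then obtain d1 where d1: "d1 > 0" "\<And>s. dist s s0 < d1 \<Longrightarrow> dist (heat_op (t - s) (apply_bcontfun f) x) (heat_op (t - s0) (apply_bcontfun f) x) < e / 2"
    using e unfolding continuous_on_iff by (metis UNIV_I half_gt_zero)
  obtain d2 where d2: "d2 > 0" "\<And>s. s \<in> A \<Longrightarrow> dist s s0 < d2 \<Longrightarrow> dist (w s) f < e / 2"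
    using w s0 e unfolding continuous_on_iff f_def by (metis half_gt_zero)
  have "dist (heat_op (t - s) (apply_bcontfun (w s)) x) (heat_op (t - s0) (apply_bcontfun (w s0)) x) < e"
    if s: "s \<in> A" "dist s s0 < min d1 d2" for s
  proof -
    have "norm (heat_op (t - s) (apply_bcontfun (w s)) x - heat_op (t - s) (apply_bcontfun f) x) \<le> dist (w s) f"
      unfolding heat_op_diff[OF continuous_on_apply_bcontfun nb continuous_on_apply_bcontfun nb, symmetric]
      by (rule norm_heat_op_le) (use dist_bounded[of "w s" _ f] in \<open>auto simp: dist_norm intro!: continuous_intros\<close>)
    then have "dist (heat_op (t - s) (apply_bcontfun (w s)) x) (heat_op (t - s) (apply_bcontfun f) x) < e / 2"
      using d2(2)[OF s(1)] s(2) by (simp add: dist_norm)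
    moreover have "dist (heat_op (t - s) (apply_bcontfun f) x) (heat_op (t - s0) (apply_bcontfun f) x) < e / 2"
      using d1(2)[of s] s(2) by simp
    ultimately show ?thesis
      using dist_triangle[of "heat_op (t - s) (apply_bcontfun (w s)) x" "heat_op (t - s0) (apply_bcontfun f) x" "heat_op (t - s) (apply_bcontfun f) x"]
      unfolding f_def[symmetric] by linarith
  qed
  then show "\<exists>d>0. \<forall>s\<in>A. dist s s0 < d \<longrightarrow> dist (heat_op (t - s) (apply_bcontfun (w s)) x) (heat_op (t - s0) (apply_bcontfun (w s0)) x) < e"
    using d1(1) d2(1) by (intro exI[of _ "min d1 d2"]) auto
qed

lemma solution_curve_continuous:
  assumes "solution_curve g T u" "ereal t < T"
  shows "continuous_on {0<..t} u"
proof -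
  have sub: "{0<..t} \<subseteq> {s. 0 < s \<and> ereal s < T}"
    using assms(2) by (auto intro: le_less_trans[of "ereal s" "ereal t" T for s])
  then have sub': "{0<..t} \<subseteq> {s. 0 \<le> s \<and> ereal s < T}" by auto
  show ?thesis using assms(1) unfolding solution_curve_def
    by (auto split: if_splits intro: continuous_on_subset[OF _ sub] continuous_on_subset[OF _ sub'])
qed

lemma solution_curve_bounded:
  assumes u: "solution_curve g T u" "ereal t < T" "0 \<le> t"
  shows "\<exists>R. \<forall>s\<in>{0..t}. norm (u s) \<le> R"
proof -
  have "bounded (u ` {0..t})"
  proof (cases "uniformly_continuous_on UNIV g")
    case True
    then have "continuous_on {s. 0 \<le> s \<and> ereal s < T} u" using u by (simp add: solution_curve_def)
    then have "continuous_on {0..t} u"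
      by (rule continuous_on_subset) (use assms(2) in \<open>auto intro: le_less_trans[of "ereal s" "ereal t" T for s]\<close>)
    then show ?thesis by (intro compact_imp_bounded compact_continuous_image) auto
  next
    case False
    then show ?thesis using u unfolding solution_curve_def by auto
  qed
  then show ?thesis by (auto simp: bounded_iff)
qed

text \<open>
  On [0, t0] both solutions take values in a bounded set K that keeps away from the pole, where zeta
  is Lipschitz.  So the norm n of the difference satisfies n(t) \<le> L times the integral of n over
  [0, t], and n vanishes: a bound n(t) \<le> E exp(2 L t) improves itself to n(t) \<le> E/2 exp(2 L
  t).
\<close>
lemma mild_solution_unique:
  fixes u v :: "real \<Rightarrow> (real ^ 'n) \<Rightarrow>\<^sub>C complex"
  assumes u: "mild_solution g T u" and v: "mild_solution g T' v"
    and t0: "0 \<le> t0" "ereal t0 < T" "ereal t0 < T'"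
  shows "u t0 = v t0"
proof -
  have cu: "solution_curve g T u" and cv: "solution_curve g T' v"
    using u v by (simp_all add: mild_solution_def)
  from solution_curve_bounded[OF cu t0(2,1)] obtain Ru where Ru: "\<And>s. s \<in> {0..t0} \<Longrightarrow> norm (u s) \<le> Ru" by blast
  from solution_curve_bounded[OF cv t0(3,1)] obtain Rv where Rv: "\<And>s. s \<in> {0..t0} \<Longrightarrow> norm (v s) \<le> Rv" by blast
  obtain du where du: "du > 0" "\<And>s x. s \<in> {0..t0} \<Longrightarrow> du \<le> cmod (apply_bcontfun (u s) x - 1)"
    using u t0 unfolding mild_solution_def by blast
  obtain dv where dv: "dv > 0" "\<And>s x. s \<in> {0..t0} \<Longrightarrow> dv \<le> cmod (apply_bcontfun (v s) x - 1)"
    using v t0 unfolding mild_solution_def by blast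
  define R where "R = max Ru Rv"
  define d where "d = min du dv"
  have d: "d > 0" using du dv by (simp add: d_def)
  define K where "K = {z. cmod z \<le> R \<and> d \<le> cmod (z - 1)}"
  have nb: "cmod (apply_bcontfun w x) \<le> norm w" for w :: "(real ^ 'n) \<Rightarrow>\<^sub>C complex" and x by (rule norm_bounded)
  have uK: "apply_bcontfun (u s) x \<in> K" and vK: "apply_bcontfun (v s) x \<in> K" if "s \<in> {0..t0}" for s x
  proof -
    have inK: "z \<in> K" if "cmod z \<le> Ru \<or> cmod z \<le> Rv" "du \<le> cmod (z - 1) \<or> dv \<le> cmod (z - 1)" for z
      using that unfolding K_def R_def d_def mem_Collect_eq le_max_iff_disj min_le_iff_disj by blast
    show "apply_bcontfun (u s) x \<in> K"
      by (rule inK[OF disjI1[OF order_trans[OF nb Ru[OF that]]] disjI1[OF du(2)[OF that]]])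
    show "apply_bcontfun (v s) x \<in> K"
      by (rule inK[OF disjI2[OF order_trans[OF nb Rv[OF that]]] disjI2[OF dv(2)[OF that]]])
  qed
  obtain L' where L': "L' \<ge> 0" "\<And>a b. a \<in> K \<Longrightarrow> b \<in> K \<Longrightarrow> cmod (riemann_zeta a - riemann_zeta b) \<le> L' * cmod (a - b)"
    using holomorphic_imp_Lipschitz_off_point[OF holomorphic_riemann_zeta d, of R] unfolding K_def by auto
  define L where "L = L' + 1"
  have L: "L > 0" "\<And>a b. a \<in> K \<Longrightarrow> b \<in> K \<Longrightarrow> cmod (riemann_zeta a - riemann_zeta b) \<le> L * cmod (a - b)"
  proof -
    show "L > 0" using L' by (simp add: L_def)
    fix a b assume "a \<in> K" "b \<in> K"
    then have "cmod (riemann_zeta a - riemann_zeta b) \<le> L' * cmod (a - b)" by (rule L'(2))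
    also have "\<dots> \<le> L * cmod (a - b)" by (intro mult_right_mono) (auto simp: L_def)
    finally show "cmod (riemann_zeta a - riemann_zeta b) \<le> L * cmod (a - b)" .
  qed
  obtain Z where Z: "\<And>a. a \<in> K \<Longrightarrow> cmod (riemann_zeta a) \<le> Z"
  proof (cases "K = {}")
    case True
    then show ?thesis using that[of 0] by auto
  next
    case False
    then obtain b where b: "b \<in> K" by auto
    have "cmod (riemann_zeta a) \<le> cmod (riemann_zeta b) + L * (2 * R)" if a: "a \<in> K" for a
    proof -
      have "cmod (a - b) \<le> 2 * R"
        using norm_triangle_ineq4[of a b] a b by (simp add: K_def)
      then have "L * cmod (a - b) \<le> L * (2 * R)" using L(1) by (intro mult_left_mono) auto
      then show ?thesis
        using L(2)[OF a b] norm_triangle_ineq2[of "riemann_zeta a" "riemann_zeta b"] by linarith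
    qed
    then show ?thesis using that by blast
  qed
  have zc: "continuous_on K riemann_zeta"
    by (rule holomorphic_on_imp_continuous_on, rule holomorphic_on_subset[OF holomorphic_riemann_zeta]) (use d in \<open>auto simp: K_def\<close>)
  have comp: "(\<lambda>y. riemann_zeta (apply_bcontfun w y)) \<in> bcontfun" if "\<And>y. apply_bcontfun w y \<in> K" for w :: "(real ^ 'n) \<Rightarrow>\<^sub>C complex"
    unfolding bcontfun_def using that Z
    by (auto simp: bounded_iff intro!: continuous_on_compose2[OF zc continuous_on_apply_bcontfun])
  define zeta_of where "zeta_of = (\<lambda>w :: (real ^ 'n) \<Rightarrow>\<^sub>C complex. Bcontfun (\<lambda>y. riemann_zeta (apply_bcontfun w y)))"
  have zeta_of: "apply_bcontfun (zeta_of w) = (\<lambda>y. riemann_zeta (apply_bcontfun w y))" if "\<And>y. apply_bcontfun w y \<in> K" for w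
    unfolding zeta_of_def by (rule Bcontfun_inverse[OF comp[OF that]])
  have zeta_Lip: "dist (zeta_of w) (zeta_of w') \<le> L * dist w w'"
    if w: "\<And>y. apply_bcontfun w y \<in> K" "\<And>y. apply_bcontfun w' y \<in> K" for w w'
  proof (rule dist_bound)
    fix y
    have "dist (apply_bcontfun (zeta_of w) y) (apply_bcontfun (zeta_of w') y) \<le> L * dist (apply_bcontfun w y) (apply_bcontfun w' y)"
      unfolding zeta_of[OF w(1)] zeta_of[OF w(2)] dist_norm by (rule L(2)[OF w])
    also have "\<dots> \<le> L * dist w w'" using L(1) dist_bounded[of w y w'] by (intro mult_left_mono) auto
    finally show "dist (apply_bcontfun (zeta_of w) y) (apply_bcontfun (zeta_of w') y) \<le> L * dist w w'" .
  qed
  have zeta_norm: "norm (zeta_of w) \<le> Z" if w: "\<And>y. apply_bcontfun w y \<in> K" for w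
    by (rule norm_bound) (use Z w in \<open>simp add: zeta_of[OF w]\<close>)
  have uc: "continuous_on {0<..t0} u" and vc: "continuous_on {0<..t0} v"
    using solution_curve_continuous[OF cu t0(2)] solution_curve_continuous[OF cv t0(3)] by blast+
  have source_cont: "continuous_on {0<..t0} (\<lambda>s. zeta_of (w s))"
    if wc: "continuous_on {0<..t0} w" and wK: "\<And>s y. s \<in> {0..t0} \<Longrightarrow> apply_bcontfun (w s) y \<in> K" for w
    unfolding continuous_on_iff
  proof (intro ballI allI impI)
    fix s and e :: real assume s: "s \<in> {0<..t0}" and e: "e > 0"
    then obtain \<eta> where \<eta>: "\<eta> > 0" "\<And>r. r \<in> {0<..t0} \<Longrightarrow> dist r s < \<eta> \<Longrightarrow> dist (w r) (w s) < e / L"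
      using wc L(1) unfolding continuous_on_iff by (metis divide_pos_pos)
    have "dist (zeta_of (w r)) (zeta_of (w s)) < e" if r: "r \<in> {0<..t0}" "dist r s < \<eta>" for r
    proof -
      have "dist (zeta_of (w r)) (zeta_of (w s)) \<le> L * dist (w r) (w s)"
        by (rule zeta_Lip; rule wK) (use r s in auto)
      also have "\<dots> < e" using \<eta>(2)[OF r] L(1) by (simp add: field_simps)
      finally show ?thesis .
    qed
    then show "\<exists>d>0. \<forall>r\<in>{0<..t0}. dist r s < d \<longrightarrow> dist (zeta_of (w r)) (zeta_of (w s)) < e" using \<eta>(1) by blast
  qed
  have integrable: "set_integrable lborel {0..t} (\<lambda>s. heat_op (t - s) (apply_bcontfun (zeta_of (w s))) x)"
    if wc: "continuous_on {0<..t0} w" and wK: "\<And>s y. s \<in> {0..t0} \<Longrightarrow> apply_bcontfun (w s) y \<in> K" and t: "t \<in> {0..t0}" for w t x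
  proof (rule set_integrable_continuous_bounded[where M = Z])
    show "continuous_on {0<..t} (\<lambda>s. heat_op (t - s) (apply_bcontfun (zeta_of (w s))) x)"
      by (rule continuous_on_heat_op_curve, rule continuous_on_subset[OF source_cont[OF wc wK]]) (use t in auto)
    show "norm (heat_op (t - s) (apply_bcontfun (zeta_of (w s))) x) \<le> Z" if "s \<in> {0..t}" for s
      by (rule norm_heat_op_le[OF continuous_on_apply_bcontfun], rule order_trans[OF nb zeta_norm], rule wK) (use that t in auto)
  qed
  have duhamel_eq: "apply_bcontfun (w t) x = heat_semigroup t g x + (LINT s:{0..t}|lborel. heat_op (t - s) (apply_bcontfun (zeta_of (w s))) x)"
    if w: "mild_solution g T'' w" "ereal t0 < T''" and wK: "\<And>s y. s \<in> {0..t0} \<Longrightarrow> apply_bcontfun (w s) y \<in> K" and t: "t \<in> {0..t0}" for w T'' t x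
  proof -
    have "ereal t < T''" using t w(2) by (auto intro: le_less_trans[of "ereal t" "ereal t0" T''])
    then have "apply_bcontfun (w t) x = heat_semigroup t g x + (LINT s:{0..t}|lborel. heat_semigroup (t - s) (\<lambda>y. riemann_zeta (apply_bcontfun (w s) y)) x)"
      using w(1) t unfolding mild_solution_def by auto
    also have "(LINT s:{0..t}|lborel. heat_semigroup (t - s) (\<lambda>y. riemann_zeta (apply_bcontfun (w s) y)) x)
      = (LINT s:{0..t}|lborel. heat_op (t - s) (apply_bcontfun (zeta_of (w s))) x)"
    proof (intro set_lebesgue_integral_cong ballI allI impI)
      fix s assume s: "s \<in> {0..t}"
      then have *: "(\<lambda>y. riemann_zeta (apply_bcontfun (w s) y)) = apply_bcontfun (zeta_of (w s))"
        using t by (intro zeta_of[symmetric] wK) auto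
      show "heat_semigroup (t - s) (\<lambda>y. riemann_zeta (apply_bcontfun (w s) y)) x = heat_op (t - s) (apply_bcontfun (zeta_of (w s))) x"
        unfolding * by (rule heat_semigroup_eq_heat_op) (use s in \<open>auto intro!: borel_measurable_continuous_onI\<close>)
    qed simp
    finally show ?thesis .
  qed
  define n where "n = (\<lambda>s. norm (u s - v s))"
  have nc: "continuous_on {0<..t0} n" unfolding n_def by (intro continuous_intros uc vc)
  have nR: "n s \<le> 2 * R" "n s \<ge> 0" if "s \<in> {0..t0}" for s
    using norm_triangle_ineq4[of "u s" "v s"] Ru[OF that] Rv[OF that] by (auto simp: n_def R_def)
  have n_int: "set_integrable lborel {0..t} n" if "t \<in> {0..t0}" for t
    by (rule set_integrable_continuous_bounded[of _ _ "2 * R"]) (use nc nR that in \<open>auto intro: continuous_on_subset\<close>)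
  have n_le: "n t \<le> L * (LINT s:{0..t}|lborel. n s)" if t: "t \<in> {0..t0}" for t
  proof -
    have "norm (u t - v t) \<le> L * (LINT s:{0..t}|lborel. n s)"
    proof (rule norm_bound)
      fix x
      let ?k = "\<lambda>w s. heat_op (t - s) (apply_bcontfun (zeta_of (w s))) x"
      have "apply_bcontfun (u t - v t) x = (LINT s:{0..t}|lborel. ?k u s)
          - (LINT s:{0..t}|lborel. ?k v s)"
        using duhamel_eq[OF u t0(2) uK t, of x] duhamel_eq[OF v t0(3) vK t, of x] by simp
      also have "\<dots> = (LINT s:{0..t}|lborel. ?k u s - ?k v s)"
        by (rule set_integral_diff(2)[OF integrable[OF uc uK t] integrable[OF vc vK t], symmetric])
      also have "norm \<dots> \<le> (LINT s:{0..t}|lborel. norm (?k u s - ?k v s))"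
        by (rule set_integral_norm_bound[OF set_integral_diff(1)[OF integrable[OF uc uK t] integrable[OF vc vK t]]])
      also have "\<dots> \<le> (LINT s:{0..t}|lborel. L * n s)"
      proof (rule set_integral_mono)
        show "set_integrable lborel {0..t} (\<lambda>s. norm (?k u s - ?k v s))"
          by (rule set_integrable_norm[OF set_integral_diff(1)[OF integrable[OF uc uK t] integrable[OF vc vK t]]])
        show "set_integrable lborel {0..t} (\<lambda>s. L * n s)" using n_int[OF t] by simp
        fix s assume s: "s \<in> {0..t}"
        then have s0: "s \<in> {0..t0}" using t by auto
        have "norm (?k u s - ?k v s) \<le> dist (zeta_of (u s)) (zeta_of (v s))"
          unfolding heat_op_diff[OF continuous_on_apply_bcontfun nb continuous_on_apply_bcontfun nb, symmetric]
          by (rule norm_heat_op_le) (use dist_bounded[of "zeta_of (u s)" _ "zeta_of (v s)"] in \<open>auto simp: dist_norm intro!: continuous_intros\<close>)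
        also have "\<dots> \<le> L * n s"
          using zeta_Lip[OF uK[OF s0] vK[OF s0]] by (simp add: n_def dist_norm)
        finally show "norm (?k u s - ?k v s) \<le> L * n s" .
      qed
      finally show "norm (apply_bcontfun (u t - v t) x) \<le> L * (LINT s:{0..t}|lborel. n s)" by simp
    qed
    moreover have "n t = norm (u t - v t)" by (simp add: n_def)
    ultimately show ?thesis by (simp only:)
  qed
  have iter: "n t \<le> 2 * R * (1 / 2) ^ k * exp (2 * L * t)" if "t \<in> {0..t0}" for k t
    using that
  proof (induction k arbitrary: t)
    case 0
    have "2 * R * 1 \<le> 2 * R * exp (2 * L * t)"
      using nR[OF 0] 0 L(1) by (intro mult_left_mono) auto
    then show ?case using nR[OF 0] by simp
  next
    case (Suc k)
    define E where "E = 2 * R * (1 / 2) ^ k"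
    have E0: "E \<ge> 0" using nR[OF Suc.prems] by (simp add: E_def)
    have hi: "((\<lambda>s. E * exp (2 * L * s)) has_integral E * exp (2 * L * t) / (2 * L) - E * exp (2 * L * 0) / (2 * L)) {0..t}"
      by (rule fundamental_theorem_of_calculus)
        (use L Suc.prems in \<open>auto intro!: derivative_eq_intros simp: has_real_derivative_iff_has_vector_derivative[symmetric]\<close>)
    have si: "set_integrable lborel {0..t} (\<lambda>s. E * exp (2 * L * s))"
      by (rule borel_integrable_atLeastAtMost') (intro continuous_intros)
    have "n t \<le> L * (LINT s:{0..t}|lborel. n s)" by (rule n_le[OF Suc.prems])
    also have "\<dots> \<le> L * (LINT s:{0..t}|lborel. E * exp (2 * L * s))"
      using L Suc.prems Suc.IH unfolding E_def[symmetric]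
      by (intro mult_left_mono set_integral_mono n_int si) auto
    also have "(LINT s:{0..t}|lborel. E * exp (2 * L * s)) = E * exp (2 * L * t) / (2 * L) - E * exp (2 * L * 0) / (2 * L)"
      using set_borel_integral_eq_integral(2)[OF si] hi by (simp only: integral_unique)
    also have "\<dots> \<le> E * exp (2 * L * t) / (2 * L)" using E0 L by simp
    finally have "n t \<le> L * (E * exp (2 * L * t) / (2 * L))" using L(1) by (simp add: mult_left_mono)
    then show ?case using L(1) by (simp add: E_def)
  qed
  have "(\<lambda>k. 2 * R * (1 / 2) ^ k * exp (2 * L * t0)) \<longlonglongrightarrow> 2 * R * 0 * exp (2 * L * t0)"
    by (intro tendsto_mult LIMSEQ_power_zero tendsto_const) auto
  then have "n t0 \<le> 2 * R * 0 * exp (2 * L * t0)"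
    by (rule LIMSEQ_le_const) (use iter[of t0] t0(1) in auto)
  then show ?thesis by (simp add: n_def)
qed

section \<open>Passage to the complex-valued formulation\<close>

text \<open>
  The Duhamel formula is that of the real solution.  The regularity of the curve comes from the
  modulus of continuity for positive times.  At time 0 it comes from the uniform continuity of g or,
  if g is not uniformly continuous, from joint continuity in time and space on compact sets.
\<close>
lemma (in lipschitz_reaction) mild_solution_of_real_solution:
  fixes g :: "real ^ 'n \<Rightarrow> real"
  assumes g: "continuous_on UNIV g" and C: "\<And>y. norm (g y) \<le> C"
    and u: "continuous_on UNIV (\<lambda>(t, x). u t x)"
    and eq: "\<And>t x. t \<ge> 0 \<Longrightarrow> u t x = heat_op t g x + duhamel 0 (\<lambda>s y. F (u s y)) t x"
    and d: "d > 0" "\<And>t x. t \<ge> 0 \<Longrightarrow> d \<le> \<bar>u t x - 1\<bar>"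
    and zeta: "\<And>t x. t \<ge> 0 \<Longrightarrow> real_zeta (u t x) = F (u t x)"
  shows "\<exists>U. mild_solution (\<lambda>x. complex_of_real (g x)) \<infinity> U \<and> (\<forall>t\<ge>0. \<forall>x. apply_bcontfun (U t) x = of_real (u t x))"
proof -
  define h where "h = (\<lambda>s y. F (u s y))"
  have hc: "continuous_on UNIV (\<lambda>(s, y). h s y)"
    unfolding h_def split_beta by (intro F_continuous_on_compose u[unfolded split_beta])
  have hB: "norm (h s y) \<le> B" for s y unfolding h_def using FB by simp
  have B0: "B \<ge> 0" using order_trans[OF norm_ge_zero hB] .
  have dB: "\<bar>duhamel 0 h t x\<bar> \<le> B * t" if "t \<ge> 0" for t x
    using norm_duhamel_0_le[OF hc hB that, of x] by simp
  have ub: "\<bar>u t x\<bar> \<le> C + B * t" if "t \<ge> 0" for t x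
    using norm_heat_op_le[OF g C, of t x] dB[OF that, of x] eq[OF that, of x] unfolding h_def by (simp add: abs_le_iff)
  have u0: "u 0 x = g x" for x using eq[of 0 x] dB[of 0 x] unfolding h_def by simp
  define U where "U = (\<lambda>t. Bcontfun (\<lambda>x. complex_of_real (u (max 0 t) x)))"
  have U_bcontfun: "(\<lambda>x. complex_of_real (u (max 0 t) x)) \<in> bcontfun" for t
    unfolding bcontfun_def
  proof (rule CollectI, rule conjI)
    show "continuous_on UNIV (\<lambda>x. complex_of_real (u (max 0 t) x))"
      by (intro continuous_intros continuous_on_slice[OF u])
    show "bounded (range (\<lambda>x. complex_of_real (u (max 0 t) x)))"
      using ub[of "max 0 t"] by (auto simp: bounded_iff)
  qed
  have U: "apply_bcontfun (U t) x = of_real (u t x)" if "t \<ge> 0" for t x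
    unfolding U_def Bcontfun_inverse[OF U_bcontfun] using that by (simp add: max_absorb2)
  have U_dist: "dist (U t) (U s) \<le> e" if "t \<ge> 0" "s \<ge> 0" "\<And>x. \<bar>u t x - u s x\<bar> \<le> e" for t s e
    by (rule dist_bound) (use that in \<open>simp add: U dist_of_real dist_real_def\<close>)
  have U_norm: "norm (U t) \<le> C + B * t" if "t \<ge> 0" for t
    by (rule norm_bound) (use that ub in \<open>simp add: U\<close>)
  \<comment> \<open>away from the initial time the modulus of continuity is uniform in space\<close>
  have U_cont_Icc: "continuous_on {a..b} U" if ab: "0 < a" "a < b" for a b
  proof -
    define K where "K = 2 * real CARD('n) * C / a + B"
    define M where "M = 2 * real CARD('n) * B"
    define \<omega> where "\<omega> = (\<lambda>d. K * d + M * (d * (ln b - ln d)))"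
    have mod_lt: "dist (U t2) (U t1) \<le> \<omega> (t2 - t1)" if "a \<le> t1" "t1 < t2" "t2 \<le> b" for t1 t2
    proof (rule U_dist)
      show "\<bar>u t2 x - u t1 x\<bar> \<le> \<omega> (t2 - t1)" for x
        using mild_solution_time_modulus[OF g C u eq ab(1) that, of x] by (simp add: \<omega>_def K_def M_def)
    qed (use ab that in auto)
    have modulus: "dist (U t2) (U t1) \<le> \<omega> (dist t2 t1)" if "t1 \<in> {a..b}" "t2 \<in> {a..b}" "t1 \<noteq> t2" for t1 t2
      using mod_lt[of t1 t2] mod_lt[of t2 t1] that by (cases "t1 < t2") (auto simp: dist_real_def dist_commute)
    have "((\<lambda>d. K * d + M * (d * (ln b - ln d))) \<longlongrightarrow> 0) (at_right 0)" by real_asymp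
    then have lim: "(\<omega> \<longlongrightarrow> 0) (at_right 0)" by (simp add: \<omega>_def)
    show ?thesis unfolding continuous_on_iff
    proof (intro ballI allI impI)
      fix t1 and e :: real assume t1: "t1 \<in> {a..b}" and e: "e > 0"
      from order_tendstoD(2)[OF lim e] obtain \<eta> where \<eta>: "\<eta> > 0" "\<And>d. 0 < d \<Longrightarrow> d < \<eta> \<Longrightarrow> \<omega> d < e"
        unfolding eventually_at_right_field by auto
      have "dist (U t2) (U t1) < e" if "t2 \<in> {a..b}" "dist t2 t1 < \<eta>" for t2
        using modulus[OF t1 that(1)] \<eta>(2)[of "dist t2 t1"] that(2) e by (cases "t1 = t2") auto
      then show "\<exists>d>0. \<forall>t2\<in>{a..b}. dist t2 t1 < d \<longrightarrow> dist (U t2) (U t1) < e" using \<eta>(1) by blast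
    qed
  qed
  have U_isCont: "isCont U t" if "t > 0" for t
    using continuous_on_interior[OF U_cont_Icc[of "t / 2" "2 * t"], of t] that by auto
  have cont_pos: "continuous_on {0<..} U"
    using U_isCont by (auto intro: continuous_at_imp_continuous_on)
  have curve: "solution_curve (\<lambda>x. complex_of_real (g x)) \<infinity> U"
  proof (cases "uniformly_continuous_on UNIV (\<lambda>x. complex_of_real (g x))")
    case True
    then have gu: "uniformly_continuous_on UNIV g"
      unfolding uniformly_continuous_on_def by (simp add: dist_of_real)
    have at0: "continuous (at 0 within {0..}) U"
      unfolding continuous_within_eps_delta
    proof (intro allI impI)
      fix e :: real assume e: "e > 0"
      obtain \<eta> where \<eta>: "\<eta> > 0" "\<And>t x. t \<in> {0..<\<eta>} \<Longrightarrow> norm (heat_op t g x - g x) \<le> e / 4"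
        using heat_op_uniformly_continuous_at_0[OF gu C, of "e / 4"] e by auto
      define \<rho> where "\<rho> = min \<eta> (e / (4 * (B + 1)))"
      have \<rho>: "\<rho> > 0" using \<eta> e B0 by (simp add: \<rho>_def)
      have "dist (U t) (U 0) < e" if t: "t \<in> {0..}" "dist t 0 < \<rho>" for t
      proof -
        have t0: "t \<ge> 0" "t < \<eta>" "t < e / (4 * (B + 1))" using t by (auto simp: \<rho>_def dist_real_def)
        have "B * t \<le> (B + 1) * (e / (4 * (B + 1)))" using t0 B0 by (intro mult_mono) auto
        also have "\<dots> = e / 4"
        proof -
          have "c * (e / (4 * c)) = e / 4" if "c > 0" for c using that by simp
          from this[of "B + 1"] show ?thesis using B0 by simp
        qed
        finally have Bt: "B * t \<le> e / 4" .
        have "dist (U t) (U 0) \<le> e / 2"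
        proof (rule U_dist)
          fix x
          have "\<bar>heat_op t g x - g x\<bar> \<le> e / 4" using \<eta>(2)[of t x] t0 by simp
          then show "\<bar>u t x - u 0 x\<bar> \<le> e / 2"
            using eq[OF t0(1), of x] dB[OF t0(1), of x] Bt unfolding h_def u0 abs_le_iff by linarith
        qed (use t0 in auto)
        then show ?thesis using e by simp
      qed
      then show "\<exists>d>0. \<forall>x'\<in>{0..}. dist x' 0 < d \<longrightarrow> dist (U x') (U 0) < e" using \<rho> by blast
    qed
    have "continuous_on {0..} U"
      unfolding continuous_on_eq_continuous_within
    proof
      fix t :: real assume "t \<in> {0..}"
      then show "continuous (at t within {0..}) U"
        using at0 U_isCont[of t] by (cases "t = 0") (auto intro: continuous_at_imp_continuous_at_within)
    qed
    then show ?thesis using True by (simp add: solution_curve_def atLeast_def)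
  next
    case False
    have "bounded (U ` {0..t})" for t
    proof -
      have "norm (U s) \<le> C + B * t" if "s \<in> {0..t}" for s
        using U_norm[of s] that B0 mult_left_mono[of s t B] by auto
      then show ?thesis unfolding bounded_iff by (intro exI[of _ "C + B * t"]) auto
    qed
    moreover have "uniform_limit K (\<lambda>t. apply_bcontfun (U t)) (\<lambda>x. complex_of_real (g x)) (at_right 0)" if K: "compact K" for K
    proof (rule uniform_limitI)
      fix e :: real assume e: "e > 0"
      have "uniformly_continuous_on ({0..1} \<times> K) (\<lambda>(t, x). u t x)"
        by (rule compact_uniformly_continuous[OF continuous_on_subset[OF u]]) (auto intro: compact_Times K)
      then obtain \<eta> where \<eta>: "\<eta> > 0"
        "\<And>p q. p \<in> {0..1} \<times> K \<Longrightarrow> q \<in> {0..1} \<times> K \<Longrightarrow> dist q p < \<eta> \<Longrightarrow> dist (case q of (t, x) \<Rightarrow> u t x) (case p of (t, x) \<Rightarrow> u t x) < e"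
        using e unfolding uniformly_continuous_on_def by metis
      have "dist (apply_bcontfun (U t) x) (complex_of_real (g x)) < e" if "0 < t" "t < min 1 \<eta>" "x \<in> K" for t x
        using \<eta>(2)[of "(0, x)" "(t, x)"] that by (simp add: dist_Pair_Pair U u0 dist_of_real dist_real_def)
      moreover have "min 1 \<eta> > 0" using \<eta>(1) by simp
      ultimately show "\<forall>\<^sub>F t in at_right 0. \<forall>x\<in>K. dist (apply_bcontfun (U t) x) (complex_of_real (g x)) < e"
        unfolding eventually_at_right_field by blast
    qed
    ultimately show ?thesis using False cont_pos by (simp add: solution_curve_def greaterThan_def)
  qed
  have "apply_bcontfun (U t) x = heat_semigroup t (\<lambda>x. complex_of_real (g x)) x +
          (LINT s:{0..t}|lborel. heat_semigroup (t - s) (\<lambda>y. riemann_zeta (apply_bcontfun (U s) y)) x)" if t: "t \<ge> 0" for t x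
  proof -
    have "heat_semigroup t (\<lambda>x. complex_of_real (g x)) x = of_real (heat_op t g x)"
      by (subst heat_semigroup_eq_heat_op)
        (use t in \<open>auto simp: heat_op_of_real intro!: borel_measurable_continuous_onI continuous_intros g\<close>)
    moreover have "(LINT s:{0..t}|lborel. heat_semigroup (t - s) (\<lambda>y. riemann_zeta (apply_bcontfun (U s) y)) x)
       = (LINT s:{0..t}|lborel. complex_of_real (heat_op (t - s) (h s) x))"
    proof (intro set_lebesgue_integral_cong ballI allI impI)
      fix s assume s: "s \<in> {0..t}"
      have "u s y \<noteq> 1" for y using d(2)[of s y] d(1) s by auto
      then have *: "(\<lambda>y. riemann_zeta (apply_bcontfun (U s) y)) = (\<lambda>y. complex_of_real (h s y))"
        using s by (auto simp: U riemann_zeta_of_real zeta h_def)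
      show "heat_semigroup (t - s) (\<lambda>y. riemann_zeta (apply_bcontfun (U s) y)) x = complex_of_real (heat_op (t - s) (h s) x)"
        unfolding * by (subst heat_semigroup_eq_heat_op)
          (use s in \<open>auto simp: heat_op_of_real intro!: borel_measurable_continuous_onI continuous_intros continuous_on_slice[OF hc]\<close>)
    qed simp
    moreover have "(LINT s:{0..t}|lborel. complex_of_real (heat_op (t - s) (h s) x)) = complex_of_real (duhamel 0 h t x)"
      unfolding duhamel_def by (subst set_integral_complex_of_real) simp
    ultimately show ?thesis using eq[OF t, of x] t by (simp add: U h_def)
  qed
  moreover have "\<exists>\<delta>>0. \<forall>s\<in>{0..t}. \<forall>x. \<delta> \<le> cmod (apply_bcontfun (U s) x - 1)" for t
  proof -
    have "cmod (complex_of_real r - 1) = \<bar>r - 1\<bar>" for r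
      using norm_of_real[of "r - 1", where 'a = complex] by simp
    then show ?thesis using d by (intro exI[of _ d]) (auto simp: U)
  qed
  ultimately have "mild_solution (\<lambda>x. complex_of_real (g x)) \<infinity> U"
    using curve unfolding mild_solution_def by auto
  then show ?thesis using U by blast
qed

text \<open>
  By uniqueness, a global mild solution extends every other mild solution with the same data.
\<close>
lemma local_solution_of_global:
  fixes U :: "real \<Rightarrow> (real ^ 'n) \<Rightarrow>\<^sub>C complex"
  assumes U: "mild_solution g \<infinity> U"
  shows "local_solution g \<infinity> U"
    and "local_solution g T v \<Longrightarrow> T = \<infinity> \<and> (\<forall>t\<ge>0. v t = U t)"
proof -
  show "local_solution g \<infinity> U"
    unfolding local_solution_def using U mild_solution_unique[OF _ U] by auto
  assume v: "local_solution g T v"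
  then have "\<infinity> \<le> T" using U unfolding local_solution_def by blast
  then have "T = \<infinity>" by simp
  moreover have "v t = U t" if "t \<ge> 0" for t
    using mild_solution_unique[OF _ U that] v \<open>T = \<infinity>\<close> unfolding local_solution_def by auto
  ultimately show "T = \<infinity> \<and> (\<forall>t\<ge>0. v t = U t)" by blast
qed

section \<open>Barriers and long-time limits\<close>

text \<open>
  The range of g is connected, so it cannot meet both sides of 1 without containing 1.
\<close>
lemma inf_dist_1_dichotomy:
  fixes g :: "real ^ 'n \<Rightarrow> real"
  assumes g: "bounded (range g)" "continuous_on UNIV g" and d: "(INF x. \<bar>g x - 1\<bar>) > 0"
  obtains (above) d where "d > 0" "\<And>x. g x \<ge> 1 + d" | (below) d where "d > 0" "\<And>x. g x \<le> 1 - d"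
proof -
  define d where "d = (INF x. \<bar>g x - 1\<bar>)"
  have d0: "d > 0" using assms(3) by (simp add: d_def)
  have far: "d \<le> \<bar>g x - 1\<bar>" for x
    unfolding d_def by (rule cINF_lower) (auto intro!: bdd_belowI[of _ 0])
  have conn: "connected (range g)"
    by (rule connected_continuous_image[OF g(2)]) (simp add: convex_connected)
  show thesis
  proof (cases "\<exists>x. g x \<ge> 1")
    case True
    then obtain x where x: "g x \<ge> 1" by blast
    have "g y \<ge> 1" for y
    proof (rule ccontr)
      assume "\<not> 1 \<le> g y"
      then have "1 \<in> range g" using connectedD_interval[OF conn, of "g y" "g x" 1] x by auto
      then obtain z where "1 = g z" by auto
      then show False using far[of z] d0 by simp
    qed
    then have "g y \<ge> 1 + d" for y using far[of y] by (smt (verit))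
    then show thesis using above d0 by blast
  next
    case False
    then have "g y \<le> 1 - d" for y using far[of y] by (smt (verit))
    then show thesis using below d0 by blast
  qed
qed

text \<open>
  On [a, b] the reaction is at least some positive constant, which dominates the speed of b - (b -
  a) exp(-c t) if c is small.
\<close>
lemma relaxing_subsolution:
  fixes F :: "real \<Rightarrow> real"
  assumes ab: "a < b" and F: "continuous_on {a..b} F" "\<And>x. x \<in> {a..b} \<Longrightarrow> F x > 0"
  obtains c where "c > 0" and "\<And>t. t \<ge> 0 \<Longrightarrow> c * (b - a) * exp (- c * t) \<le> F (b - (b - a) * exp (- c * t))"
proof -
  obtain x0 where x0: "x0 \<in> {a..b}" "\<And>x. x \<in> {a..b} \<Longrightarrow> F x0 \<le> F x"
    using continuous_attains_inf[of "{a..b}" F] ab F(1) by auto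
  define c where "c = F x0 / (b - a)"
  have c: "c > 0" using F(2)[OF x0(1)] ab by (simp add: c_def)
  have "c * (b - a) * exp (- c * t) \<le> F (b - (b - a) * exp (- c * t))" if t: "t \<ge> 0" for t
  proof -
    have e: "exp (- c * t) \<le> 1" "exp (- c * t) > 0" using c t by auto
    have "c * (b - a) * exp (- c * t) \<le> c * (b - a) * 1" using e c ab by (intro mult_left_mono) auto
    also have "\<dots> = F x0" using ab by (simp add: c_def)
    also have "\<dots> \<le> F (b - (b - a) * exp (- c * t))"
    proof (rule x0(2))
      define z where "z = (b - a) * exp (- c * t)"
      have "z \<le> (b - a) * 1" unfolding z_def using e ab by (intro mult_left_mono) auto
      moreover have "0 \<le> z" unfolding z_def using e ab by (intro mult_nonneg_nonneg) auto
      ultimately show "b - (b - a) * exp (- c * t) \<in> {a..b}" unfolding z_def[symmetric] by simp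
    qed
    finally show ?thesis .
  qed
  then show thesis using that c by blast
qed

text \<open>
  Below the equilibrium p the barriers of relaxing_subsolution climb to any point b < p.  Stopping
  short of p keeps the reaction bounded away from 0 on the way.  If the data already lie above p,
  then p itself is a subsolution.
\<close>
lemma lower_asymptotics:
  fixes u :: "real \<Rightarrow> real ^ 'n \<Rightarrow> real"
  assumes sub: "\<And>v v' V t x. v 0 \<le> i \<Longrightarrow> (\<And>t. t \<ge> 0 \<Longrightarrow> (v has_real_derivative v' t) (at t)) \<Longrightarrow>
       (\<And>t. t \<ge> 0 \<Longrightarrow> v' t \<le> F (v t)) \<Longrightarrow> (\<And>t. t \<ge> 0 \<Longrightarrow> \<bar>v t\<bar> \<le> V) \<Longrightarrow> t \<ge> 0 \<Longrightarrow> v t \<le> u t x"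
    and F: "continuous_on {i..} F" "\<And>x. i \<le> x \<Longrightarrow> x < p \<Longrightarrow> F x > 0" "F p \<ge> 0"
  shows "ereal p \<le> Liminf at_top (\<lambda>t. ereal (u t x))"
proof (cases "p \<le> i")
  case True
  have "p \<le> u t x" if "t \<ge> 0" for t
    by (rule sub[of "\<lambda>_. p" "\<lambda>_. 0" "\<bar>p\<bar>"]) (use True F that in auto)
  then show ?thesis
    by (intro Liminf_bounded) (auto intro!: eventually_mono[OF eventually_ge_at_top[of 0]])
next
  case False
  show ?thesis
    unfolding le_Liminf_iff
  proof (intro allI impI)
    fix y assume "y < ereal p"
    then obtain r where r: "y < ereal r" "ereal r < ereal p" using ereal_dense2 by blast
    define e where "e = p - r"
    have e: "e > 0" using r(2) by (simp add: e_def)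
    define b where "b = max ((i + p) / 2) (p - e / 2)"
    have "i < (i + p) / 2" "(i + p) / 2 < p" using False by auto
    then have b: "i < b" "b < p" "p - e / 2 \<le> b" using e unfolding b_def by linarith+
    obtain c where c: "c > 0" "\<And>t. t \<ge> 0 \<Longrightarrow> c * (b - i) * exp (- c * t) \<le> F (b - (b - i) * exp (- c * t))"
      by (rule relaxing_subsolution[of i b F]) (use b F in \<open>auto intro: continuous_on_subset\<close>)
    have v: "b - (b - i) * exp (- c * t) \<le> u t x" if t: "t \<ge> 0" for t
    proof (rule sub[of "\<lambda>t. b - (b - i) * exp (- c * t)" "\<lambda>t. c * (b - i) * exp (- c * t)" "\<bar>b\<bar> + (b - i)"])
      show "\<bar>b - (b - i) * exp (- c * t)\<bar> \<le> \<bar>b\<bar> + (b - i)" if "t \<ge> 0" for t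
      proof -
        define z where "z = (b - i) * exp (- c * t)"
        have "0 \<le> z" unfolding z_def using b by (intro mult_nonneg_nonneg) auto
        moreover have "z \<le> (b - i) * 1" unfolding z_def using that c b by (intro mult_left_mono) auto
        ultimately show ?thesis unfolding z_def[symmetric] using abs_triangle_ineq4[of b z] by simp
      qed
    qed (use c t in \<open>auto intro!: derivative_eq_intros\<close>)
    have "((\<lambda>t. b - (b - i) * exp (- c * t)) \<longlongrightarrow> b) at_top"
      using c(1) by real_asymp
    then have "\<forall>\<^sub>F t in at_top. b - (b - i) * exp (- c * t) > p - e"
      by (rule order_tendstoD(1)) (use b e in auto)
    then show "\<forall>\<^sub>F t in at_top. y < ereal (u t x)"
      using eventually_ge_at_top[of 0]
    proof eventually_elim
      case (elim t)
      then have "r < u t x" using v[of t] by (simp add: e_def)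
      then have "ereal r < ereal (u t x)" by simp
      with r(1) show ?case by (rule less_trans)
    qed
  qed
qed

lemma upper_asymptotics:
  fixes u :: "real \<Rightarrow> real ^ 'n \<Rightarrow> real"
  assumes super: "\<And>v v' V t x. s \<le> v 0 \<Longrightarrow> (\<And>t. t \<ge> 0 \<Longrightarrow> (v has_real_derivative v' t) (at t)) \<Longrightarrow>
       (\<And>t. t \<ge> 0 \<Longrightarrow> F (v t) \<le> v' t) \<Longrightarrow> (\<And>t. t \<ge> 0 \<Longrightarrow> \<bar>v t\<bar> \<le> V) \<Longrightarrow> t \<ge> 0 \<Longrightarrow> u t x \<le> v t"
    and F: "continuous_on {..s} F" "\<And>x. p < x \<Longrightarrow> x \<le> s \<Longrightarrow> F x < 0" "F p \<le> 0"
  shows "Limsup at_top (\<lambda>t. ereal (u t x)) \<le> ereal p"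
proof -
  have "ereal (- p) \<le> Liminf at_top (\<lambda>t. ereal (- u t x))"
  proof (rule lower_asymptotics[where i = "- s" and F = "\<lambda>x. - F (- x)"])
    fix v v' V t x
    assume v: "v 0 \<le> - s" "\<And>t. t \<ge> 0 \<Longrightarrow> (v has_real_derivative v' t) (at t)"
       "\<And>t. t \<ge> 0 \<Longrightarrow> v' t \<le> - F (- v t)" "\<And>t. t \<ge> 0 \<Longrightarrow> \<bar>v t\<bar> \<le> V" "(0 :: real) \<le> t"
    have "u t x \<le> - v t"
      by (rule super[of "\<lambda>t. - v t" "\<lambda>t. - v' t" V])
        (use v(1,3-5) in \<open>auto intro!: DERIV_minus v(2) simp: le_minus_iff\<close>)
    then show "v t \<le> - u t x" by simp
  next
    show "continuous_on {- s..} (\<lambda>x. - F (- x))"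
      by (intro continuous_intros continuous_on_compose2[OF F(1)]) auto
  qed (use F in auto)
  also have "Liminf at_top (\<lambda>t. ereal (- u t x)) = - Limsup at_top (\<lambda>t. ereal (u t x))"
    using ereal_Liminf_uminus[of at_top "\<lambda>t. ereal (u t x)"] by simp
  finally show ?thesis
    by (metis ereal_minus_le_minus ereal_uminus_uminus uminus_ereal.simps(1))
qed

lemma negative_even_greatest:
  fixes I :: real
  shows "\<exists>k\<ge>1. (GREATEST y. y \<in> {- 2 * real k |k. 1 \<le> k \<and> - 2 * real k \<le> I}) = - 2 * real k \<and> - 2 * real k \<le> I"
proof -
  define P where "P = (\<lambda>k :: nat. 1 \<le> k \<and> - 2 * real k \<le> I)"
  obtain m :: nat where "\<bar>I\<bar> \<le> real m" using real_arch_simple by blast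
  then have "P (m + 1)" by (auto simp: P_def)
  then have P: "P (LEAST k. P k)" "\<And>j. P j \<Longrightarrow> (LEAST k. P k) \<le> j" by (auto intro: LeastI Least_le)
  define k where "k = (LEAST k. P k)"
  have "(GREATEST y. y \<in> {- 2 * real k |k. 1 \<le> k \<and> - 2 * real k \<le> I}) = - 2 * real k"
    by (rule Greatest_equality) (use P in \<open>auto simp: P_def k_def\<close>)
  then show ?thesis using P by (intro exI[of _ k]) (auto simp: P_def k_def)
qed

lemma negative_even_inf:
  fixes S :: real
  assumes S: "S \<le> - 2"
  shows "\<exists>k\<ge>1. Inf {- 2 * real k |k. 1 \<le> k \<and> - 2 * real k \<ge> S} = - 2 * real k \<and> S \<le> - 2 * real k"
proof -
  define A where "A = {- 2 * real k |k. 1 \<le> k \<and> - 2 * real k \<ge> S}"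
  obtain m :: nat where m: "\<bar>S\<bar> \<le> real m" using real_arch_simple by blast
  have "A \<subseteq> (\<lambda>k. - 2 * real k) ` {..m}"
  proof
    fix y assume "y \<in> A"
    then obtain k where k: "y = - 2 * real k" "S \<le> - 2 * real k" by (auto simp: A_def)
    then have "real k \<le> real m" using m by linarith
    then show "y \<in> (\<lambda>k. - 2 * real k) ` {..m}" using k by auto
  qed
  then have fin: "finite A" using finite_surj by blast
  have "- 2 * real 1 \<in> A" unfolding A_def using S by force
  then have ne: "A \<noteq> {}" by blast
  have "Inf A \<in> A" unfolding cInf_eq_Min[OF fin ne] by (rule Min_in[OF fin ne])
  then show ?thesis unfolding A_def by auto
qed

section \<open>Global solutions on either side of the pole\<close>

text \<open>
  Zeta with its argument cut off at I takes values in [1, zeta(I)], so the Duhamel formula itself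
  gives the bounds, and they make the cut-off invisible.
\<close>
lemma global_solution_above_1:
  fixes g :: "real ^ 'n \<Rightarrow> real" and S I :: real
  assumes g: "continuous_on UNIV g" and C: "\<And>y. norm (g y) \<le> C"
    and I: "I > 1" "\<And>x. I \<le> g x" and S: "\<And>x. g x \<le> S"
  shows "\<exists>U. mild_solution (\<lambda>x. complex_of_real (g x)) \<infinity> U \<and>
    (\<forall>t\<ge>0. \<forall>x. apply_bcontfun (U t) x \<in> \<real> \<and> t + I \<le> Re (apply_bcontfun (U t) x) \<and>
       Re (apply_bcontfun (U t) x) \<le> real_zeta I * t + S)"
proof -
  define F where "F = (\<lambda>x. real_zeta (max x I))"
  obtain L where L: "L > 0" "\<And>x y. x \<ge> I \<Longrightarrow> y \<ge> I \<Longrightarrow> \<bar>real_zeta x - real_zeta y\<bar> \<le> L * \<bar>x - y\<bar>"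
    using real_zeta_Lipschitz_right[OF I(1)] by blast
  have F_bounds: "1 \<le> F x" "F x \<le> real_zeta I" for x
    unfolding F_def using I(1) by (auto intro!: real_zeta_ge_1 real_zeta_antimono)
  interpret lipschitz_reaction F L "real_zeta I"
  proof
    show "\<bar>F x - F y\<bar> \<le> L * \<bar>x - y\<bar>" for x y
    proof -
      have "\<bar>F x - F y\<bar> \<le> L * \<bar>max x I - max y I\<bar>" unfolding F_def by (rule L(2)) auto
      also have "\<dots> \<le> L * \<bar>x - y\<bar>" using L(1) by (intro mult_left_mono) (auto simp: max_def)
      finally show ?thesis .
    qed
    show "\<bar>F x\<bar> \<le> real_zeta I" for x using F_bounds[of x] by simp
  qed (rule L(1))
  obtain u where u: "continuous_on UNIV (\<lambda>(t, x). u t x)"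
    and eq: "\<And>t x. t \<ge> 0 \<Longrightarrow> u t x = heat_op t g x + duhamel 0 (\<lambda>s y. F (u s y)) t x"
    by (rule global_solution_exists[OF g C]) blast
  have hc: "continuous_on UNIV (\<lambda>(s, y). F (u s y))"
    unfolding split_beta by (intro F_continuous_on_compose u[unfolded split_beta])
  have hB: "norm (F (u s y)) \<le> real_zeta I" for s y using FB by simp
  have const: "duhamel 0 (\<lambda>s (y :: real ^ 'n). c) t x = c * t" if "t \<ge> 0" for c t :: real and x
    using that by (simp add: duhamel_space_const set_lebesgue_integral_def)
  have bounds: "t + I \<le> u t x" "u t x \<le> real_zeta I * t + S" if t: "t \<ge> 0" for t x
  proof -
    have "I \<le> heat_op t g x" "heat_op t g x \<le> S"
      using heat_op_ge_const[OF g C I(2)] heat_op_le_const[OF g C S] by auto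
    moreover have "1 * t \<le> duhamel 0 (\<lambda>s y. F (u s y)) t x"
      unfolding const[OF t, of 1 x, symmetric]
      by (rule duhamel_mono[OF _ _ hc hB, of _ 1]) (use F_bounds in auto)
    moreover have "duhamel 0 (\<lambda>s y. F (u s y)) t x \<le> real_zeta I * t"
      unfolding const[OF t, of "real_zeta I" x, symmetric]
      by (rule duhamel_mono[OF hc hB, of _ "\<bar>real_zeta I\<bar>"]) (use F_bounds in auto)
    ultimately show "t + I \<le> u t x" "u t x \<le> real_zeta I * t + S" using eq[OF t, of x] by auto
  qed
  have "\<exists>U. mild_solution (\<lambda>x. complex_of_real (g x)) \<infinity> U \<and> (\<forall>t\<ge>0. \<forall>x. apply_bcontfun (U t) x = of_real (u t x))"
  proof (rule mild_solution_of_real_solution[OF g C u eq, of "I - 1"])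
    show "I - 1 \<le> \<bar>u t x - 1\<bar>" if "t \<ge> 0" for t x using bounds(1)[OF that, of x] that I(1) by simp
    show "real_zeta (u t x) = F (u t x)" if "t \<ge> 0" for t x
      using bounds(1)[OF that, of x] that by (simp add: F_def max_absorb1)
  qed (use I(1) in auto)
  then show ?thesis using bounds by auto
qed

text \<open>
  Zeta is clamped to [lo, hi].  The constants lo and hi are a sub- and a supersolution, because zeta
  vanishes at lo and is at most 0 at hi.  For the limits, clamping must not change the signs of zeta
  between the data and the attracting equilibrium p = -4 n + 2.  This holds because lo and hi are
  even integers or hi = S > -2: if I < p then hi \<ge> p, and if S > p then lo \<le> p.
\<close>
lemma global_solution_below_1:
  fixes g :: "real ^ 'n \<Rightarrow> real" and S I lo hi :: real and k1 :: nat
  assumes g: "continuous_on UNIV g" and C: "\<And>y. norm (g y) \<le> C"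
    and IS: "\<And>x. I \<le> g x" "\<And>x. g x \<le> S" "S < 1"
    and lo: "lo = - 2 * real k1" "k1 \<ge> 1" "lo \<le> I"
    and hi: "S \<le> hi" "(hi = S \<and> - 2 < S) \<or> (\<exists>k\<ge>1. hi = - 2 * real k)"
  shows "\<exists>U. mild_solution (\<lambda>x. complex_of_real (g x)) \<infinity> U \<and>
    (\<forall>t\<ge>0. \<forall>x. apply_bcontfun (U t) x \<in> \<real> \<and> lo \<le> Re (apply_bcontfun (U t) x) \<and> Re (apply_bcontfun (U t) x) \<le> hi) \<and>
    (\<forall>n1 \<ge> (1 :: nat). I \<in> {- 4 * real n1<..<- 4 * real n1 + 4} \<longrightarrow>
       (\<forall>x. ereal (- 4 * real n1 + 2) \<le> Liminf at_top (\<lambda>t. ereal (Re (apply_bcontfun (U t) x))))) \<and>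
    (\<forall>n2 \<ge> (1 :: nat). S \<in> {- 4 * real n2<..<- 4 * real n2 + 4} \<longrightarrow>
       (\<forall>x. Limsup at_top (\<lambda>t. ereal (Re (apply_bcontfun (U t) x))) \<le> ereal (- 4 * real n2 + 2)))"
proof -
  have even_zero: "real_zeta (- 4 * real n + 2) = 0" if "n \<ge> 1" for n :: nat
    using real_zeta_even_negative[of "2 * n - 1"] that by (simp add: of_nat_diff algebra_simps)
  have IS': "I \<le> S" using IS(1,2) order_trans by blast
  have lohi: "lo \<le> hi" "hi < 1" using lo(3) IS' hi IS(3) by auto
  have zlo: "real_zeta lo = 0" using real_zeta_even_negative[OF lo(2)] lo(1) by simp
  have zhi: "real_zeta hi \<le> 0"
    using hi(2) real_zeta_even_negative real_zeta_neg_near_zero[of S] IS(3) by (auto intro: less_imp_le)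
  define clamp where "clamp = (\<lambda>x. max lo (min hi x))"
  have clamp: "clamp x \<in> {lo..hi}" "\<bar>clamp x - clamp y\<bar> \<le> \<bar>x - y\<bar>" for x y
    using lohi(1) by (auto simp: clamp_def max_def min_def)
  have clamp_id: "clamp x = x" if "lo \<le> x" "x \<le> hi" for x using that by (simp add: clamp_def)
  define F where "F = (\<lambda>x. real_zeta (clamp x))"
  obtain L where L: "L > 0" "\<And>x y. x \<in> {lo..hi} \<Longrightarrow> y \<in> {lo..hi} \<Longrightarrow> \<bar>real_zeta x - real_zeta y\<bar> \<le> L * \<bar>x - y\<bar>"
    using real_zeta_Lipschitz_compact[OF lohi(2), of lo] by blast
  interpret lipschitz_reaction F L "L * (hi - lo)"
  proof
    show "\<bar>F x - F y\<bar> \<le> L * \<bar>x - y\<bar>" for x y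
    proof -
      have "\<bar>F x - F y\<bar> \<le> L * \<bar>clamp x - clamp y\<bar>" unfolding F_def by (rule L(2)[OF clamp(1) clamp(1)])
      also have "\<dots> \<le> L * \<bar>x - y\<bar>" using L(1) clamp(2) by (intro mult_left_mono) auto
      finally show ?thesis .
    qed
    show "\<bar>F x\<bar> \<le> L * (hi - lo)" for x
    proof -
      have "\<bar>real_zeta (clamp x) - real_zeta lo\<bar> \<le> L * \<bar>clamp x - lo\<bar>"
        using clamp(1)[of x] lohi(1) by (intro L(2)) auto
      also have "\<dots> \<le> L * (hi - lo)" using clamp(1)[of x] L(1) by (intro mult_left_mono) auto
      finally show ?thesis by (simp add: F_def zlo)
    qed
  qed (rule L(1))
  obtain u where u: "continuous_on UNIV (\<lambda>(t, x). u t x)"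
    and eq: "\<And>t x. t \<ge> 0 \<Longrightarrow> u t x = heat_op t g x + duhamel 0 (\<lambda>s y. F (u s y)) t x"
    and sub: "\<And>v v' V t x. (\<And>x. v 0 \<le> g x) \<Longrightarrow> (\<And>t. t \<ge> 0 \<Longrightarrow> (v has_real_derivative v' t) (at t)) \<Longrightarrow>
       (\<And>t. t \<ge> 0 \<Longrightarrow> v' t \<le> F (v t)) \<Longrightarrow> (\<And>t. t \<ge> 0 \<Longrightarrow> \<bar>v t\<bar> \<le> V) \<Longrightarrow> t \<ge> 0 \<Longrightarrow> v t \<le> u t x"
    and super: "\<And>v v' V t x. (\<And>x. g x \<le> v 0) \<Longrightarrow> (\<And>t. t \<ge> 0 \<Longrightarrow> (v has_real_derivative v' t) (at t)) \<Longrightarrow>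
       (\<And>t. t \<ge> 0 \<Longrightarrow> F (v t) \<le> v' t) \<Longrightarrow> (\<And>t. t \<ge> 0 \<Longrightarrow> \<bar>v t\<bar> \<le> V) \<Longrightarrow> t \<ge> 0 \<Longrightarrow> u t x \<le> v t"
    by (rule global_solution_exists[OF g C]) blast
  have bounds: "lo \<le> u t x" "u t x \<le> hi" if t: "t \<ge> 0" for t x
  proof -
    show "lo \<le> u t x"
    proof (rule sub[of "\<lambda>_. lo" "\<lambda>_. 0" "\<bar>lo\<bar>"])
      show "lo \<le> g x" for x using lo(3) IS(1)[of x] by simp
    qed (use lohi zlo t in \<open>auto simp: F_def clamp_id\<close>)
    show "u t x \<le> hi"
    proof (rule super[of "\<lambda>_. hi" "\<lambda>_. 0" "\<bar>hi\<bar>"])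
      show "g x \<le> hi" for x using hi(1) IS(2)[of x] by simp
    qed (use lohi zhi t in \<open>auto simp: F_def clamp_id\<close>)
  qed
  obtain U where U: "mild_solution (\<lambda>x. complex_of_real (g x)) \<infinity> U" "\<And>t x. t \<ge> 0 \<Longrightarrow> apply_bcontfun (U t) x = of_real (u t x)"
  proof -
    have "\<exists>U. mild_solution (\<lambda>x. complex_of_real (g x)) \<infinity> U \<and> (\<forall>t\<ge>0. \<forall>x. apply_bcontfun (U t) x = of_real (u t x))"
    proof (rule mild_solution_of_real_solution[OF g C u eq, of "1 - hi"])
      show "1 - hi \<le> \<bar>u t x - 1\<bar>" if "t \<ge> 0" for t x using bounds(2)[OF that, of x] by simp
      show "real_zeta (u t x) = F (u t x)" if "t \<ge> 0" for t x
        using bounds[OF that, of x] by (simp add: F_def clamp_id)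
    qed (use lohi(2) in auto)
    then show thesis using that by blast
  qed
  have ReU: "\<forall>\<^sub>F t in at_top. ereal (Re (apply_bcontfun (U t) x)) = ereal (u t x)" for x
    using eventually_ge_at_top[of 0] by eventually_elim (simp add: U(2))
  have inf: "ereal (- 4 * real n1 + 2) \<le> Liminf at_top (\<lambda>t. ereal (Re (apply_bcontfun (U t) x)))"
    if n1: "n1 \<ge> 1" "I \<in> {- 4 * real n1<..<- 4 * real n1 + 4}" for n1 :: nat and x
  proof -
    define p where "p = - 4 * real n1 + 2"
    have p_hi: "p \<le> hi"
    proof (cases "hi = S \<and> - 2 < S")
      case True
      then show ?thesis using n1(1) by (simp add: p_def)
    next
      case False
      then obtain k :: nat where k: "k \<ge> 1" "hi = - 2 * real k" using hi(2) by blast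
      then have "2 * real k < 4 * real n1" using n1(2) IS' hi(1) by auto
      then have "k < 2 * n1" by linarith
      then have "real k \<le> real (2 * n1 - 1)" by simp
      then show ?thesis using k(2) n1(1) by (simp add: p_def of_nat_diff)
    qed
    have Fp: "F p = 0"
    proof (cases "lo \<le> p")
      case True
      then show ?thesis using p_hi even_zero[OF n1(1)] by (simp add: F_def clamp_id p_def)
    next
      case False
      then have "clamp p = lo" using lohi(1) by (simp add: clamp_def)
      then show ?thesis by (simp add: F_def zlo)
    qed
    have "ereal p \<le> Liminf at_top (\<lambda>t. ereal (u t x))"
    proof (rule lower_asymptotics[of I F])
      show "v t \<le> u t x" if "v 0 \<le> I" "\<And>t. 0 \<le> t \<Longrightarrow> (v has_real_derivative v' t) (at t)"
        "\<And>t. 0 \<le> t \<Longrightarrow> v' t \<le> F (v t)" "\<And>t. 0 \<le> t \<Longrightarrow> \<bar>v t\<bar> \<le> V" "0 \<le> t" for v v' V t x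
        by (rule sub[OF order_trans[OF that(1) IS(1)] that(2) that(3) that(4) that(5)])
      show "continuous_on {I..} F" by (rule continuous_F)
      show "F x > 0" if "I \<le> x" "x < p" for x
        using that lo(3) p_hi n1 real_zeta_pos[OF n1(1), of x] by (simp add: F_def clamp_id p_def)
    qed (simp add: Fp)
    then show ?thesis unfolding Liminf_eq[OF ReU] p_def .
  qed
  have sup: "Limsup at_top (\<lambda>t. ereal (Re (apply_bcontfun (U t) x))) \<le> ereal (- 4 * real n2 + 2)"
    if n2: "n2 \<ge> 1" "S \<in> {- 4 * real n2<..<- 4 * real n2 + 4}" for n2 :: nat and x
  proof -
    define p where "p = - 4 * real n2 + 2"
    have p_lo: "lo \<le> p"
    proof -
      have "4 * real n2 - 4 < 2 * real k1" using n2(2) IS' lo by auto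
      then have "2 * n2 < k1 + 2" by linarith
      then have "real (2 * n2) \<le> real (k1 + 1)" by simp
      then show ?thesis by (simp add: p_def lo(1))
    qed
    have Fp: "F p \<le> 0"
    proof (cases "p \<le> hi")
      case True
      then show ?thesis using p_lo even_zero[OF n2(1)] by (simp add: F_def clamp_id p_def)
    next
      case False
      then have "clamp p = hi" using lohi(1) by (simp add: clamp_def)
      then show ?thesis by (simp add: F_def zhi)
    qed
    have "Limsup at_top (\<lambda>t. ereal (u t x)) \<le> ereal p"
    proof (rule upper_asymptotics[of S F])
      show "u t x \<le> v t" if "S \<le> v 0" "\<And>t. 0 \<le> t \<Longrightarrow> (v has_real_derivative v' t) (at t)"
        "\<And>t. 0 \<le> t \<Longrightarrow> F (v t) \<le> v' t" "\<And>t. 0 \<le> t \<Longrightarrow> \<bar>v t\<bar> \<le> V" "0 \<le> t" for v v' V t x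
        by (rule super[OF order_trans[OF IS(2) that(1)] that(2) that(3) that(4) that(5)])
      show "continuous_on {..S} F" by (rule continuous_F)
      show "F x < 0" if "p < x" "x \<le> S" for x
        using that hi(1) p_lo n2 real_zeta_neg[OF n2(1), of x] by (simp add: F_def clamp_id p_def)
    qed (rule Fp)
    then show ?thesis unfolding Limsup_eq[OF ReU] p_def .
  qed
  show ?thesis using U bounds inf sup by (intro exI[of _ U]) auto
qed

theorem theorem1p6:
  fixes g :: "real ^ 'n \<Rightarrow> real" and S I :: real
  assumes "bounded (range g)" and "continuous_on UNIV g"
    and "(INF x. \<bar>g x - 1\<bar>) > 0"
    and "S = (SUP x. g x)" and "I = (INF x. g x)"
  shows "(\<exists>T u. local_solution (\<lambda>x. complex_of_real (g x)) T u) \<and>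
    (\<forall>T u. local_solution (\<lambda>x. complex_of_real (g x)) T u \<longrightarrow>
       T = \<infinity> \<and>
       (\<forall>t\<ge>0. \<forall>x. apply_bcontfun (u t) x \<in> \<real>) \<and>
       (I > 1 \<longrightarrow>
          (\<forall>t\<ge>0. \<forall>x. t + I \<le> Re (apply_bcontfun (u t) x) \<and>
             Re (apply_bcontfun (u t) x) \<le> Re (riemann_zeta (complex_of_real I)) * t + S)) \<and>
       (I < 1 \<longrightarrow>
          (\<forall>k1 k2 :: real.
             - 2 * k1 = (GREATEST y. y \<in> {- 2 * real k |k. 1 \<le> k \<and> - 2 * real k \<le> I}) \<longrightarrow>
             - 2 * k2 = (if S \<le> - 2 then Inf {- 2 * real k |k. 1 \<le> k \<and> - 2 * real k \<ge> S}
                         else S) \<longrightarrow>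
             (\<forall>t\<ge>0. \<forall>x. - 2 * k1 \<le> Re (apply_bcontfun (u t) x) \<and>
                Re (apply_bcontfun (u t) x) \<le> - 2 * k2))) \<and>
       (I < 1 \<longrightarrow>
          (\<forall>n1 n2 :: nat. n1 \<ge> 1 \<longrightarrow> n2 \<ge> 1 \<longrightarrow>
             I \<in> {- 4 * real n1 <..< - 4 * real n1 + 4} \<longrightarrow>
             S \<in> {- 4 * real n2 <..< - 4 * real n2 + 4} \<longrightarrow>
             (\<forall>x. ereal (- 4 * real n1 + 2)
                    \<le> Liminf at_top (\<lambda>t. ereal (Re (apply_bcontfun (u t) x))) \<and>
                  Liminf at_top (\<lambda>t. ereal (Re (apply_bcontfun (u t) x)))
                    \<le> Limsup at_top (\<lambda>t. ereal (Re (apply_bcontfun (u t) x))) \<and>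
                  Limsup at_top (\<lambda>t. ereal (Re (apply_bcontfun (u t) x)))
                    \<le> ereal (- 4 * real n2 + 2)))))"
proof -
  let ?g = "\<lambda>x. complex_of_real (g x)"
  note g = assms(2)
  obtain C where "\<forall>r\<in>range g. norm r \<le> C" using assms(1) unfolding bounded_iff by blast
  then have C: "norm (g y) \<le> C" for y by blast
  have gS: "g x \<le> S" and gI: "I \<le> g x" for x
    unfolding assms(4,5) using assms(1)
    by (auto intro!: cSUP_upper cINF_lower bounded_imp_bdd_above bounded_imp_bdd_below)
  have zI: "Re (riemann_zeta (complex_of_real I)) = real_zeta I" by (simp add: real_zeta_def)
  consider (above) "I > 1" | (below) "I < 1" "S < 1"
  proof (rule inf_dist_1_dichotomy[OF assms(1,2,3)])
    fix d assume d: "d > 0" "\<And>x. g x \<ge> 1 + d"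
    then have "I \<ge> 1 + d" unfolding assms(5) by (intro cINF_greatest) auto
    then show thesis using that(1) d(1) by simp
  next
    fix d assume d: "d > 0" "\<And>x. g x \<le> 1 - d"
    then have "S \<le> 1 - d" unfolding assms(4) by (intro cSUP_least) auto
    moreover have "I \<le> S" using gI gS order_trans by blast
    ultimately show thesis using that(2) d(1) by simp
  qed
  then show ?thesis
  proof cases
    case above
    obtain U where U: "mild_solution ?g \<infinity> U"
      and b: "\<And>t x. t \<ge> 0 \<Longrightarrow> apply_bcontfun (U t) x \<in> \<real> \<and> t + I \<le> Re (apply_bcontfun (U t) x) \<and> Re (apply_bcontfun (U t) x) \<le> real_zeta I * t + S"
      using global_solution_above_1[OF g C above gI gS] by blast
    have ex: "\<exists>T u. local_solution ?g T u" using local_solution_of_global(1)[OF U] by blast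
    show ?thesis
    proof (rule conjI[OF ex], rule allI, rule allI, rule impI, intro conjI)
      fix T u assume ls: "local_solution ?g T u"
      have T: "T = \<infinity>" and u: "\<And>t. t \<ge> 0 \<Longrightarrow> u t = U t"
        using local_solution_of_global(2)[OF U ls] by auto
      show "T = \<infinity>" by (rule T)
      show "\<forall>t\<ge>0. \<forall>x. apply_bcontfun (u t) x \<in> \<real>" using b u by simp
      show "I > 1 \<longrightarrow>
          (\<forall>t\<ge>0. \<forall>x. t + I \<le> Re (apply_bcontfun (u t) x) \<and>
             Re (apply_bcontfun (u t) x) \<le> Re (riemann_zeta (complex_of_real I)) * t + S)"
        using b u zI by simp
    qed (use above in auto)
  next
    case below
    obtain m :: nat where m: "m \<ge> 1"
      "(GREATEST y. y \<in> {- 2 * real k |k. 1 \<le> k \<and> - 2 * real k \<le> I}) = - 2 * real m" "- 2 * real m \<le> I"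
      using negative_even_greatest[of I] by blast
    define hi where "hi = (if S \<le> - 2 then Inf {- 2 * real k |k. 1 \<le> k \<and> - 2 * real k \<ge> S} else S)"
    have hi: "S \<le> hi" "(hi = S \<and> - 2 < S) \<or> (\<exists>k\<ge>1. hi = - 2 * real k)"
      using negative_even_inf[of S] unfolding hi_def by auto
    obtain U where U: "mild_solution ?g \<infinity> U"
      and b: "\<And>t x. t \<ge> 0 \<Longrightarrow> apply_bcontfun (U t) x \<in> \<real> \<and> - 2 * real m \<le> Re (apply_bcontfun (U t) x) \<and> Re (apply_bcontfun (U t) x) \<le> hi"
      and inf: "\<And>n1 :: nat. n1 \<ge> 1 \<Longrightarrow> I \<in> {- 4 * real n1<..<- 4 * real n1 + 4} \<Longrightarrow>
        (\<forall>x. ereal (- 4 * real n1 + 2) \<le> Liminf at_top (\<lambda>t. ereal (Re (apply_bcontfun (U t) x))))"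
      and sup: "\<And>n2 :: nat. n2 \<ge> 1 \<Longrightarrow> S \<in> {- 4 * real n2<..<- 4 * real n2 + 4} \<Longrightarrow>
        (\<forall>x. Limsup at_top (\<lambda>t. ereal (Re (apply_bcontfun (U t) x))) \<le> ereal (- 4 * real n2 + 2))"
      using global_solution_below_1[OF g C gI gS below(2) refl m(1,3) hi] by blast
    have ex: "\<exists>T u. local_solution ?g T u" using local_solution_of_global(1)[OF U] by blast
    show ?thesis
    proof (rule conjI[OF ex], rule allI, rule allI, rule impI, intro conjI)
      fix T u assume ls: "local_solution ?g T u"
      have T: "T = \<infinity>" and u: "\<And>t. t \<ge> 0 \<Longrightarrow> u t = U t"
        using local_solution_of_global(2)[OF U ls] by auto
      show "T = \<infinity>" by (rule T)
      show "\<forall>t\<ge>0. \<forall>x. apply_bcontfun (u t) x \<in> \<real>" using b u by simp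
      show "I < 1 \<longrightarrow>
        (\<forall>k1 k2 :: real.
           - 2 * k1 = (GREATEST y. y \<in> {- 2 * real k |k. 1 \<le> k \<and> - 2 * real k \<le> I}) \<longrightarrow>
           - 2 * k2 = (if S \<le> - 2 then Inf {- 2 * real k |k. 1 \<le> k \<and> - 2 * real k \<ge> S}
                       else S) \<longrightarrow>
           (\<forall>t\<ge>0. \<forall>x. - 2 * k1 \<le> Re (apply_bcontfun (u t) x) \<and>
              Re (apply_bcontfun (u t) x) \<le> - 2 * k2))"
      proof (intro impI allI)
        fix k1 k2 t :: real and x
        assume k: "- 2 * k1 = (GREATEST y. y \<in> {- 2 * real k |k. 1 \<le> k \<and> - 2 * real k \<le> I})"
          "- 2 * k2 = (if S \<le> - 2 then Inf {- 2 * real k |k. 1 \<le> k \<and> - 2 * real k \<ge> S} else S)" and t: "0 \<le> t"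
        show "- 2 * k1 \<le> Re (apply_bcontfun (u t) x) \<and> Re (apply_bcontfun (u t) x) \<le> - 2 * k2"
          unfolding k hi_def[symmetric] m(2) using b[OF t, of x] u[OF t] by simp
      qed
      have ev: "\<forall>\<^sub>F t in at_top. ereal (Re (apply_bcontfun (u t) x)) = ereal (Re (apply_bcontfun (U t) x))" for x
        using eventually_ge_at_top[of 0] by eventually_elim (simp add: u)
      show "I < 1 \<longrightarrow>
        (\<forall>n1 n2 :: nat. n1 \<ge> 1 \<longrightarrow> n2 \<ge> 1 \<longrightarrow>
           I \<in> {- 4 * real n1 <..< - 4 * real n1 + 4} \<longrightarrow>
           S \<in> {- 4 * real n2 <..< - 4 * real n2 + 4} \<longrightarrow>
           (\<forall>x. ereal (- 4 * real n1 + 2)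
                  \<le> Liminf at_top (\<lambda>t. ereal (Re (apply_bcontfun (u t) x))) \<and>
                Liminf at_top (\<lambda>t. ereal (Re (apply_bcontfun (u t) x)))
                  \<le> Limsup at_top (\<lambda>t. ereal (Re (apply_bcontfun (u t) x))) \<and>
                Limsup at_top (\<lambda>t. ereal (Re (apply_bcontfun (u t) x)))
                  \<le> ereal (- 4 * real n2 + 2)))"
      proof (intro impI allI conjI)
        fix n1 n2 :: nat and x
        assume n: "n1 \<ge> 1" "n2 \<ge> 1" "I \<in> {- 4 * real n1 <..< - 4 * real n1 + 4}" "S \<in> {- 4 * real n2 <..< - 4 * real n2 + 4}"
        show "ereal (- 4 * real n1 + 2) \<le> Liminf at_top (\<lambda>t. ereal (Re (apply_bcontfun (u t) x)))"
          unfolding Liminf_eq[OF ev] using inf[OF n(1,3)] by blast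
        show "Limsup at_top (\<lambda>t. ereal (Re (apply_bcontfun (u t) x))) \<le> ereal (- 4 * real n2 + 2)"
          unfolding Limsup_eq[OF ev] using sup[OF n(2,4)] by blast
        show "Liminf at_top (\<lambda>t. ereal (Re (apply_bcontfun (u t) x))) \<le> Limsup at_top (\<lambda>t. ereal (Re (apply_bcontfun (u t) x)))"
          by (rule Liminf_le_Limsup) simp
      qed
    qed (use below in auto)
  qed
qed

end
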